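(* Let $\mathbb L(\lambda)=\mathbb M_{\tau_1}(Y_1)\,\mathbb M_{\sigma_1}(X_1)\,(\lambda\mathbb M^{\mathcal S}_\tau-\mathbb M^{\mathcal S}_\sigma)\,\mathbb M_{\sigma_2}(X_2)\,\mathbb M_{\tau_2}(Y_2)$ be a GFPR of $G(\lambda)$, where all the matrix assignments $X_1,X_2,Y_1,Y_2$ are nonsingular. Then $\mathbb L(\lambda)$ is a Rosenbrock strong linearization of $G(\lambda)$.
   Context: Setting: $P(\lambda)=\sum_{i=0}^m\lambda^iA_i$ with $A_i\in\mathbb C^{n\times n}$, $A_m\neq0$, $m\ge1$; $G(\lambda)=P(\lambda)+C(\lambda E-A)^{-1}B$ is a minimal realization ($r$ smallest possible) with $A,E\in\mathbb C^{r\times r}$, $E$ nonsingular, $C\in\mathbb C^{n\times r}$, $B\in\mathbb C^{r\times n}$; system matrix $\mathcal S(\lambda)=\left[\begin{array}{c|c}P(\lambda)&C\\ \hline B&A-\lambda E\end{array}\right]$. $e_j$ is the $j$-th column of $I_m$. Elementary matrices: for $X\in\mathbb C^{n\times n}$, $M_0(X)=\mathrm{diag}(I_{(m-1)n},X)$, $M_{-m}(X)=\mathrm{diag}(X,I_{(m-1)n})$, and for $1\le i\le m-1$, $M_i(X)=\mathrm{diag}\big(I_{(m-i-1)n},\begin{bmatrix}X&I_n\\ I_n&0\end{bmatrix},I_{(i-1)n}\big)$, $M_{-i}(X)=\mathrm{diag}\big(I_{(m-i-1)n},\begin{bmatrix}0&I_n\\ I_n&X\end{bmatrix},I_{(i-1)n}\big)$.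 For $i\in\{-m,\dots,m-1\}$: $\mathbb M_i(X)=\mathrm{diag}(M_i(X),I_r)$; $M_i^P=M_i(-A_i)$ if $i\ge0$, $M_i^P=M_i(A_{-i})$ if $i<0$. Fiedler matrices: $\mathbb M_0^{\mathcal S}=\left[\begin{array}{c|c}M_0^P&-e_m\otimes C\\ \hline -e_m^T\otimes B&-A\end{array}\right]$, $\mathbb M_{-m}^{\mathcal S}=\mathrm{diag}(M_{-m}^P,-E)$, $\mathbb M_i^{\mathcal S}=\mathrm{diag}(M_i^P,I_r)$ and $\mathbb M_{-i}^{\mathcal S}=(\mathbb M_i^{\mathcal S})^{-1}$ for $1\le i\le m-1$. Index tuples: $\mathbf t=(t_1,\dots,t_k)$ is an ordered tuple of integers (possibly empty); permutations of finite sets are regarded as tuples; $(\alpha,\beta)$ is concatenation. A matrix assignment for $\mathbf t$ is a tuple $X=(X_1,\dots,X_k)$ of $n\times n$ matrices; it is nonsingular if the matrices assigned to positions of $\mathbf t$ occupied by the indices $0$ and $-m$ are nonsingular. $\mathbb M_{\mathbf t}(X)=\mathbb M_{t_1}(X_1)\cdots\mathbb M_{t_k}(X_k)$, $\mathbb M^{\mathcal S}_{\mathbf t}=\mathbb M^{\mathcal S}_{t_1}\cdots\mathbb M^{\mathcal S}_{t_k}$ (empty product $=$ identity). $\mathbf t$ satisfies the SIP if whenever $t_a=t_b$ with $a<b$ there is $c$ with $a<c<b$ and $t_c=t_a+1$. GFPR of $G(\lambda)$: a pencil of the form displayed in the claim, where $0\le h\le m-1$; $\sigma,\tau$ are permutations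 of $\{0,\dots,h\}$ and $\{-m,\dots,-h-1\}$; $\sigma_1,\sigma_2$ are index tuples from $\{0,\dots,h-1\}$ with $(\sigma_1,\sigma,\sigma_2)$ satisfying the SIP; $\tau_1,\tau_2$ are index tuples from $\{-m,\dots,-h-2\}$ with $(\tau_1,\tau,\tau_2)$ satisfying the SIP; $X_1,X_2,Y_1,Y_2$ are matrix assignments for $\sigma_1,\sigma_2,\tau_1,\tau_2$. A matrix polynomial is unimodular if its determinant is a nonzero constant. A square rational matrix $F(\lambda)$ is biproper if $\lim_{\lambda\to\infty}F(\lambda)$ exists and is nonsingular. Rosenbrock strong linearization: an $(mn+r)\times(mn+r)$ pencil $\mathbb L(\lambda)=\left[\begin{array}{c|c}\mathcal X-\lambda\mathcal Y&\mathcal C\\ \hline\mathcal B&H-\lambda K\end{array}\right]$, with $H-\lambda K$ of size $r\times r$, $K$ nonsingular, and irreducible (i.e. $[\mathcal B\ \ H-\lambda K]$ and $\begin{bmatrix}\mathcal C\\ H-\lambda K\end{bmatrix}$ have rank $r$ for all $\lambda\in\mathbb C$), is a Rosenbrock strong linearization of $G(\lambda)$ if (i) $\mathrm{diag}(U(\lambda),U_0)\,\mathbb L(\lambda)\,\mathrm{diag}(V(\lambda),V_0)=\mathrm{diag}(I_{(m-1)n},\mathcal S(\lambda))$ for some $mn\times mn$ unimodular $U,V$ and nonsingular $U_0,V_0\in\mathbb C^{r\times r}$; and (ii) $\mathcal O_\ell(\lambda)\,\lambda^{-1}\mathbb G(\lambda)\,\mathcal O_r(\lambda)=\mathrm{diag}(I_{(m-1)n},\lambda^{-m}G(\lambda))$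 for some $mn\times mn$ biproper $\mathcal O_\ell,\mathcal O_r$, where $\mathbb G(\lambda)=\mathcal X-\lambda\mathcal Y+\mathcal C(\lambda K-H)^{-1}\mathcal B$ is the transfer function of $\mathbb L(\lambda)$. *)

theory Defs
  imports
    "HOL-Computational_Algebra.Computational_Algebra"
    "HOL-Computational_Algebra.Field_as_Ring"
    "Jordan_Normal_Form.Determinant"
    "Jordan_Normal_Form.Gauss_Jordan_Elimination"
    "Jordan_Normal_Form.DL_Rank"
begin

text \<open>
  Constant matrices have type \<open>complex mat\<close>, matrix polynomials \<open>complex poly mat\<close>, and
  rational matrices \<open>complex poly fract mat\<close>; the indeterminate is \<open>[:0, 1:]\<close>.
\<close>

abbreviation const_mat :: "complex mat \<Rightarrow> complex poly mat" where
  "const_mat \<equiv> map_mat (\<lambda>c. [:c:])"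

abbreviation rat_mat :: "complex poly mat \<Rightarrow> complex poly fract mat" where
  "rat_mat \<equiv> map_mat to_fract"

definition lam :: "complex poly" where
  "lam = [:0, 1:]"

definition mat_inv :: "'a::field mat \<Rightarrow> 'a mat" where
  "mat_inv M = the (mat_inverse M)"

definition kronecker :: "'a::semiring_0 mat \<Rightarrow> 'a mat \<Rightarrow> 'a mat" (infixl "\<otimes>\<^sub>k" 70) where
  "M \<otimes>\<^sub>k N = mat (dim_row M * dim_row N) (dim_col M * dim_col N)
     (\<lambda>(i, j). M $$ (i div dim_row N, j div dim_col N) * N $$ (i mod dim_row N, j mod dim_col N))"

text \<open>The matrix \<open>[M N]\<close>, the column counterpart of \<open>@\<^sub>r\<close>.\<close>

definition append_cols :: "'a::zero mat \<Rightarrow> 'a mat \<Rightarrow> 'a mat" (infixr "@\<^sub>c" 65) where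
  "M @\<^sub>c N = four_block_mat M N (0\<^sub>m 0 (dim_col M)) (0\<^sub>m 0 (dim_col N))"

definition mat_prod :: "nat \<Rightarrow> 'a::semiring_1 mat list \<Rightarrow> 'a mat" where
  "mat_prod N Ms = foldr (*) Ms (1\<^sub>m N)"


section \<open>Rational matrices, realizations and system matrices\<close>

definition unimodular :: "nat \<Rightarrow> complex poly mat \<Rightarrow> bool" where
  "unimodular N U \<longleftrightarrow> U \<in> carrier_mat N N \<and> (\<exists>c. c \<noteq> 0 \<and> det U = [:c:])"

definition rat_eval :: "complex poly fract \<Rightarrow> complex \<Rightarrow> complex" where
  "rat_eval f z = (case quot_of_fract f of (p, q) \<Rightarrow> poly p z / poly q z)"

definition biproper :: "nat \<Rightarrow> complex poly fract mat \<Rightarrow> bool" where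
  "biproper N F \<longleftrightarrow> F \<in> carrier_mat N N \<and>
     (\<exists>L \<in> carrier_mat N N. det L \<noteq> 0 \<and>
        (\<forall>i<N. \<forall>j<N. (rat_eval (F $$ (i, j)) \<longlongrightarrow> L $$ (i, j)) at_infinity))"

text \<open>\<open>matrix_poly n m Ac\<close> is \<open>P(\<lambda>) = \<Sum>k\<le>m. \<lambda>^k A\<^sub>k\<close> with \<open>A\<^sub>k = Ac k\<close>.\<close>

definition matrix_poly :: "nat \<Rightarrow> nat \<Rightarrow> (nat \<Rightarrow> complex mat) \<Rightarrow> complex poly mat" where
  "matrix_poly n m Ac = mat n n (\<lambda>(i, j). \<Sum>k\<le>m. monom (Ac k $$ (i, j)) k)"

definition pencil :: "complex mat \<Rightarrow> complex mat \<Rightarrow> complex poly mat" where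
  "pencil X Y = const_mat X - lam \<cdot>\<^sub>m const_mat Y"

text \<open>\<open>P(\<lambda>) + C (\<lambda>E - A)\<^sup>-\<^sup>1 B\<close>, the inverse being taken over the field of rational functions.\<close>

definition transfer_function ::
    "complex poly mat \<Rightarrow> complex mat \<Rightarrow> complex mat \<Rightarrow> complex mat \<Rightarrow> complex mat
      \<Rightarrow> complex poly fract mat" where
  "transfer_function P A E B C =
     rat_mat P + rat_mat (const_mat C)
       * mat_inv (rat_mat (lam \<cdot>\<^sub>m const_mat E - const_mat A)) * rat_mat (const_mat B)"

definition realization ::
    "nat \<Rightarrow> nat \<Rightarrow> complex poly fract mat \<Rightarrow> complex poly mat \<Rightarrow>
      complex mat \<Rightarrow> complex mat \<Rightarrow> complex mat \<Rightarrow> complex mat \<Rightarrow> bool" where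
  "realization n r G P A E B C \<longleftrightarrow>
     P \<in> carrier_mat n n \<and> A \<in> carrier_mat r r \<and> E \<in> carrier_mat r r \<and>
     B \<in> carrier_mat r n \<and> C \<in> carrier_mat n r \<and> det E \<noteq> 0 \<and>
     G = transfer_function P A E B C"

definition minimal_realization ::
    "nat \<Rightarrow> nat \<Rightarrow> complex poly fract mat \<Rightarrow> complex poly mat \<Rightarrow>
      complex mat \<Rightarrow> complex mat \<Rightarrow> complex mat \<Rightarrow> complex mat \<Rightarrow> bool" where
  "minimal_realization n r G P A E B C \<longleftrightarrow>
     realization n r G P A E B C \<and>
     (\<forall>r' P' A' E' B' C'. realization n r' G P' A' E' B' C' \<longrightarrow> r \<le> r')"

definition system_matrix ::
    "complex poly mat \<Rightarrow> complex mat \<Rightarrow> complex mat \<Rightarrow> complex mat \<Rightarrow> complex mat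
      \<Rightarrow> complex poly mat" where
  "system_matrix P A E B C = four_block_mat P (const_mat C) (const_mat B) (pencil A E)"


section \<open>Elementary and Fiedler matrices\<close>

text \<open>\<open>elem_mat n m i X\<close> is \<open>M\<^sub>i(X)\<close>; it is meaningful for \<open>-m \<le> i \<le> m - 1\<close> only.\<close>

definition elem_mat :: "nat \<Rightarrow> nat \<Rightarrow> int \<Rightarrow> complex mat \<Rightarrow> complex mat" where
  "elem_mat n m i X =
    (if i = 0 then diag_block_mat [1\<^sub>m ((m - 1) * n), X]
     else if i = - int m then diag_block_mat [X, 1\<^sub>m ((m - 1) * n)]
     else if i > 0 then
       diag_block_mat
         [1\<^sub>m ((m - nat i - 1) * n),
          four_block_mat X (1\<^sub>m n) (1\<^sub>m n) (0\<^sub>m n n),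
          1\<^sub>m ((nat i - 1) * n)]
     else
       diag_block_mat
         [1\<^sub>m ((m - nat (- i) - 1) * n),
          four_block_mat (0\<^sub>m n n) (1\<^sub>m n) (1\<^sub>m n) X,
          1\<^sub>m ((nat (- i) - 1) * n)])"

definition elem_mat_ext :: "nat \<Rightarrow> nat \<Rightarrow> nat \<Rightarrow> int \<Rightarrow> complex mat \<Rightarrow> complex mat" where
  "elem_mat_ext n m r i X = diag_block_mat [elem_mat n m i X, 1\<^sub>m r]"

definition fiedler_P :: "nat \<Rightarrow> nat \<Rightarrow> (nat \<Rightarrow> complex mat) \<Rightarrow> int \<Rightarrow> complex mat" where
  "fiedler_P n m Ac i =
     (if i \<ge> 0 then elem_mat n m i (- Ac (nat i)) else elem_mat n m i (Ac (nat (- i))))"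

text \<open>The last unit vector \<open>e\<^sub>m\<close> as an \<open>m \<times> 1\<close> matrix.\<close>

definition e_last :: "nat \<Rightarrow> complex mat" where
  "e_last m = mat_of_cols m [unit_vec m (m - 1)]"

definition fiedler_S ::
    "nat \<Rightarrow> nat \<Rightarrow> nat \<Rightarrow> (nat \<Rightarrow> complex mat) \<Rightarrow> complex mat \<Rightarrow> complex mat \<Rightarrow>
      complex mat \<Rightarrow> complex mat \<Rightarrow> int \<Rightarrow> complex mat" where
  "fiedler_S n m r Ac A E B C i =
    (if i = 0 then
       four_block_mat (fiedler_P n m Ac 0) (- e_last m \<otimes>\<^sub>k C) (- transpose_mat (e_last m) \<otimes>\<^sub>k B) (- A)
     else if i = - int m then diag_block_mat [fiedler_P n m Ac i, - E]
     else if i > 0 then diag_block_mat [fiedler_P n m Ac i, 1\<^sub>m r]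
     else mat_inv (diag_block_mat [fiedler_P n m Ac (- i), 1\<^sub>m r]))"


section \<open>Index tuples and matrix assignments\<close>

definition SIP :: "int list \<Rightarrow> bool" where
  "SIP t \<longleftrightarrow> (\<forall>a b. a < b \<and> b < length t \<and> t ! a = t ! b \<longrightarrow>
     (\<exists>c. a < c \<and> c < b \<and> t ! c = t ! a + 1))"

definition is_perm_of :: "int list \<Rightarrow> int set \<Rightarrow> bool" where
  "is_perm_of t S \<longleftrightarrow> distinct t \<and> set t = S"

definition matrix_assignment :: "nat \<Rightarrow> int list \<Rightarrow> complex mat list \<Rightarrow> bool" where
  "matrix_assignment n t X \<longleftrightarrow> length X = length t \<and> (\<forall>M \<in> set X. M \<in> carrier_mat n n)"

definition nonsingular_assignment :: "nat \<Rightarrow> int list \<Rightarrow> complex mat list \<Rightarrow> bool" where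
  "nonsingular_assignment m t X \<longleftrightarrow>
     (\<forall>k < length t. t ! k = 0 \<or> t ! k = - int m \<longrightarrow> det (X ! k) \<noteq> 0)"

definition elem_prod ::
    "nat \<Rightarrow> nat \<Rightarrow> nat \<Rightarrow> int list \<Rightarrow> complex mat list \<Rightarrow> complex mat" where
  "elem_prod n m r t X = mat_prod (m * n + r) (map2 (elem_mat_ext n m r) t X)"

definition fiedler_prod ::
    "nat \<Rightarrow> nat \<Rightarrow> nat \<Rightarrow> (nat \<Rightarrow> complex mat) \<Rightarrow> complex mat \<Rightarrow> complex mat \<Rightarrow>
      complex mat \<Rightarrow> complex mat \<Rightarrow> int list \<Rightarrow> complex mat" where
  "fiedler_prod n m r Ac A E B C t = mat_prod (m * n + r) (map (fiedler_S n m r Ac A E B C) t)"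


section \<open>Generalized Fiedler pencils with repetition\<close>

definition GFPR_data ::
    "nat \<Rightarrow> nat \<Rightarrow> nat \<Rightarrow> int list \<Rightarrow> int list \<Rightarrow> int list \<Rightarrow> int list \<Rightarrow> int list \<Rightarrow> int list \<Rightarrow>
      complex mat list \<Rightarrow> complex mat list \<Rightarrow> complex mat list \<Rightarrow> complex mat list \<Rightarrow> bool" where
  "GFPR_data n m h \<sigma> \<tau> \<sigma>1 \<sigma>2 \<tau>1 \<tau>2 X1 X2 Y1 Y2 \<longleftrightarrow>
     h \<le> m - 1 \<and>
     is_perm_of \<sigma> {0..int h} \<and> is_perm_of \<tau> {- int m..- int h - 1} \<and>
     set \<sigma>1 \<subseteq> {0..int h - 1} \<and> set \<sigma>2 \<subseteq> {0..int h - 1} \<and> SIP (\<sigma>1 @ \<sigma> @ \<sigma>2) \<and>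
     set \<tau>1 \<subseteq> {- int m..- int h - 2} \<and> set \<tau>2 \<subseteq> {- int m..- int h - 2} \<and> SIP (\<tau>1 @ \<tau> @ \<tau>2) \<and>
     matrix_assignment n \<sigma>1 X1 \<and> matrix_assignment n \<sigma>2 X2 \<and>
     matrix_assignment n \<tau>1 Y1 \<and> matrix_assignment n \<tau>2 Y2"

definition GFPR ::
    "nat \<Rightarrow> nat \<Rightarrow> nat \<Rightarrow> (nat \<Rightarrow> complex mat) \<Rightarrow> complex mat \<Rightarrow> complex mat \<Rightarrow>
      complex mat \<Rightarrow> complex mat \<Rightarrow>
      int list \<Rightarrow> int list \<Rightarrow> int list \<Rightarrow> int list \<Rightarrow> int list \<Rightarrow> int list \<Rightarrow>
      complex mat list \<Rightarrow> complex mat list \<Rightarrow> complex mat list \<Rightarrow> complex mat list \<Rightarrow>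
      complex poly mat" where
  "GFPR n m r Ac A E B C \<sigma> \<tau> \<sigma>1 \<sigma>2 \<tau>1 \<tau>2 X1 X2 Y1 Y2 =
     const_mat (elem_prod n m r \<tau>1 Y1) * const_mat (elem_prod n m r \<sigma>1 X1)
     * (lam \<cdot>\<^sub>m const_mat (fiedler_prod n m r Ac A E B C \<tau>)
         - const_mat (fiedler_prod n m r Ac A E B C \<sigma>))
     * const_mat (elem_prod n m r \<sigma>2 X2) * const_mat (elem_prod n m r \<tau>2 Y2)"


section \<open>Rosenbrock strong linearizations\<close>

text \<open>
  Irreducibility of the \<open>(N + r) \<times> (N + r)\<close> pencil with blocks
  \<open>X - \<lambda>Y\<close>, \<open>CC\<close>, \<open>BB\<close>, \<open>H - \<lambda>K\<close>, which involves only the last three.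
\<close>

definition irreducible_pencil ::
    "nat \<Rightarrow> nat \<Rightarrow> complex mat \<Rightarrow> complex mat \<Rightarrow> complex mat \<Rightarrow> complex mat \<Rightarrow> bool" where
  "irreducible_pencil N r BB CC H K \<longleftrightarrow>
     (\<forall>z :: complex.
        vec_space.rank r (BB @\<^sub>c (H - z \<cdot>\<^sub>m K)) = r \<and>
        vec_space.rank (N + r) (CC @\<^sub>r (H - z \<cdot>\<^sub>m K)) = r)"

text \<open>
  \<open>G\<close> is the rational matrix and \<open>S\<close> the system matrix of its given minimal realization.  The
  blocks of \<open>L\<close>, hence its transfer function, are uniquely determined by \<open>L\<close>.
\<close>

definition rosenbrock_strong_linearization ::
    "nat \<Rightarrow> nat \<Rightarrow> nat \<Rightarrow> complex poly fract mat \<Rightarrow> complex poly mat \<Rightarrow> complex poly mat \<Rightarrow> bool" where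
  "rosenbrock_strong_linearization n m r G S L \<longleftrightarrow>
    (\<exists>X Y CC BB H K.
       X \<in> carrier_mat (m * n) (m * n) \<and> Y \<in> carrier_mat (m * n) (m * n) \<and>
       CC \<in> carrier_mat (m * n) r \<and> BB \<in> carrier_mat r (m * n) \<and>
       H \<in> carrier_mat r r \<and> K \<in> carrier_mat r r \<and>
       L = four_block_mat (pencil X Y) (const_mat CC) (const_mat BB) (pencil H K) \<and>
       det K \<noteq> 0 \<and>
       irreducible_pencil (m * n) r BB CC H K \<and>
       (\<exists>U V U0 V0.
          unimodular (m * n) U \<and> unimodular (m * n) V \<and>
          U0 \<in> carrier_mat r r \<and> det U0 \<noteq> 0 \<and> V0 \<in> carrier_mat r r \<and> det V0 \<noteq> 0 \<and>
          diag_block_mat [U, const_mat U0] * L * diag_block_mat [V, const_mat V0]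
            = diag_block_mat [1\<^sub>m ((m - 1) * n), S]) \<and>
       (\<exists>Ol Or.
          biproper (m * n) Ol \<and> biproper (m * n) Or \<and>
          Ol * (inverse (to_fract lam) \<cdot>\<^sub>m transfer_function (pencil X Y) H K BB CC) * Or
            = diag_block_mat [1\<^sub>m ((m - 1) * n), inverse (to_fract lam ^ m) \<cdot>\<^sub>m G]))"

end

theory Submission
  imports Defs "Jordan_Normal_Form.Schur_Decomposition"
begin

text \<open>
  The pencil is a Fiedler pencil in disguise, and a Fiedler pencil can be peeled, one coefficient
  at a time, down to the system matrix.

  \<^item> The factors \<open>M\<^sub>\<tau>\<^sub>j(Y\<^sub>j)\<close> and \<open>M\<^sub>\<sigma>\<^sub>j(X\<^sub>j)\<close> are constant and nonsingular, and they act as the identity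
  on the last \<open>r\<close> coordinates.  A Fiedler factor with index \<open>-i\<close> is the inverse of the one with
  index \<open>i\<close>, so all factors of \<open>M\<^sub>\<tau>\<close> but the one with index \<open>-m\<close> can be moved over to \<open>M\<^sub>\<sigma>\<close>.  Up to
  constant nonsingular factors the pencil is therefore \<open>\<lambda>M\<^sub>-\<^sub>m - M\<^sub>w\<close> for a permutation \<open>w\<close> of
  \<open>{0..m - 1}\<close> (\<open>fiedler_pencil_factor\<close>, \<open>GFPR_factor\<close>).

  \<^item> Fiedler matrices with non-adjacent indices commute, so only the side on which \<open>i\<close> stands with
  respect to \<open>i - 1\<close> matters, and \<open>M\<^sub>w\<close> arises from the factor of index \<open>0\<close> by attaching a corner
  block for \<open>1, 2, ...\<close>, each on its own side (\<open>fiedler_prod_nested\<close>).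

  \<^item> At finite points, removing the outermost corner by unimodular operations leaves a pencil of the
  same shape with one index less and leading coefficient \<open>\<lambda>A\<^sub>m + A\<^sub>m\<^sub>-\<^sub>1\<close> in place of \<open>A\<^sub>m\<close>.  Iterating is
  Horner's scheme for \<open>P\<close>; the operations never touch the last \<open>r\<close> coordinates, so the end is the
  system matrix (\<open>finite_reduction\<close>).

  \<^item> At infinity the state block is eliminated before anything else.  Its Schur complement passes
  through the nested product and changes only the innermost block \<open>-A\<^sub>0\<close>, by the proper matrix
  \<open>-C(\<lambda>E - A)\<^sup>-\<^sup>1B\<close> (\<open>schur_nested\<close>).  Peeling \<open>\<lambda>\<^sup>-\<^sup>1\<close> times the result with the other possible
  pivot uses only biproper operations; each corner leaves a factor \<open>\<lambda>\<^sup>-\<^sup>1\<close> on one side of the leading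
  block, and the product of these factors turns Horner's scheme into \<open>\<lambda>\<^sup>-\<^sup>mG(\<lambda>)\<close>
  (\<open>infinite_reduction\<close>).

  \<^item> Irreducibility comes from minimality.  The unimodular equivalence carries the off-diagonal
  blocks of the pencil to \<open>C\<close> and \<open>B\<close> padded with zeros, so a null vector violating irreducibility is
  one for the realization itself, and such a vector allows one state to be deleted
  (\<open>uncontrollable_intertwining\<close>).
\<close>

section \<open>Direct sums and block matrices\<close>

abbreviation sq_mat :: "nat \<Rightarrow> 'a mat set" where
  "sq_mat N \<equiv> carrier_mat N N"

text \<open>
  The direct sum of two matrices.  In contrast to block-diagonal lists it is associative on the
  nose, so a unit block can be regrouped with either neighbour.
\<close>

definition dsum :: "'a::zero mat \<Rightarrow> 'a mat \<Rightarrow> 'a mat" (infixr "\<boxplus>" 66) where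
  "A \<boxplus> B = four_block_mat A (0\<^sub>m (dim_row A) (dim_col B)) (0\<^sub>m (dim_row B) (dim_col A)) B"

lemma dim_dsum [simp]:
  "dim_row (A \<boxplus> B) = dim_row A + dim_row B" "dim_col (A \<boxplus> B) = dim_col A + dim_col B"
  by (simp_all add: dsum_def)

lemma dsum_carrier [simp]:
  "A \<in> carrier_mat a b \<Longrightarrow> B \<in> carrier_mat c d \<Longrightarrow> A \<boxplus> B \<in> carrier_mat (a + c) (b + d)"
  by (simp add: dsum_def)

lemma dsum_one [simp]: "1\<^sub>m a \<boxplus> 1\<^sub>m b = 1\<^sub>m (a + b)"
  by (simp add: dsum_def)

lemma dsum_mult:
  fixes A :: "'a::semiring_0 mat"
  assumes "A \<in> carrier_mat a b" "B \<in> carrier_mat b c" "C \<in> carrier_mat d e" "D \<in> carrier_mat e f"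
  shows "(A \<boxplus> C) * (B \<boxplus> D) = A * B \<boxplus> C * D"
proof -
  have "(A \<boxplus> C) * (B \<boxplus> D) = four_block_mat (A * B + 0\<^sub>m a e * 0\<^sub>m e c) (A * 0\<^sub>m b f + 0\<^sub>m a e * D)
     (0\<^sub>m d b * B + C * 0\<^sub>m e c) (0\<^sub>m d b * 0\<^sub>m b f + C * D)"
    using assms unfolding dsum_def
    by (subst mult_four_block_mat[where ?nr1.0=a and ?n1.0=b and ?n2.0=e and ?nr2.0=d and ?nc1.0=c and ?nc2.0=f]) auto
  also have "\<dots> = A * B \<boxplus> C * D" using assms unfolding dsum_def by auto
  finally show ?thesis .
qed

lemma dsum_assoc: "(A \<boxplus> B) \<boxplus> C = A \<boxplus> B \<boxplus> C"
  using assoc_four_block_mat[of A B C] by (simp add: dsum_def)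

lemma diag_block_mat_dsum: "diag_block_mat [A, B] = A \<boxplus> B"
  "diag_block_mat [A, B, C] = A \<boxplus> B \<boxplus> C"
proof -
  have *: "diag_block_mat (A # Bs) = A \<boxplus> diag_block_mat Bs" for A :: "'a mat" and Bs
    by (simp add: dsum_def Let_def)
  show "diag_block_mat [A, B] = A \<boxplus> B" "diag_block_mat [A, B, C] = A \<boxplus> B \<boxplus> C"
    by (simp_all only: * [of A] *[of B "[C]"] diag_block_mat_singleton)
qed

lemma dsum_transpose: "(A \<boxplus> B)\<^sup>T = A\<^sup>T \<boxplus> B\<^sup>T"
  unfolding dsum_def by (subst transpose_four_block_mat) auto

lemma map_dsum: "f 0 = 0 \<Longrightarrow> map_mat f (A \<boxplus> B) = map_mat f A \<boxplus> map_mat f B"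
  by (rule eq_matI) (auto simp: dsum_def)

lemma det_dsum:
  fixes A :: "'a::idom mat"
  assumes "A \<in> sq_mat a" "B \<in> sq_mat b"
  shows "det (A \<boxplus> B) = det A * det B"
  using assms unfolding dsum_def
  by (subst det_four_block_mat_upper_right_zero[where n=a and m=b]) auto

text \<open>
  The matrix \<open>[I\<^sub>n 0]\<close>.  It pads a block with zeros, and makes three-by-three block computations
  expressible with two-by-two blocks.
\<close>

definition lead_block :: "nat \<Rightarrow> nat \<Rightarrow> 'a::{zero,one} mat" where
  "lead_block n s = mat n (n + s) (\<lambda>(i, j). if i = j then 1 else 0)"

lemma lead_block_carrier [simp]: "lead_block n s \<in> carrier_mat n (n + s)" "dim_row (lead_block n s) = n" "dim_col (lead_block n s) = n + s"
  by (simp_all add: lead_block_def)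

lemma mult_lead_block:
  fixes B :: "'a::semiring_1 mat"
  assumes "B \<in> carrier_mat a n"
  shows "B * lead_block n s = mat a (n + s) (\<lambda>(i, j). if j < n then B $$ (i, j) else 0)"
  by (rule eq_matI) (use assms in \<open>auto simp: scalar_prod_def lead_block_def if_distrib sum.delta cong: if_cong intro!: sum.neutral\<close>)

lemma lead_block_mult:
  fixes B :: "'a::semiring_1 mat"
  assumes "B \<in> carrier_mat (n + s) b"
  shows "lead_block n s * B = mat n b (\<lambda>(i, j). B $$ (i, j))"
  by (rule eq_matI)
    (use assms in \<open>auto simp: scalar_prod_def lead_block_def if_distrib[of "\<lambda>x. x * _"] cong: if_cong\<close>)

lemma lead_block_T_mult:
  fixes B :: "'a::comm_semiring_1 mat"
  assumes "B \<in> carrier_mat n a"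
  shows "(lead_block n s)\<^sup>T * B = mat (n + s) a (\<lambda>(i, j). if i < n then B $$ (i, j) else 0)"
proof -
  have "(lead_block n s)\<^sup>T * B = (B\<^sup>T * lead_block n s)\<^sup>T"
    using assms by (subst transpose_mult[of _ a n]) auto
  also have "\<dots> = mat (n + s) a (\<lambda>(i, j). if i < n then B $$ (i, j) else 0)"
    using assms by (subst mult_lead_block[of _ a]) auto
  finally show ?thesis .
qed

lemma lead_block_mult_T: "lead_block n s * (lead_block n s)\<^sup>T = (1\<^sub>m n :: 'a::semiring_1 mat)"
  by (subst lead_block_mult) (auto simp: lead_block_def)

lemma four_block_dsum:
  fixes a :: "'a::comm_semiring_1 mat"
  assumes "a \<in> sq_mat n" "b \<in> sq_mat n" "c \<in> sq_mat n" "d \<in> sq_mat n"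
    "D \<in> sq_mat s"
  shows "four_block_mat a b c d \<boxplus> D = four_block_mat a (b * lead_block n s) ((lead_block n s)\<^sup>T * c) (d \<boxplus> D)"
  by (rule eq_matI) (use assms in \<open>auto simp: dsum_def mult_lead_block[of _ n] lead_block_T_mult[of _ n]\<close>)

lemma lead_block_T_sandwich:
  fixes L :: "'a::comm_semiring_1 mat"
  assumes "L \<in> sq_mat n"
  shows "(lead_block n s)\<^sup>T * L * lead_block n s = L \<boxplus> 0\<^sub>m s s"
proof -
  have "(lead_block n s)\<^sup>T * L \<in> carrier_mat (n + s) n" using assms by auto
  from mult_lead_block[OF this, of s] show ?thesis
    using assms by (auto intro!: eq_matI simp: dsum_def lead_block_T_mult[OF assms])
qed

lemma lead_block_mult_dsum:
  fixes L :: "'a::comm_semiring_1 mat"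
  assumes "L \<in> sq_mat n" "D \<in> sq_mat s"
  shows "lead_block n s * (L \<boxplus> D) = L * lead_block n s"
  using mult_lead_block[OF assms(1), of s] lead_block_mult[OF dsum_carrier[OF assms]] assms
  by (auto intro!: eq_matI simp: dsum_def)

text \<open>
  The ring laws for matrices are stated below with side conditions on dimensions instead of
  carriers: the sizes are then computed by rewriting, and no middle dimension has to be guessed.
\<close>

lemma mat_assoc_dim:
  fixes A :: "'a::semiring_0 mat"
  shows "dim_col A = dim_row B \<Longrightarrow> dim_col B = dim_row C \<Longrightarrow> A * B * C = A * (B * C)"
  by (rule assoc_mult_mat) auto

lemma mat_assoc4:
  fixes A :: "'a::semiring_0 mat"
  shows "dim_col A = dim_row B \<Longrightarrow> dim_col B = dim_row F \<Longrightarrow> dim_col F = dim_row V \<Longrightarrow> A * B * F * V = A * ((B * F) * V)"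
  by (simp add: mat_assoc_dim)

lemma mat_distrib_dim:
  fixes A :: "'a::ring mat"
  shows "dim_row A = dim_row B \<Longrightarrow> dim_col A = dim_col B \<Longrightarrow> dim_col A = dim_row C \<Longrightarrow> (A + B) * C = A * C + B * C"
    "dim_row A = dim_row B \<Longrightarrow> dim_col A = dim_col B \<Longrightarrow> dim_col A = dim_row C \<Longrightarrow> (A - B) * C = A * C - B * C"
    "dim_row B = dim_row C \<Longrightarrow> dim_col B = dim_col C \<Longrightarrow> dim_col A = dim_row B \<Longrightarrow> A * (B + C) = A * B + A * C"
    "dim_row B = dim_row C \<Longrightarrow> dim_col B = dim_col C \<Longrightarrow> dim_col A = dim_row B \<Longrightarrow> A * (B - C) = A * B - A * C"
  by (auto intro!: add_mult_distrib_mat minus_mult_distrib_mat mult_add_distrib_mat mult_minus_distrib_mat)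

lemma mat_smult_dim:
  fixes A :: "'a::comm_semiring_0 mat"
  shows "dim_col A = dim_row B \<Longrightarrow> (c \<cdot>\<^sub>m A) * B = c \<cdot>\<^sub>m (A * B)"
    "dim_col A = dim_row B \<Longrightarrow> A * (c \<cdot>\<^sub>m B) = c \<cdot>\<^sub>m (A * B)"
  by (auto intro!: mult_smult_assoc_mat mult_smult_distrib)

lemma mat_uminus_dim:
  fixes A :: "'a::ring mat"
  shows "dim_col A = dim_row B \<Longrightarrow> (- A) * B = - (A * B)"
    "dim_col A = dim_row B \<Longrightarrow> A * (- B) = - (A * B)"
  by (auto intro!: uminus_mult_left_mat uminus_mult_right_mat)

lemma mat_one_zero_dim:
  fixes A :: "'a::semiring_1 mat"
  shows "dim_row A = n \<Longrightarrow> 1\<^sub>m n * A = A" "dim_col A = n \<Longrightarrow> A * 1\<^sub>m n = A"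
   "dim_row A = n \<Longrightarrow> 0\<^sub>m k n * A = 0\<^sub>m k (dim_col A)" "dim_col A = n \<Longrightarrow> A * 0\<^sub>m n k = 0\<^sub>m (dim_row A) k"
  by auto

lemma mat_add_zero_dim:
  fixes A :: "'a::group_add mat"
  shows "dim_row A = m \<Longrightarrow> dim_col A = k \<Longrightarrow> A + 0\<^sub>m m k = A"
    "dim_row A = m \<Longrightarrow> dim_col A = k \<Longrightarrow> 0\<^sub>m m k + A = A"
    "dim_row A = m \<Longrightarrow> dim_col A = k \<Longrightarrow> A - 0\<^sub>m m k = A"
    "dim_row A = m \<Longrightarrow> dim_col A = k \<Longrightarrow> 0\<^sub>m m k - A = - A"
    "- (0\<^sub>m m k :: 'a mat) = 0\<^sub>m m k"
    "- A + A = 0\<^sub>m (dim_row A) (dim_col A)"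
  by (auto intro!: eq_matI)

lemma mat_smult_uminus: "c \<cdot>\<^sub>m (- A) = - (c \<cdot>\<^sub>m (A :: 'a::ring mat))"
  by (rule eq_matI) auto

lemma mat_add_uminus_dim:
  fixes A :: "'a::group_add mat"
  shows "dim_row A = dim_row B \<Longrightarrow> dim_col A = dim_col B \<Longrightarrow> A + - B = A - B"
  by (rule eq_matI) auto

lemma smult_mat_assoc: "a \<cdot>\<^sub>m (b \<cdot>\<^sub>m A) = (a * b :: 'a::semigroup_mult) \<cdot>\<^sub>m A"
  by (rule eq_matI) (auto simp: mult.assoc)

lemma four_block_mult_dim:
  fixes A1 :: "'a::semiring_0 mat"
  assumes "dim_row B1 = dim_row A1" "dim_col C1 = dim_col A1" "dim_row D1 = dim_row C1" "dim_col D1 = dim_col B1"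
    "dim_row B2 = dim_row A2" "dim_col C2 = dim_col A2" "dim_row D2 = dim_row C2" "dim_col D2 = dim_col B2"
    "dim_col A1 = dim_row A2" "dim_col B1 = dim_row C2"
  shows "four_block_mat A1 B1 C1 D1 * four_block_mat A2 B2 C2 D2
    = four_block_mat (A1 * A2 + B1 * C2) (A1 * B2 + B1 * D2) (C1 * A2 + D1 * C2) (C1 * B2 + D1 * D2)"
  by (rule mult_four_block_mat) (use assms in auto)

lemma dsum_mult_dim:
  fixes A :: "'a::semiring_0 mat"
  shows "dim_col A = dim_row B \<Longrightarrow> dim_col C = dim_row D \<Longrightarrow> (A \<boxplus> C) * (B \<boxplus> D) = A * B \<boxplus> C * D"
  by (rule dsum_mult) auto

lemmas mat_dim_simps = mat_assoc_dim mat_distrib_dim mat_smult_dim mat_uminus_dim mat_one_zero_dim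
  mat_add_zero_dim mat_smult_uminus mat_add_uminus_dim

section \<open>Eliminating one corner\<close>

text \<open>
  The nontrivial block of an elementary matrix of positive index.  Its inverse, up to the sign of
  \<open>X\<close>, is the block of the matrix with the opposite index.
\<close>

definition corner :: "nat \<Rightarrow> 'a::{zero,one} mat \<Rightarrow> 'a mat" where
  "corner n X = four_block_mat X (1\<^sub>m n) (1\<^sub>m n) (0\<^sub>m n n)"

definition corner_inv :: "nat \<Rightarrow> 'a::{zero,one,uminus} mat \<Rightarrow> 'a mat" where
  "corner_inv n X = four_block_mat (0\<^sub>m n n) (1\<^sub>m n) (1\<^sub>m n) (- X)"

lemma dim_corner [simp]:
  "dim_row (corner n X) = dim_row X + n" "dim_col (corner n X) = dim_col X + n"
  "dim_row (corner_inv n X) = n + dim_row X" "dim_col (corner_inv n X) = n + dim_col X"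
  by (simp_all add: corner_def corner_inv_def)

lemma corner_inverse:
  fixes X :: "'a::ring_1 mat"
  assumes "X \<in> sq_mat n"
  shows "corner n X * corner_inv n X = 1\<^sub>m (n + n)" "corner_inv n X * corner n X = 1\<^sub>m (n + n)"
proof -
  have [simp]: "X + - X = 0\<^sub>m n n" "- X + X = 0\<^sub>m n n" "dim_row X = n" "dim_col X = n"
    "X + 0\<^sub>m n n = X" "- X + 0\<^sub>m n n = - X" "1\<^sub>m n + - 0\<^sub>m n n = (1\<^sub>m n :: 'a mat)" using assms by auto
  show "corner n X * corner_inv n X = 1\<^sub>m (n + n)" "corner_inv n X * corner n X = 1\<^sub>m (n + n)"
    by (simp_all add: corner_def corner_inv_def four_block_mult_dim mat_dim_simps)
qed

text \<open>
  The row and column operations that eliminate one corner at finite points.  The corner is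
  inverted first, which moves the constant identity block of the pencil into pivot position.
\<close>

definition pivot_rows :: "nat \<Rightarrow> 'a::comm_ring_1 \<Rightarrow> 'a mat \<Rightarrow> 'a mat \<Rightarrow> 'a mat" where
  "pivot_rows n x L X = four_block_mat (- 1\<^sub>m n) (0\<^sub>m n n) (x \<cdot>\<^sub>m L) (1\<^sub>m n) * corner_inv n X"

definition pivot_cols :: "nat \<Rightarrow> 'a::comm_ring_1 \<Rightarrow> 'a mat" where
  "pivot_cols n x = four_block_mat (1\<^sub>m n) (x \<cdot>\<^sub>m 1\<^sub>m n) (0\<^sub>m n n) (1\<^sub>m n)"

text \<open>
  After the corner is inverted, the inner product \<open>N\<close> is met only by the identity, and the top left
  block of the pencil is \<open>-I\<close>.  Its Schur complement replaces the leading coefficient \<open>L\<close> by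
  \<open>xL - X\<close>, a step of Horner's scheme, and keeps \<open>N\<close>.
\<close>

lemma finite_step_left:
  fixes x :: "'a::comm_ring_1"
  assumes c: "L \<in> sq_mat n" "X \<in> sq_mat n" "D \<in> sq_mat s" "N \<in> sq_mat (n + s)"
  shows "(pivot_rows n x L X \<boxplus> 1\<^sub>m s) * (x \<cdot>\<^sub>m (L \<boxplus> 1\<^sub>m n \<boxplus> D) - (corner n X \<boxplus> 1\<^sub>m s) * (1\<^sub>m n \<boxplus> N)) * (pivot_cols n x \<boxplus> 1\<^sub>m s)
    = 1\<^sub>m n \<boxplus> (x \<cdot>\<^sub>m ((x \<cdot>\<^sub>m L - X) \<boxplus> D) - N)"
proof -
  define W :: "'a mat" where "W = four_block_mat (- 1\<^sub>m n) (0\<^sub>m n n) (x \<cdot>\<^sub>m L) (1\<^sub>m n)"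
  let ?U = "pivot_rows n x L X" let ?V = "pivot_cols n x" let ?e = "lead_block n s :: 'a mat"
  have d [simp]: "dim_row L = n" "dim_col L = n" "dim_row X = n" "dim_col X = n" "dim_row D = s" "dim_col D = s"
    "dim_row N = n + s" "dim_col N = n + s" using c by auto
  have dUV [simp]: "dim_row ?U = n + n" "dim_col ?U = n + n" "dim_row ?V = n + n" "dim_col ?V = n + n"
      "dim_row W = n + n" "dim_col W = n + n"
    by (simp_all add: pivot_rows_def pivot_cols_def W_def)
  have UW: "?U = W * corner_inv n X" by (simp add: pivot_rows_def W_def)
  have UT: "?U * corner n X = W"
    unfolding UW using c(2) by (simp add: mat_assoc_dim corner_inverse mat_one_zero_dim)
  have W1: "W \<boxplus> 1\<^sub>m s = four_block_mat (- 1\<^sub>m n) (0\<^sub>m n (n + s)) (x \<cdot>\<^sub>m (?e\<^sup>T * L)) (1\<^sub>m (n + s))"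
    unfolding W_def by (subst four_block_dsum[where n=n and s=s]) (simp_all add: mat_smult_dim carrier_matI)
  have V1: "?V \<boxplus> 1\<^sub>m s = four_block_mat (1\<^sub>m n) (x \<cdot>\<^sub>m ?e) (0\<^sub>m (n + s) n) (1\<^sub>m (n + s))"
    unfolding pivot_cols_def by (subst four_block_dsum[where n=n and s=s]) (simp_all add: mat_smult_dim)
  have N1: "1\<^sub>m n \<boxplus> N = four_block_mat (1\<^sub>m n) (0\<^sub>m n (n + s)) (0\<^sub>m (n + s) n) N"
    by (simp add: dsum_def)
  have prodN: "(W \<boxplus> 1\<^sub>m s) * (1\<^sub>m n \<boxplus> N) * (?V \<boxplus> 1\<^sub>m s)
    = four_block_mat (- 1\<^sub>m n) (- (x \<cdot>\<^sub>m ?e)) (x \<cdot>\<^sub>m (?e\<^sup>T * L)) ((x * x) \<cdot>\<^sub>m (L \<boxplus> 0\<^sub>m s s) + N)"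
    unfolding W1 V1 N1
    by (simp add: four_block_mult_dim mat_dim_simps lead_block_T_sandwich[OF c(1), symmetric] smult_mat_assoc)
  have prodL: "?U * (L \<boxplus> 1\<^sub>m n) * ?V = four_block_mat (0\<^sub>m n n) (- 1\<^sub>m n) L (x \<cdot>\<^sub>m L + (x \<cdot>\<^sub>m L - X))"
  proof -
    have "corner_inv n X * (L \<boxplus> 1\<^sub>m n) * ?V = four_block_mat (0\<^sub>m n n) (1\<^sub>m n) L (x \<cdot>\<^sub>m L - X)"
      using c by (simp add: corner_inv_def dsum_def pivot_cols_def four_block_mult_dim mat_dim_simps)
    then show ?thesis unfolding UW
      by (simp add: mat_assoc_dim) (simp add: W_def four_block_mult_dim mat_dim_simps)
  qed
  have "(?U \<boxplus> 1\<^sub>m s) * (x \<cdot>\<^sub>m (L \<boxplus> 1\<^sub>m n \<boxplus> D) - (corner n X \<boxplus> 1\<^sub>m s) * (1\<^sub>m n \<boxplus> N)) * (?V \<boxplus> 1\<^sub>m s)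
    = x \<cdot>\<^sub>m ((?U \<boxplus> 1\<^sub>m s) * ((L \<boxplus> 1\<^sub>m n) \<boxplus> D) * (?V \<boxplus> 1\<^sub>m s))
     - (?U \<boxplus> 1\<^sub>m s) * (corner n X \<boxplus> 1\<^sub>m s) * (1\<^sub>m n \<boxplus> N) * (?V \<boxplus> 1\<^sub>m s)"
    by (simp add: mat_dim_simps dsum_assoc)
  also have "\<dots> = x \<cdot>\<^sub>m (four_block_mat (0\<^sub>m n n) (- 1\<^sub>m n) L (x \<cdot>\<^sub>m L + (x \<cdot>\<^sub>m L - X)) \<boxplus> D)
     - four_block_mat (- 1\<^sub>m n) (- (x \<cdot>\<^sub>m ?e)) (x \<cdot>\<^sub>m (?e\<^sup>T * L)) ((x * x) \<cdot>\<^sub>m (L \<boxplus> 0\<^sub>m s s) + N)"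
    by (simp add: dsum_mult_dim UT mat_one_zero_dim prodL prodN)
  also have "four_block_mat (0\<^sub>m n n) (- 1\<^sub>m n) L (x \<cdot>\<^sub>m L + (x \<cdot>\<^sub>m L - X)) \<boxplus> D
     = four_block_mat (0\<^sub>m n n) (- ?e) (?e\<^sup>T * L) ((x \<cdot>\<^sub>m L + (x \<cdot>\<^sub>m L - X)) \<boxplus> D)"
    by (subst four_block_dsum[where n=n and s=s]) (simp_all add: mat_dim_simps carrier_matI)
  also have "x \<cdot>\<^sub>m \<dots> - four_block_mat (- 1\<^sub>m n) (- (x \<cdot>\<^sub>m ?e)) (x \<cdot>\<^sub>m (?e\<^sup>T * L)) ((x * x) \<cdot>\<^sub>m (L \<boxplus> 0\<^sub>m s s) + N)
    = 1\<^sub>m n \<boxplus> (x \<cdot>\<^sub>m ((x \<cdot>\<^sub>m L - X) \<boxplus> D) - N)"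
    by (rule eq_matI) (auto simp: dsum_def algebra_simps)
  finally show ?thesis .
qed

abbreviation lead_scale :: "nat \<Rightarrow> nat \<Rightarrow> 'a::comm_ring_1 \<Rightarrow> 'a mat" where
  "lead_scale n s c \<equiv> c \<cdot>\<^sub>m 1\<^sub>m n \<boxplus> 1\<^sub>m s"

text \<open>
  At infinity the parameter \<open>\<mu> = \<lambda>\<^sup>-\<^sup>1\<close> is small and \<open>\<lambda>\<close> is not available, so the pivot must be the
  identity block of the leading matrix instead of the one in the corner.  The weights \<open>\<alpha>\<close> and
  \<open>\<beta>\<close> record the powers of \<open>\<mu>\<close> that earlier steps have left on the first block row and column;
  a corner on the left adds one factor \<open>\<mu>\<close> to the column weight.
\<close>

lemma infinite_step_left:
  fixes \<mu> \<alpha> \<beta> :: "'a::comm_ring_1"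
  assumes c: "L \<in> sq_mat n" "X \<in> sq_mat n" "D \<in> sq_mat s" "N \<in> sq_mat (n + s)"
  defines "Q \<equiv> (- (\<alpha> \<cdot>\<^sub>m X) \<boxplus> D) - \<mu> \<cdot>\<^sub>m (lead_scale n s \<alpha> * N)"
  shows "(four_block_mat (1\<^sub>m n) (0\<^sub>m n (n + s)) (- (Q * (lead_block n s)\<^sup>T)) (1\<^sub>m (n + s)) * (corner_inv n (\<alpha> \<cdot>\<^sub>m X) \<boxplus> 1\<^sub>m s))
      * ((L \<boxplus> 1\<^sub>m n \<boxplus> D) - \<mu> \<cdot>\<^sub>m (lead_scale n (n + s) \<alpha> * ((corner n X \<boxplus> 1\<^sub>m s) * (1\<^sub>m n \<boxplus> N))
          * lead_scale n (n + s) \<beta>))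
      * (four_block_mat (0\<^sub>m n n) (1\<^sub>m n) (1\<^sub>m n) ((\<mu> * \<beta>) \<cdot>\<^sub>m 1\<^sub>m n) \<boxplus> 1\<^sub>m s)
    = 1\<^sub>m n \<boxplus> (((L - (\<mu> * \<alpha> * \<beta>) \<cdot>\<^sub>m X) \<boxplus> D)
        - \<mu> \<cdot>\<^sub>m (lead_scale n s \<alpha> * N * lead_scale n s (\<mu> * \<beta>)))"
proof -
  let ?e = "lead_block n s :: 'a mat" and ?T = "corner_inv n (\<alpha> \<cdot>\<^sub>m X)" and ?a = "\<alpha> \<cdot>\<^sub>m 1\<^sub>m n :: 'a mat"
  let ?b = "\<beta> \<cdot>\<^sub>m 1\<^sub>m n :: 'a mat" and ?V = "four_block_mat (0\<^sub>m n n) (1\<^sub>m n) (1\<^sub>m n) ((\<mu> * \<beta>) \<cdot>\<^sub>m 1\<^sub>m n)"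
  let ?mb = "(\<mu> * \<beta>) \<cdot>\<^sub>m 1\<^sub>m n :: 'a mat"
  have d [simp]: "dim_row L = n" "dim_col L = n" "dim_row X = n" "dim_col X = n" "dim_row D = s" "dim_col D = s"
    "dim_row N = n + s" "dim_col N = n + s" using c by auto
  have Qd [simp]: "dim_row Q = n + s" "dim_col Q = n + s" by (simp_all add: Q_def)
  have TT: "?T * ((?a \<boxplus> 1\<^sub>m n) * corner n X) = (1\<^sub>m n \<boxplus> ?a)"
    unfolding corner_inv_def corner_def dsum_def
    by (simp add: four_block_mult_dim mat_dim_simps) (rule eq_matI, auto)
  have TL: "?T * (L \<boxplus> 1\<^sub>m n) = four_block_mat (0\<^sub>m n n) (1\<^sub>m n) L (- (\<alpha> \<cdot>\<^sub>m X))"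
    unfolding corner_inv_def dsum_def
    by (simp add: four_block_mult_dim mat_dim_simps)
  have "(?T \<boxplus> 1\<^sub>m s) * ((L \<boxplus> 1\<^sub>m n \<boxplus> D) - \<mu> \<cdot>\<^sub>m ((?a \<boxplus> 1\<^sub>m (n + s)) * ((corner n X \<boxplus> 1\<^sub>m s) * (1\<^sub>m n \<boxplus> N))
          * (?b \<boxplus> 1\<^sub>m (n + s))))
     = (?T \<boxplus> 1\<^sub>m s) * ((L \<boxplus> 1\<^sub>m n) \<boxplus> D) - \<mu> \<cdot>\<^sub>m ((?T \<boxplus> 1\<^sub>m s) * (((?a \<boxplus> 1\<^sub>m n) \<boxplus> 1\<^sub>m s) * (corner n X \<boxplus> 1\<^sub>m s)) * ((1\<^sub>m n \<boxplus> N)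
          * (?b \<boxplus> 1\<^sub>m (n + s))))"
    by (simp add: mat_dim_simps dsum_assoc)
  also have "\<dots> = (four_block_mat (0\<^sub>m n n) (1\<^sub>m n) L (- (\<alpha> \<cdot>\<^sub>m X)) \<boxplus> D) - \<mu> \<cdot>\<^sub>m ((1\<^sub>m n \<boxplus> (?a \<boxplus> 1\<^sub>m s)) * (?b \<boxplus> N))"
  proof -
    have "(?T \<boxplus> 1\<^sub>m s) * (((?a \<boxplus> 1\<^sub>m n) \<boxplus> 1\<^sub>m s) * (corner n X \<boxplus> 1\<^sub>m s)) = 1\<^sub>m n \<boxplus> (?a \<boxplus> 1\<^sub>m s)"
      by (simp add: dsum_mult_dim mat_one_zero_dim TT) (rule dsum_assoc)
    moreover have "(?T \<boxplus> 1\<^sub>m s) * ((L \<boxplus> 1\<^sub>m n) \<boxplus> D) = four_block_mat (0\<^sub>m n n) (1\<^sub>m n) L (- (\<alpha> \<cdot>\<^sub>m X)) \<boxplus> D"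
      by (simp add: dsum_mult_dim mat_one_zero_dim TL)
    moreover have "(1\<^sub>m n \<boxplus> N) * (?b \<boxplus> 1\<^sub>m (n + s)) = ?b \<boxplus> N"
      by (simp add: dsum_mult_dim mat_one_zero_dim)
    ultimately show ?thesis by (simp only:)
  qed
  also have "\<dots> = four_block_mat (0\<^sub>m n n) ?e (?e\<^sup>T * L) (- (\<alpha> \<cdot>\<^sub>m X) \<boxplus> D) - \<mu> \<cdot>\<^sub>m (?b \<boxplus> ((?a \<boxplus> 1\<^sub>m s) * N))"
    using c by (subst four_block_dsum[where n=n and s=s]) (simp_all add: mat_dim_simps dsum_mult_dim)
  also have "\<dots> = four_block_mat (- ?mb) ?e (?e\<^sup>T * L) Q"
    unfolding Q_def by (rule eq_matI) (auto simp: dsum_def algebra_simps)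
  finally have G: "(?T \<boxplus> 1\<^sub>m s) * ((L \<boxplus> 1\<^sub>m n \<boxplus> D) - \<mu> \<cdot>\<^sub>m ((?a \<boxplus> 1\<^sub>m (n + s)) * ((corner n X \<boxplus> 1\<^sub>m s) * (1\<^sub>m n \<boxplus> N))
          * (?b \<boxplus> 1\<^sub>m (n + s)))) = four_block_mat (- ?mb) ?e (?e\<^sup>T * L) Q" .
  have V1: "?V \<boxplus> 1\<^sub>m s = four_block_mat (0\<^sub>m n n) ?e (?e\<^sup>T) (?mb \<boxplus> 1\<^sub>m s)"
    by (subst four_block_dsum[where n=n and s=s]) (simp_all add: mat_dim_simps)
  have lead_block: "?e * (?mb \<boxplus> 1\<^sub>m s) = (\<mu> * \<beta>) \<cdot>\<^sub>m ?e"
    by (subst lead_block_mult_dsum) (simp_all add: mat_dim_simps)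
  have GV: "four_block_mat (- ?mb) ?e (?e\<^sup>T * L) Q * (?V \<boxplus> 1\<^sub>m s)
    = four_block_mat (1\<^sub>m n) (0\<^sub>m n (n + s)) (Q * ?e\<^sup>T) ((L \<boxplus> 0\<^sub>m s s) + Q * (?mb \<boxplus> 1\<^sub>m s))"
  proof -
    have "?e * ?e\<^sup>T = 1\<^sub>m n" by (rule lead_block_mult_T)
    then show ?thesis unfolding V1
      by (simp add: four_block_mult_dim mat_dim_simps lead_block lead_block_T_sandwich[OF c(1), symmetric])
  qed
  have Qmb: "(L \<boxplus> 0\<^sub>m s s) + Q * (?mb \<boxplus> 1\<^sub>m s) = ((L - (\<mu> * \<alpha> * \<beta>) \<cdot>\<^sub>m X) \<boxplus> D)
        - \<mu> \<cdot>\<^sub>m ((?a \<boxplus> 1\<^sub>m s) * N * (?mb \<boxplus> 1\<^sub>m s))"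
  proof -
    have "Q * (?mb \<boxplus> 1\<^sub>m s) = ((- (\<alpha> \<cdot>\<^sub>m X)) * ?mb \<boxplus> D) - \<mu> \<cdot>\<^sub>m ((?a \<boxplus> 1\<^sub>m s) * N * (?mb \<boxplus> 1\<^sub>m s))"
      unfolding Q_def by (simp add: mat_dim_simps dsum_mult_dim)
    then show ?thesis
      by (simp add: mat_dim_simps) (rule eq_matI, auto simp: dsum_def algebra_simps)
  qed
  have "four_block_mat (1\<^sub>m n) (0\<^sub>m n (n + s)) (- (Q * ?e\<^sup>T)) (1\<^sub>m (n + s)) *
     four_block_mat (1\<^sub>m n) (0\<^sub>m n (n + s)) (Q * ?e\<^sup>T) ((L \<boxplus> 0\<^sub>m s s) + Q * (?mb \<boxplus> 1\<^sub>m s))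
     = 1\<^sub>m n \<boxplus> ((L \<boxplus> 0\<^sub>m s s) + Q * (?mb \<boxplus> 1\<^sub>m s))"
    by (simp add: four_block_mult_dim mat_one_zero_dim mat_add_zero_dim dsum_def)
  then show ?thesis
    by (subst mat_assoc4) (simp_all only: G GV Qmb, simp_all)
qed

section \<open>Nested products and the reduction at finite points\<close>

abbreviation attach :: "bool \<Rightarrow> nat \<Rightarrow> nat \<Rightarrow> 'a::ring_1 mat \<Rightarrow> 'a mat \<Rightarrow> 'a mat" where
  "attach left n s X N \<equiv> (if left then (corner n X \<boxplus> 1\<^sub>m s) * (1\<^sub>m n \<boxplus> N)
     else (1\<^sub>m n \<boxplus> N) * (corner n X \<boxplus> 1\<^sub>m s))"

text \<open>
  A product of Fiedler matrices, one for each index \<open>0, ..., k\<close>, built from the factor \<open>Z\<close> of index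
  \<open>0\<close> outwards.  The flag \<open>side i\<close> tells whether \<open>i\<close> stands to the left of \<open>i - 1\<close>; the last \<open>r\<close>
  coordinates belong to the state.
\<close>

fun nested :: "nat \<Rightarrow> nat \<Rightarrow> 'a::ring_1 mat \<Rightarrow> (nat \<Rightarrow> bool) \<Rightarrow> (nat \<Rightarrow> 'a mat) \<Rightarrow> nat \<Rightarrow> 'a mat" where
  "nested n r Z side X 0 = Z"
| "nested n r Z side X (Suc k) =
    attach (side (Suc k)) n (k * n + r) (X (Suc k)) (nested n r Z side X k)"

text \<open>
  Horner's scheme started at \<open>L\<close> for the coefficients \<open>-X k, ..., -X 1\<close>.
\<close>

fun horner :: "'a::ring_1 \<Rightarrow> (nat \<Rightarrow> 'a mat) \<Rightarrow> nat \<Rightarrow> 'a mat \<Rightarrow> 'a mat" where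
  "horner x X 0 L = L"
| "horner x X (Suc k) L = horner x X k (x \<cdot>\<^sub>m L - X (Suc k))"

lemma nested_carrier:
  assumes "Z \<in> sq_mat (n + r)" "\<And>i. i \<le> k \<Longrightarrow> X i \<in> sq_mat n"
  shows "nested n r Z side X k \<in> sq_mat (n + (k * n + r))"
  using assms
proof (induction k)
  case (Suc k)
  then show ?case using carrier_matD[OF Suc.prems(2)[of "Suc k"]] by (auto intro!: carrier_matI)
qed simp

lemma horner_carrier:
  assumes "L \<in> sq_mat n" "\<And>i. i \<le> k \<Longrightarrow> X i \<in> sq_mat n"
  shows "horner x X k L \<in> sq_mat n"
  using assms
proof (induction k arbitrary: L)
  case (Suc k)
  show ?case using Suc.prems by (auto intro!: Suc.IH minus_carrier_mat)
qed simp

lemma corner_transpose: "X \<in> sq_mat n \<Longrightarrow> (corner n X)\<^sup>T = corner n (X\<^sup>T)"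
  unfolding corner_def by (subst transpose_four_block_mat[where ?nr1.0=n and ?nr2.0=n and ?nc1.0=n and ?nc2.0=n]) auto

lemma minus_transpose: "dim_row A = dim_row B \<Longrightarrow> dim_col A = dim_col B \<Longrightarrow> (A - B)\<^sup>T = A\<^sup>T - B\<^sup>T"
  by (rule eq_matI) auto

lemma smult_transpose: "(c \<cdot>\<^sub>m A)\<^sup>T = c \<cdot>\<^sub>m A\<^sup>T"
  by (rule eq_matI) auto

lemma mult_transpose: "dim_col A = dim_row B \<Longrightarrow> (A * B :: 'a::comm_semiring_0 mat)\<^sup>T = B\<^sup>T * A\<^sup>T"
  by (rule transpose_mult) auto

lemmas transpose_dim_simps = dsum_transpose minus_transpose smult_transpose mult_transpose

lemma unit_det_mult:
  fixes A :: "'a::idom mat"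
  assumes "A \<in> sq_mat k" "B \<in> sq_mat k" "det A dvd 1" "det B dvd 1"
  shows "det (A * B) dvd 1"
  using assms mult_dvd_mono[of "det A" 1 "det B" 1] by (simp add: det_mult)

lemma unit_det_dsum:
  fixes A :: "'a::idom mat"
  assumes "A \<in> sq_mat k" "B \<in> sq_mat l" "det A dvd 1" "det B dvd 1"
  shows "det (A \<boxplus> B) dvd 1"
  using assms mult_dvd_mono[of "det A" 1 "det B" 1] by (simp add: det_dsum)

lemma unit_det_pivot_rows:
  fixes x :: "'a::idom"
  assumes "L \<in> sq_mat n" "X \<in> sq_mat n"
  shows "pivot_rows n x L X \<in> sq_mat (n + n)" "det (pivot_rows n x L X) dvd 1"
proof -
  have c: "corner_inv n X \<in> sq_mat (n + n)" "corner n X \<in> sq_mat (n + n)"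
    using assms by (auto intro!: carrier_matI)
  have "det (corner n X) * det (corner_inv n X) = 1"
    using det_mult[OF c(2,1)] corner_inverse(1)[OF assms(2)] by simp
  then have u: "det (corner_inv n X) dvd 1" by (metis dvd_triv_right)
  let ?W = "four_block_mat (- 1\<^sub>m n) (0\<^sub>m n n) (x \<cdot>\<^sub>m L) (1\<^sub>m n)"
  have W: "?W \<in> sq_mat (n + n)" using assms by auto
  have "det ?W = det (- 1\<^sub>m n :: 'a mat) * 1"
    using assms by (subst det_four_block_mat_upper_right_zero[where n=n and m=n]) auto
  moreover have "det (- 1\<^sub>m n :: 'a mat) * det (- 1\<^sub>m n :: 'a mat) = 1"
    by (subst det_mult[symmetric, of _ n]) (auto simp: mat_dim_simps uminus_uminus_mat)
  ultimately have "det ?W dvd 1" by (metis dvd_triv_left mult_1_right)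
  then show "det (pivot_rows n x L X) dvd 1" "pivot_rows n x L X \<in> sq_mat (n + n)"
    unfolding pivot_rows_def using unit_det_mult[OF W c(1)] mult_carrier_mat[OF W c(1)] u by auto
qed

lemma unit_det_pivot_cols:
  "pivot_cols n (x :: 'a::idom) \<in> sq_mat (n + n)" "det (pivot_cols n x) dvd 1"
  unfolding pivot_cols_def by (auto simp: det_four_block_mat_lower_left_zero[where n=n and m=n])

text \<open>
  Transposition exchanges the two sides of a corner, so one computation serves both.  The
  transformations depend neither on \<open>N\<close> nor on \<open>D\<close>, and act on the first two block rows
  and columns only; this is why they leave the state coordinates alone.
\<close>

lemma finite_step:
  fixes x :: "'a::idom"
  assumes "L \<in> sq_mat n" "X \<in> sq_mat n"
  obtains U V where "U \<in> sq_mat (n + n)" "V \<in> sq_mat (n + n)"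
    "det U dvd 1" "det V dvd 1"
    "\<And>D N s. D \<in> sq_mat s \<Longrightarrow> N \<in> sq_mat (n + s) \<Longrightarrow>
      (U \<boxplus> 1\<^sub>m s) * (x \<cdot>\<^sub>m (L \<boxplus> 1\<^sub>m n \<boxplus> D) -
          attach left n s X N)
       * (V \<boxplus> 1\<^sub>m s) = 1\<^sub>m n \<boxplus> (x \<cdot>\<^sub>m ((x \<cdot>\<^sub>m L - X) \<boxplus> D) - N)"
proof (cases left)
  case True
  show ?thesis
    by (rule that[OF unit_det_pivot_rows(1)[OF assms, of x] unit_det_pivot_cols(1)[of n x] unit_det_pivot_rows(2)[OF assms] unit_det_pivot_cols(2)])
      (use finite_step_left[OF assms] True in simp)
next
  case False
  have t: "L\<^sup>T \<in> sq_mat n" "X\<^sup>T \<in> sq_mat n" using assms by auto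
  let ?U = "(pivot_cols n x)\<^sup>T" and ?V = "(pivot_rows n x (L\<^sup>T) (X\<^sup>T))\<^sup>T"
  show ?thesis
  proof (rule that[of ?U ?V])
    show "?U \<in> sq_mat (n + n)" "?V \<in> sq_mat (n + n)"
      using unit_det_pivot_rows(1)[OF t] unit_det_pivot_cols(1) by auto
    show "det ?U dvd 1" "det ?V dvd 1"
      unfolding det_transpose[OF unit_det_pivot_rows(1)[OF t]] det_transpose[OF unit_det_pivot_cols(1)]
      by (rule unit_det_pivot_cols(2) unit_det_pivot_rows(2)[OF t])+
    fix D N :: "'a mat" and s assume DN: "D \<in> sq_mat s" "N \<in> sq_mat (n + s)"
    have [simp]: "dim_row (pivot_rows n x L\<^sup>T X\<^sup>T) = n + n" "dim_col (pivot_rows n x L\<^sup>T X\<^sup>T) = n + n"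
      "dim_row (pivot_cols n x) = n + n" "dim_col (pivot_cols n x) = n + n"
      using unit_det_pivot_rows(1)[OF t] unit_det_pivot_cols(1)[of n x] by auto
    have "(pivot_rows n x L\<^sup>T X\<^sup>T \<boxplus> 1\<^sub>m s) * (x \<cdot>\<^sub>m (L\<^sup>T \<boxplus> 1\<^sub>m n \<boxplus> D\<^sup>T) -
        (corner n X\<^sup>T \<boxplus> 1\<^sub>m s) * (1\<^sub>m n \<boxplus> N\<^sup>T)) * (pivot_cols n x \<boxplus> 1\<^sub>m s)
      = 1\<^sub>m n \<boxplus> (x \<cdot>\<^sub>m ((x \<cdot>\<^sub>m L\<^sup>T - X\<^sup>T) \<boxplus> D\<^sup>T) - N\<^sup>T)" (is "?l = ?r")
      by (rule finite_step_left) (use t DN in auto)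
    then have "?l\<^sup>T = ?r\<^sup>T" by simp
    then show "(?U \<boxplus> 1\<^sub>m s) * (x \<cdot>\<^sub>m (L \<boxplus> 1\<^sub>m n \<boxplus> D) -
          attach left n s X N)
       * (?V \<boxplus> 1\<^sub>m s) = 1\<^sub>m n \<boxplus> (x \<cdot>\<^sub>m ((x \<cdot>\<^sub>m L - X) \<boxplus> D) - N)"
      using False assms DN by (simp add: transpose_dim_simps corner_transpose[OF assms(2), symmetric] mat_assoc_dim)
  qed
qed

text \<open>
  Induction on the number of corners.  The last \<open>r\<close> coordinates are kept apart because a system
  equivalence must not mix them with the others.
\<close>

lemma finite_reduction:
  fixes x :: "'a::idom"
  assumes "Z \<in> sq_mat (n + r)" "\<And>i. i \<le> k \<Longrightarrow> X i \<in> sq_mat n"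
    "L \<in> sq_mat n" "D \<in> sq_mat r"
  shows "\<exists>U V. U \<in> sq_mat (n + k * n) \<and> V \<in> sq_mat (n + k * n)
    \<and> det U dvd 1 \<and> det V dvd 1 \<and>
    (U \<boxplus> 1\<^sub>m r) * (x \<cdot>\<^sub>m (L \<boxplus> 1\<^sub>m (k * n) \<boxplus> D) - nested n r Z side X k) * (V \<boxplus> 1\<^sub>m r)
     = 1\<^sub>m (k * n) \<boxplus> (x \<cdot>\<^sub>m (horner x X k L \<boxplus> D) - Z)"
  using assms(2,3)
proof (induction k arbitrary: L)
  case 0
  have [simp]: "0\<^sub>m 0 0 \<boxplus> M = M" for M :: "'a mat" by (rule eq_matI) (auto simp: dsum_def)
  have [simp]: "1\<^sub>m 0 = (0\<^sub>m 0 0 :: 'a mat)" by (rule eq_matI) auto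
  show ?case
    by (rule exI[of _ "1\<^sub>m n"], rule exI[of _ "1\<^sub>m n"]) (use assms 0 in \<open>simp add: mat_one_zero_dim\<close>)
next
  case (Suc k)
  let ?X = "X (Suc k)" and ?N = "nested n r Z side X k" and ?s = "k * n + r"
  have X: "?X \<in> sq_mat n" using Suc.prems(1) by simp
  have L': "x \<cdot>\<^sub>m L - ?X \<in> sq_mat n" using X Suc.prems(2) by auto
  have N: "?N \<in> sq_mat (n + ?s)" using nested_carrier[OF assms(1), of k X] Suc.prems(1) by simp
  have D: "1\<^sub>m (k * n) \<boxplus> D \<in> sq_mat ?s" using assms(4) by simp
  obtain U1 V1 where 1: "U1 \<in> sq_mat (n + n)" "V1 \<in> sq_mat (n + n)"
    "det U1 dvd 1" "det V1 dvd 1"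
    "\<And>D N s. D \<in> sq_mat s \<Longrightarrow> N \<in> sq_mat (n + s) \<Longrightarrow>
      (U1 \<boxplus> 1\<^sub>m s) * (x \<cdot>\<^sub>m (L \<boxplus> 1\<^sub>m n \<boxplus> D) -
          attach (side (Suc k)) n s ?X N)
       * (V1 \<boxplus> 1\<^sub>m s) = 1\<^sub>m n \<boxplus> (x \<cdot>\<^sub>m ((x \<cdot>\<^sub>m L - ?X) \<boxplus> D) - N)"
    using finite_step[OF Suc.prems(2) X, of x "side (Suc k)"] by metis
  obtain U2 V2 where 2: "U2 \<in> sq_mat (n + k * n)" "V2 \<in> sq_mat (n + k * n)"
    "det U2 dvd 1" "det V2 dvd 1"
    "(U2 \<boxplus> 1\<^sub>m r) * (x \<cdot>\<^sub>m ((x \<cdot>\<^sub>m L - ?X) \<boxplus> 1\<^sub>m (k * n) \<boxplus> D) - ?N) * (V2 \<boxplus> 1\<^sub>m r)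
     = 1\<^sub>m (k * n) \<boxplus> (x \<cdot>\<^sub>m (horner x X k (x \<cdot>\<^sub>m L - ?X) \<boxplus> D) - Z)"
    using Suc.IH[OF _ L'] Suc.prems(1) by (metis le_SucI)
  let ?U = "(1\<^sub>m n \<boxplus> U2) * (U1 \<boxplus> 1\<^sub>m (k * n))" and ?V = "(V1 \<boxplus> 1\<^sub>m (k * n)) * (1\<^sub>m n \<boxplus> V2)"
  let ?F = "x \<cdot>\<^sub>m (L \<boxplus> 1\<^sub>m (Suc k * n) \<boxplus> D) - nested n r Z side X (Suc k)"
  let ?F' = "x \<cdot>\<^sub>m ((x \<cdot>\<^sub>m L - ?X) \<boxplus> 1\<^sub>m (k * n) \<boxplus> D) - ?N"
  note dims = 1(1) 1(2) 2(1) 2(2) X Suc.prems(2) N assms(4) assms(1)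
  note [simp] = dims[THEN carrier_matD(1)] dims[THEN carrier_matD(2)]
  have U: "?U \<boxplus> 1\<^sub>m r = (1\<^sub>m n \<boxplus> (U2 \<boxplus> 1\<^sub>m r)) * (U1 \<boxplus> 1\<^sub>m ?s)"
    by (simp add: dsum_assoc[symmetric] dsum_one[symmetric, of "k * n" r] dsum_mult_dim mat_one_zero_dim del: dsum_one)
  have V: "?V \<boxplus> 1\<^sub>m r = (V1 \<boxplus> 1\<^sub>m ?s) * (1\<^sub>m n \<boxplus> (V2 \<boxplus> 1\<^sub>m r))"
    by (simp add: dsum_assoc[symmetric] dsum_one[symmetric, of "k * n" r] dsum_mult_dim mat_one_zero_dim del: dsum_one)
  have F: "(U1 \<boxplus> 1\<^sub>m ?s) * ?F * (V1 \<boxplus> 1\<^sub>m ?s) = 1\<^sub>m n \<boxplus> ?F'"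
  proof -
    have "L \<boxplus> 1\<^sub>m (Suc k * n) \<boxplus> D = L \<boxplus> 1\<^sub>m n \<boxplus> (1\<^sub>m (k * n) \<boxplus> D)"
      by (simp add: dsum_assoc[symmetric])
    then show ?thesis using 1(5)[OF D N] by simp
  qed
  have "(?U \<boxplus> 1\<^sub>m r) * ?F * (?V \<boxplus> 1\<^sub>m r)
     = (1\<^sub>m n \<boxplus> (U2 \<boxplus> 1\<^sub>m r)) * ((U1 \<boxplus> 1\<^sub>m ?s) * ?F * (V1 \<boxplus> 1\<^sub>m ?s)) * (1\<^sub>m n \<boxplus> (V2 \<boxplus> 1\<^sub>m r))"
    unfolding U V by (simp add: mat_assoc_dim)
  also have "\<dots> = 1\<^sub>m n \<boxplus> (U2 \<boxplus> 1\<^sub>m r) * ?F' * (V2 \<boxplus> 1\<^sub>m r)"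
    unfolding F by (simp add: dsum_mult_dim mat_one_zero_dim)
  also have "\<dots> = 1\<^sub>m (Suc k * n) \<boxplus> (x \<cdot>\<^sub>m (horner x X (Suc k) L \<boxplus> D) - Z)"
    unfolding 2(5) by (simp add: dsum_assoc[symmetric])
  finally have eq: "(?U \<boxplus> 1\<^sub>m r) * ?F * (?V \<boxplus> 1\<^sub>m r) = 1\<^sub>m (Suc k * n) \<boxplus> (x \<cdot>\<^sub>m (horner x X (Suc k) L \<boxplus> D) - Z)" .
  have c: "1\<^sub>m n \<boxplus> U2 \<in> sq_mat (n + Suc k * n)" "U1 \<boxplus> 1\<^sub>m (k * n) \<in> sq_mat (n + Suc k * n)"
    "1\<^sub>m n \<boxplus> V2 \<in> sq_mat (n + Suc k * n)" "V1 \<boxplus> 1\<^sub>m (k * n) \<in> sq_mat (n + Suc k * n)"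
    by (auto intro!: carrier_matI)
  have "det ?U dvd 1"
    by (rule unit_det_mult[OF c(1,2) unit_det_dsum[OF one_carrier_mat 2(1) _ 2(3)] unit_det_dsum[OF 1(1) one_carrier_mat 1(3)]])
      simp_all
  moreover have "det ?V dvd 1"
    by (rule unit_det_mult[OF c(4,3) unit_det_dsum[OF 1(2) one_carrier_mat 1(4)] unit_det_dsum[OF one_carrier_mat 2(2) _ 2(4)]])
      simp_all
  ultimately show ?case using eq mult_carrier_mat[OF c(1,2)] mult_carrier_mat[OF c(4,3)]
    by (intro exI[of _ ?U] exI[of _ ?V]) (simp del: nested.simps)
qed

section \<open>Proper and biproper rational matrices\<close>

text \<open>
  The value at infinity of a rational function.
\<close>

definition tends :: "complex poly fract \<Rightarrow> complex \<Rightarrow> bool" where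
  "tends f l \<longleftrightarrow> (rat_eval f \<longlongrightarrow> l) at_infinity"

lemma eventually_poly_nonzero: "(q :: complex poly) \<noteq> 0 \<Longrightarrow> eventually (\<lambda>z. poly q z \<noteq> 0) at_infinity"
proof -
  assume "q \<noteq> 0"
  then have fin: "finite {z. poly q z = 0}" by (rule poly_roots_finite)
  have "norm z \<le> (\<Sum>w | poly q w = 0. norm w)" if "poly q z = 0" for z
    using fin that by (intro member_le_sum) auto
  then show ?thesis unfolding eventually_at_infinity
    by (intro exI[of _ "(\<Sum>w | poly q w = 0. norm w) + 1"]) force
qed

lemma at_infinity_complex_nontrivial: "at_infinity \<noteq> (bot :: complex filter)"
proof
  assume "at_infinity = (bot :: complex filter)"
  then have "eventually (\<lambda>z :: complex. False) at_infinity" by simp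
  then obtain b where "\<And>z :: complex. norm z \<ge> b \<Longrightarrow> False" unfolding eventually_at_infinity by auto
  from this[of "of_real \<bar>b\<bar>"] show False using abs_ge_self[of b] by simp
qed

text \<open>
  Cancelling a common factor changes the value at finitely many points only, and none of them is
  near infinity.
\<close>

lemma rat_eval_Fract:
  assumes "b \<noteq> 0"
  shows "eventually (\<lambda>z. rat_eval (Fract a b) z = poly a z / poly b z) at_infinity"
proof -
  obtain p q where pq: "quot_of_fract (Fract a b) = (p, q)" by force
  have q: "q \<noteq> 0" using snd_quot_of_fract_nonzero[of "Fract a b"] pq by simp
  have "Fract p q = Fract a b" using Fract_quot_of_fract[of "Fract a b"] pq by simp
  then have e: "p * b = a * q" using assms q by (simp add: eq_fract)
  show ?thesis using eventually_poly_nonzero[OF assms] eventually_poly_nonzero[OF q]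
  proof eventually_elim
    case (elim z)
    have "poly p z * poly b z = poly a z * poly q z" using arg_cong[OF e, of "\<lambda>p. poly p z"] by simp
    then show ?case using elim pq by (simp add: rat_eval_def frac_eq_eq)
  qed
qed

lemma tends_Fract: "b \<noteq> 0 \<Longrightarrow> tends (Fract a b) l \<longleftrightarrow> ((\<lambda>z. poly a z / poly b z) \<longlongrightarrow> l) at_infinity"
  unfolding tends_def by (intro tendsto_cong rat_eval_Fract)

lemma tends_add: "tends f k \<Longrightarrow> tends g l \<Longrightarrow> tends (f + g) (k + l)"
proof (cases f rule: Fract_cases, cases g rule: Fract_cases)
  fix a b c d assume f: "f = Fract a b" "b \<noteq> 0" and g: "g = Fract c d" "d \<noteq> 0" and "tends f k" "tends g l"
  then have "((\<lambda>z. poly a z / poly b z + poly c z / poly d z) \<longlongrightarrow> k + l) at_infinity"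
    by (intro tendsto_add) (simp_all add: tends_Fract)
  moreover have "eventually (\<lambda>z. poly a z / poly b z + poly c z / poly d z = poly (a * d + c * b) z / poly (b * d) z) at_infinity"
    using eventually_poly_nonzero[OF f(2)] eventually_poly_nonzero[OF g(2)]
    by eventually_elim (simp add: add_frac_eq)
  ultimately have "((\<lambda>z. poly (a * d + c * b) z / poly (b * d) z) \<longlongrightarrow> k + l) at_infinity"
    by (rule Lim_transform_eventually)
  then show ?thesis using f g by (simp add: add_fract tends_Fract)
qed

lemma tends_mult: "tends f k \<Longrightarrow> tends g l \<Longrightarrow> tends (f * g) (k * l)"
proof (cases f rule: Fract_cases, cases g rule: Fract_cases)
  fix a b c d assume f: "f = Fract a b" "b \<noteq> 0" and g: "g = Fract c d" "d \<noteq> 0" and "tends f k" "tends g l"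
  then have "((\<lambda>z. poly a z / poly b z * (poly c z / poly d z)) \<longlongrightarrow> k * l) at_infinity"
    by (intro tendsto_mult) (simp_all add: tends_Fract)
  then show ?thesis using f g by (simp add: tends_Fract)
qed

lemma tends_inverse: "tends f k \<Longrightarrow> k \<noteq> 0 \<Longrightarrow> tends (inverse f) (inverse k)"
proof (cases f rule: Fract_cases)
  fix a b assume f: "f = Fract a b" "b \<noteq> 0" and t: "tends f k" and k: "k \<noteq> 0"
  have a: "a \<noteq> 0"
  proof
    assume "a = 0"
    then have "((\<lambda>z :: complex. 0) \<longlongrightarrow> k) at_infinity" using f t by (simp add: tends_Fract)
    then show False using k tendsto_unique[OF at_infinity_complex_nontrivial tendsto_const] by blast
  qed
  have "((\<lambda>z. inverse (poly a z / poly b z)) \<longlongrightarrow> inverse k) at_infinity"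
    using f t k by (intro tendsto_inverse) (simp_all add: tends_Fract)
  then show ?thesis using f a by (simp add: tends_Fract)
qed

lemma tends_const: "tends (to_fract [:c:]) c"
  unfolding to_fract_def by (subst tends_Fract) auto

lemma tends_0 [simp]: "tends 0 0" using tends_const[of 0] by simp
lemma tends_1 [simp]: "tends 1 1" using tends_const[of 1] by (simp add: one_pCons[symmetric])

lemma tends_uminus: "tends f k \<Longrightarrow> tends (- f) (- k)"
proof -
  assume "tends f k"
  then have "tends (to_fract [:- 1:] * f) (- 1 * k)" by (intro tends_mult tends_const)
  moreover have "[:- 1:] = - (1 :: complex poly)" by (simp add: one_pCons)
  then have "to_fract [:- 1:] = (- 1 :: complex poly fract)" by (simp only: to_fract_uminus to_fract_1)
  ultimately show ?thesis by simp
qed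

lemma tends_minus: "tends f k \<Longrightarrow> tends g l \<Longrightarrow> tends (f - g) (k - l)"
  using tends_add[of f k "- g" "- l"] tends_uminus[of g l] by simp

lemma tends_sum: "(\<And>i. i \<in> I \<Longrightarrow> tends (f i) (g i)) \<Longrightarrow> tends (sum f I) (sum g I)"
  by (induction I rule: infinite_finite_induct) (auto intro: tends_add)

lemma tends_prod: "(\<And>i. i \<in> I \<Longrightarrow> tends (f i) (g i)) \<Longrightarrow> tends (prod f I) (prod g I)"
  by (induction I rule: infinite_finite_induct) (auto intro: tends_mult)

lemma tends_inverse_lam: "tends (inverse (to_fract lam)) 0"
proof -
  have "((\<lambda>z :: complex. inverse z) \<longlongrightarrow> 0) at_infinity" by (rule tendsto_inverse_0)
  moreover have "inverse (to_fract lam) = Fract 1 lam" by (simp add: to_fract_def)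
  moreover have "lam \<noteq> 0" by (simp add: lam_def)
  ultimately show ?thesis by (simp add: tends_Fract) (simp add: lam_def inverse_eq_divide)
qed

lemma tends_unique: "tends f k \<Longrightarrow> tends f l \<Longrightarrow> k = l"
  unfolding tends_def using tendsto_unique[OF at_infinity_complex_nontrivial] by blast

text \<open>
  The rational functions without a pole at infinity, which form a ring.
\<close>

definition proper :: "complex poly fract \<Rightarrow> bool" where
  "proper f \<longleftrightarrow> (\<exists>l. tends f l)"

lemma proper_intros:
  "proper 0" "proper 1" "proper f \<Longrightarrow> proper g \<Longrightarrow> proper (f + g)" "proper f \<Longrightarrow> proper g \<Longrightarrow> proper (f - g)"
  "proper f \<Longrightarrow> proper g \<Longrightarrow> proper (f * g)" "proper f \<Longrightarrow> proper (- f)" "proper (to_fract [:c:])"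
  "proper (inverse (to_fract lam))"
  unfolding proper_def
  by (rule exI, rule tends_0 tends_1 tends_const tends_inverse_lam
      | elim exE, rule exI, rule tends_add tends_minus tends_mult tends_uminus, assumption+)+

lemma proper_power: "proper f \<Longrightarrow> proper (f ^ k)"
  by (induction k) (auto intro: proper_intros)

lemma proper_sum: "(\<And>i. i \<in> I \<Longrightarrow> proper (f i)) \<Longrightarrow> proper (sum f I)"
  by (induction I rule: infinite_finite_induct) (auto intro: proper_intros)

definition proper_mat :: "complex poly fract mat \<Rightarrow> bool" where
  "proper_mat F \<longleftrightarrow> (\<forall>i < dim_row F. \<forall>j < dim_col F. proper (F $$ (i, j)))"

lemma proper_mat_mult: "proper_mat F \<Longrightarrow> proper_mat G \<Longrightarrow> dim_col F = dim_row G \<Longrightarrow> proper_mat (F * G)"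
  unfolding proper_mat_def by (auto simp: scalar_prod_def intro!: proper_sum proper_intros)

lemma proper_mat_intros:
  "proper_mat F \<Longrightarrow> proper_mat G \<Longrightarrow> dim_row F = dim_row G \<Longrightarrow> dim_col F = dim_col G \<Longrightarrow> proper_mat (F + G)"
  "proper_mat F \<Longrightarrow> proper_mat G \<Longrightarrow> dim_row F = dim_row G \<Longrightarrow> dim_col F = dim_col G \<Longrightarrow> proper_mat (F - G)"
  "proper_mat F \<Longrightarrow> proper_mat (- F)"
  "proper c \<Longrightarrow> proper_mat F \<Longrightarrow> proper_mat (c \<cdot>\<^sub>m F)"
  "proper_mat (1\<^sub>m a)" "proper_mat (0\<^sub>m a b)" "proper_mat F \<Longrightarrow> proper_mat (F\<^sup>T)"
  "proper_mat (rat_mat (const_mat A))"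
  unfolding proper_mat_def by (auto intro: proper_intros)

lemma proper_mat_four_block:
  assumes "proper_mat A" "proper_mat B" "proper_mat C" "proper_mat D"
    "dim_row B = dim_row A" "dim_col C = dim_col A" "dim_row D = dim_row C" "dim_col D = dim_col B"
  shows "proper_mat (four_block_mat A B C D)"
  using assms unfolding proper_mat_def by auto

lemma proper_mat_dsum: "proper_mat A \<Longrightarrow> proper_mat B \<Longrightarrow> proper_mat (A \<boxplus> B)"
  unfolding dsum_def by (rule proper_mat_four_block) (auto intro: proper_mat_intros)

lemma proper_mat_lead_block: "proper_mat (lead_block n s)"
  unfolding proper_mat_def by (auto simp: lead_block_def intro: proper_intros)

lemma proper_mat_corner: "X \<in> sq_mat n \<Longrightarrow> proper_mat X \<Longrightarrow> proper_mat (corner n X)"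
  "X \<in> sq_mat n \<Longrightarrow> proper_mat X \<Longrightarrow> proper_mat (corner_inv n X)"
  unfolding corner_def corner_inv_def by (auto intro!: proper_mat_four_block proper_mat_intros)

text \<open>
  Entrywise limits at infinity; a biproper matrix is one whose limit is nonsingular.
\<close>

definition mat_tends :: "nat \<Rightarrow> nat \<Rightarrow> complex poly fract mat \<Rightarrow> complex mat \<Rightarrow> bool" where
  "mat_tends a b F L \<longleftrightarrow> F \<in> carrier_mat a b \<and> L \<in> carrier_mat a b \<and>
     (\<forall>i<a. \<forall>j<b. tends (F $$ (i, j)) (L $$ (i, j)))"

lemma proper_mat_tends:
  assumes "proper_mat F" "F \<in> carrier_mat a b"
  obtains L where "mat_tends a b F L"
proof -
  define L where "L = mat a b (\<lambda>ij. SOME l. tends (F $$ ij) l)"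
  have "mat_tends a b F L"
    using assms unfolding mat_tends_def L_def proper_mat_def proper_def by (auto intro: someI_ex)
  then show ?thesis by (rule that)
qed

lemma mat_tends_mult: "mat_tends a b F L \<Longrightarrow> mat_tends b c G M \<Longrightarrow> mat_tends a c (F * G) (L * M)"
  unfolding mat_tends_def by (auto simp: scalar_prod_def intro!: tends_sum tends_mult)

lemma mat_tends_unique: "mat_tends a b F L \<Longrightarrow> mat_tends a b F M \<Longrightarrow> L = M"
  unfolding mat_tends_def
proof (intro eq_matI; elim conjE)
  fix i j assume "i < dim_row M" "j < dim_col M" "M \<in> carrier_mat a b"
    and "\<forall>i<a. \<forall>j<b. tends (F $$ (i, j)) (L $$ (i, j))" "\<forall>i<a. \<forall>j<b. tends (F $$ (i, j)) (M $$ (i, j))"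
  then show "L $$ (i, j) = M $$ (i, j)" by (intro tends_unique[of "F $$ (i, j)"]) auto
qed auto

lemma biproper_iff: "biproper N F \<longleftrightarrow> (\<exists>L. mat_tends N N F L \<and> det L \<noteq> 0)"
  unfolding biproper_def mat_tends_def tends_def by auto

lemma biproper_carrier: "biproper N F \<Longrightarrow> F \<in> sq_mat N"
  unfolding biproper_def by simp

lemma biproper_mult: "biproper N F \<Longrightarrow> biproper N G \<Longrightarrow> biproper N (F * G)"
  unfolding biproper_iff
proof (elim exE conjE)
  fix L M assume "mat_tends N N F L" "mat_tends N N G M" and d: "det L \<noteq> 0" "det M \<noteq> 0"
  then have "mat_tends N N (F * G) (L * M)" and "L \<in> sq_mat N" "M \<in> sq_mat N"
    using mat_tends_mult by (auto simp: mat_tends_def)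
  with d show "\<exists>L. mat_tends N N (F * G) L \<and> det L \<noteq> 0" by (auto simp: det_mult)
qed

lemma biproper_transpose: "biproper N F \<Longrightarrow> biproper N (F\<^sup>T)"
  unfolding biproper_iff
proof (elim exE conjE)
  fix L assume "mat_tends N N F L" "det L \<noteq> 0"
  then show "\<exists>L. mat_tends N N (F\<^sup>T) L \<and> det L \<noteq> 0"
    by (intro exI[of _ "L\<^sup>T"]) (auto simp: mat_tends_def det_transpose)
qed

lemma biproper_dsum:
  assumes "biproper N F" "biproper K G"
  shows "biproper (N + K) (F \<boxplus> G)"
proof -
  from assms obtain L M where "mat_tends N N F L" "det L \<noteq> 0" "mat_tends K K G M" "det M \<noteq> 0"
    unfolding biproper_iff by auto
  moreover from calculation have "mat_tends (N + K) (N + K) (F \<boxplus> G) (L \<boxplus> M)"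
    by (auto simp: mat_tends_def dsum_def)
  ultimately show ?thesis unfolding biproper_iff
    by (intro exI[of _ "L \<boxplus> M"]) (auto simp: mat_tends_def det_dsum)
qed

text \<open>
  The limits of two mutually inverse proper matrices are mutually inverse, hence nonsingular.
\<close>

lemma biproper_of_proper_inverse:
  assumes "F \<in> sq_mat N" "G \<in> sq_mat N" "proper_mat F" "proper_mat G" "F * G = 1\<^sub>m N"
  shows "biproper N F"
proof -
  obtain L M where L: "mat_tends N N F L" and M: "mat_tends N N G M"
    using proper_mat_tends assms by metis
  have "mat_tends N N (1\<^sub>m N) (L * M)" using mat_tends_mult[OF L M] assms by simp
  moreover have "mat_tends N N (1\<^sub>m N) (1\<^sub>m N)" by (auto simp: mat_tends_def)
  ultimately have "L * M = 1\<^sub>m N" by (rule mat_tends_unique)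
  then have "det L * det M = 1" using L M det_mult[of L N M] by (simp add: mat_tends_def)
  then show ?thesis using L unfolding biproper_iff by auto
qed

lemma biproper_one: "biproper N (1\<^sub>m N)"
  by (rule biproper_of_proper_inverse[of _ _ "1\<^sub>m N"]) (auto intro: proper_mat_intros)

lemma biproper_const:
  assumes "A \<in> sq_mat N" "det A \<noteq> 0"
  shows "biproper N (rat_mat (const_mat A))"
  unfolding biproper_iff by (rule exI[of _ A]) (use assms in \<open>auto simp: mat_tends_def intro: tends_const\<close>)

lemma biproper_corner_inv:
  assumes "X \<in> sq_mat n" "proper_mat X"
  shows "biproper (n + n) (corner_inv n X)"
  by (rule biproper_of_proper_inverse[of _ _ "corner n X"])
    (use assms in \<open>auto intro!: carrier_matI proper_mat_corner simp: corner_inverse\<close>)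

lemma biproper_lower:
  assumes "W \<in> carrier_mat b a" "proper_mat W"
  shows "biproper (a + b) (four_block_mat (1\<^sub>m a) (0\<^sub>m a b) W (1\<^sub>m b))"
proof (rule biproper_of_proper_inverse[of _ _ "four_block_mat (1\<^sub>m a) (0\<^sub>m a b) (- W) (1\<^sub>m b)"])
  have [simp]: "dim_row W = b" "dim_col W = a" using assms by auto
  have "W + - W = 0\<^sub>m b a" by (rule eq_matI) auto
  then show "four_block_mat (1\<^sub>m a) (0\<^sub>m a b) W (1\<^sub>m b) * four_block_mat (1\<^sub>m a) (0\<^sub>m a b) (- W) (1\<^sub>m b) = 1\<^sub>m (a + b)"
    by (simp add: four_block_mult_dim mat_one_zero_dim mat_add_zero_dim)
qed (use assms in \<open>auto intro!: proper_mat_four_block proper_mat_intros\<close>)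

section \<open>The reduction at infinity\<close>

lemma proper_mat_nested:
  assumes "Z \<in> sq_mat (n + r)" "\<And>i. i \<le> k \<Longrightarrow> X i \<in> sq_mat n"
    "proper_mat Z" "\<And>i. i \<le> k \<Longrightarrow> proper_mat (X i)"
  shows "proper_mat (nested n r Z side X k)"
  using assms(2,4)
proof (induction k)
  case (Suc k)
  have N: "proper_mat (nested n r Z side X k)" by (rule Suc.IH) (use Suc.prems in auto)
  have c: "nested n r Z side X k \<in> sq_mat (n + (k * n + r))"
    by (rule nested_carrier) (use assms(1) Suc.prems in auto)
  have X: "X (Suc k) \<in> sq_mat n" "proper_mat (X (Suc k))" using Suc.prems by auto
  show ?case using N c X
    by (auto intro!: proper_mat_mult proper_mat_dsum proper_mat_intros proper_mat_corner)
qed (use assms in simp)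

text \<open>
  The elimination uses rows of the inner product \<open>N\<close>, so it is biproper only because \<open>N\<close> is proper.
  It would also mix the state coordinates with the others, which is the reason for removing
  these beforehand.
\<close>

lemma infinite_step:
  fixes \<mu> \<alpha> \<beta> :: "complex poly fract"
  assumes c: "L \<in> sq_mat n" "X \<in> sq_mat n" "N \<in> sq_mat (n + s)"
    and p: "proper_mat X" "proper_mat N" "proper \<mu>" "proper \<alpha>" "proper \<beta>"
  shows "\<exists>U V. biproper (n + n + s) U \<and> biproper (n + n + s) V \<and>
    U * ((L \<boxplus> 1\<^sub>m (n + s)) - \<mu> \<cdot>\<^sub>m (lead_scale n (n + s) \<alpha>
       * attach left n s X N
       * lead_scale n (n + s) \<beta>)) * V
    = 1\<^sub>m n \<boxplus> (((L - (\<mu> * \<alpha> * \<beta>) \<cdot>\<^sub>m X) \<boxplus> 1\<^sub>m s)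
        - \<mu> \<cdot>\<^sub>m (lead_scale n s (if left then \<alpha> else \<mu> * \<alpha>) * N * lead_scale n s (if left then \<mu> * \<beta> else \<beta>)))"
proof -
  have main: "\<exists>U V. biproper (n + n + s) U \<and> biproper (n + n + s) V \<and>
    U * ((L \<boxplus> 1\<^sub>m (n + s)) - \<mu> \<cdot>\<^sub>m (lead_scale n (n + s) \<alpha>
       * ((corner n X \<boxplus> 1\<^sub>m s) * (1\<^sub>m n \<boxplus> N))
       * lead_scale n (n + s) \<beta>)) * V
    = 1\<^sub>m n \<boxplus> (((L - (\<mu> * \<alpha> * \<beta>) \<cdot>\<^sub>m X) \<boxplus> 1\<^sub>m s)
        - \<mu> \<cdot>\<^sub>m (lead_scale n s \<alpha> * N * lead_scale n s (\<mu> * \<beta>)))"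
    if c: "L \<in> sq_mat n" "X \<in> sq_mat n" "N \<in> sq_mat (n + s)"
      and p: "proper_mat X" "proper_mat N" "proper \<mu>" "proper \<alpha>" "proper \<beta>"
    for L X N and \<alpha> \<beta> :: "complex poly fract"
  proof -
    define Q where "Q = (- (\<alpha> \<cdot>\<^sub>m X) \<boxplus> 1\<^sub>m s) - \<mu> \<cdot>\<^sub>m (lead_scale n s \<alpha> * N)"
    note [simp] = carrier_matD[OF c(1)] carrier_matD[OF c(2)] carrier_matD[OF c(3)]
    have Q: "proper_mat Q" "dim_row Q = n + s" "dim_col Q = n + s"
      unfolding Q_def using p
      by (auto intro!: proper_mat_mult proper_mat_dsum proper_mat_intros)
    define U where "U = four_block_mat (1\<^sub>m n) (0\<^sub>m n (n + s)) (- (Q * (lead_block n s)\<^sup>T)) (1\<^sub>m (n + s)) * (corner_inv n (\<alpha> \<cdot>\<^sub>m X) \<boxplus> 1\<^sub>m s)"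
    define V where "V = four_block_mat (0\<^sub>m n n) (1\<^sub>m n) (1\<^sub>m n) ((\<mu> * \<beta>) \<cdot>\<^sub>m 1\<^sub>m n :: complex poly fract mat) \<boxplus> 1\<^sub>m s"
    have "biproper (n + (n + s)) (four_block_mat (1\<^sub>m n) (0\<^sub>m n (n + s)) (- (Q * (lead_block n s)\<^sup>T)) (1\<^sub>m (n + s)))"
      using Q by (intro biproper_lower) (auto intro!: carrier_matI proper_mat_mult proper_mat_intros proper_mat_lead_block)
    moreover have "biproper (n + n + s) (corner_inv n (\<alpha> \<cdot>\<^sub>m X) \<boxplus> 1\<^sub>m s)"
      using p c by (intro biproper_dsum biproper_corner_inv biproper_one) (auto intro: proper_mat_intros)
    ultimately have U: "biproper (n + n + s) U" unfolding U_def
      by (intro biproper_mult) (simp_all add: add.assoc)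
    have "four_block_mat (0\<^sub>m n n) (1\<^sub>m n) (1\<^sub>m n) ((\<mu> * \<beta>) \<cdot>\<^sub>m 1\<^sub>m n :: complex poly fract mat) = corner_inv n (- ((\<mu> * \<beta>) \<cdot>\<^sub>m 1\<^sub>m n))"
      by (simp add: corner_inv_def uminus_uminus_mat)
    then have V: "biproper (n + n + s) V" unfolding V_def using p
      by (auto intro!: biproper_dsum biproper_corner_inv biproper_one proper_mat_intros proper_intros)
    show ?thesis
      using infinite_step_left[OF c(1,2) one_carrier_mat c(3), of \<alpha> \<mu> \<beta>, folded Q_def, folded U_def V_def] U V
      by (intro exI[of _ U] exI[of _ V]) simp
  qed
  show ?thesis
  proof (cases left)
    case True
    then show ?thesis using main[OF c p] by simp
  next
    case False
    have ct: "L\<^sup>T \<in> sq_mat n" "X\<^sup>T \<in> sq_mat n" "N\<^sup>T \<in> sq_mat (n + s)" using c by auto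
    note [simp] = carrier_matD[OF c(1)] carrier_matD[OF c(2)] carrier_matD[OF c(3)]
    obtain U V where UV: "biproper (n + n + s) U" "biproper (n + n + s) V" and eq:
      "U * ((L\<^sup>T \<boxplus> 1\<^sub>m (n + s)) - \<mu> \<cdot>\<^sub>m (lead_scale n (n + s) \<beta>
         * ((corner n X\<^sup>T \<boxplus> 1\<^sub>m s) * (1\<^sub>m n \<boxplus> N\<^sup>T))
         * lead_scale n (n + s) \<alpha>)) * V
      = 1\<^sub>m n \<boxplus> (((L\<^sup>T - (\<mu> * \<beta> * \<alpha>) \<cdot>\<^sub>m X\<^sup>T) \<boxplus> 1\<^sub>m s)
          - \<mu> \<cdot>\<^sub>m (lead_scale n s \<beta> * N\<^sup>T * lead_scale n s (\<mu> * \<alpha>)))" (is "?l = ?r")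
      using main[OF ct, of \<beta> \<alpha>] p by (auto intro: proper_mat_intros)
    note [simp] = carrier_matD[OF biproper_carrier[OF UV(1)]] carrier_matD[OF biproper_carrier[OF UV(2)]]
    from eq have "?l\<^sup>T = ?r\<^sup>T" by simp
    then show ?thesis using False UV
      by (intro exI[of _ "V\<^sup>T"] exI[of _ "U\<^sup>T"])
        (simp add: transpose_dim_simps corner_transpose[OF c(2), symmetric] mat_assoc_dim biproper_transpose mult.commute mult.left_commute)
  qed
qed

text \<open>
  The exchange between the scaled coefficient \<open>\<mu>\<^sup>cl\<close> and the Horner step \<open>xl - z\<close> for \<open>\<mu> = x\<^sup>-\<^sup>1\<close>.
\<close>

lemma reversal_entry:
  fixes x \<mu> :: "'a::comm_ring_1"
  assumes "\<mu> * x = 1"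
  shows "\<mu> ^ Suc c * (x * l - z) = \<mu> ^ c * l - \<mu> ^ Suc c * z"
proof -
  have "\<mu> ^ Suc c * (x * l) = (\<mu> * x) * (\<mu> ^ c * l)" by (simp only: power_Suc mult_ac)
  then show ?thesis using assms by (simp only: right_diff_distrib mult_1_left)
qed

text \<open>
  Writing the leading block as \<open>\<mu>\<^sup>a\<^sup>+\<^sup>bL\<close> makes its recursion the same Horner scheme as at finite
  points, although \<open>L\<close> itself grows with every step.
\<close>

lemma infinite_reduction:
  fixes x \<mu> :: "complex poly fract"
  assumes Z: "Z \<in> sq_mat n" "proper_mat Z" and X: "\<And>i. i \<le> k \<Longrightarrow> X i \<in> sq_mat n" "\<And>i. i \<le> k \<Longrightarrow> proper_mat (X i)"
    and L: "L \<in> sq_mat n" and \<mu>: "proper \<mu>" "\<mu> * x = 1"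
  shows "\<exists>U V. biproper (n + k * n) U \<and> biproper (n + k * n) V \<and>
    U * (((\<mu> ^ (a + b) \<cdot>\<^sub>m L) \<boxplus> 1\<^sub>m (k * n)) - \<mu> \<cdot>\<^sub>m (lead_scale n (k * n) (\<mu> ^ a) * nested n 0 Z side X k * lead_scale n (k * n) (\<mu> ^ b))) * V
     = 1\<^sub>m (k * n) \<boxplus> (\<mu> ^ (a + b + k + 1) \<cdot>\<^sub>m (x \<cdot>\<^sub>m horner x X k L - Z))"
  using X L
proof (induction k arbitrary: L a b)
  case 0
  have [simp]: "M \<boxplus> 0\<^sub>m 0 0 = M" "0\<^sub>m 0 0 \<boxplus> M = M" for M :: "complex poly fract mat"
    by (rule eq_matI; simp add: dsum_def)+
  have [simp]: "1\<^sub>m 0 = (0\<^sub>m 0 0 :: complex poly fract mat)" by (rule eq_matI) auto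
  have "\<mu> ^ (a + b) \<cdot>\<^sub>m L - \<mu> \<cdot>\<^sub>m (\<mu> ^ a \<cdot>\<^sub>m 1\<^sub>m n * Z * (\<mu> ^ b \<cdot>\<^sub>m 1\<^sub>m n)) = \<mu> ^ (a + b + 1) \<cdot>\<^sub>m (x \<cdot>\<^sub>m L - Z)"
  proof -
    have "\<mu> \<cdot>\<^sub>m (\<mu> ^ a \<cdot>\<^sub>m 1\<^sub>m n * Z * (\<mu> ^ b \<cdot>\<^sub>m 1\<^sub>m n)) = \<mu> ^ Suc (a + b) \<cdot>\<^sub>m Z"
      using Z by (simp add: mat_dim_simps smult_mat_assoc power_add mult_ac)
    then show ?thesis unfolding Suc_eq_plus1[symmetric]
      by (simp only:) (intro eq_matI; use Z 0 in \<open>simp add: reversal_entry[OF \<mu>(2), unfolded power_Suc]\<close>)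
  qed
  then show ?case using Z 0 biproper_one[of n]
    by (intro exI[of _ "1\<^sub>m n"]) (simp add: mat_one_zero_dim)
next
  case (Suc k)
  let ?X = "X (Suc k)" and ?N = "nested n 0 Z side X k" and ?s = "k * n"
  let ?a = "if side (Suc k) then a else Suc a" and ?b = "if side (Suc k) then Suc b else b"
  have X: "?X \<in> sq_mat n" "proper_mat ?X" using Suc.prems by auto
  have L': "x \<cdot>\<^sub>m L - ?X \<in> sq_mat n" using X Suc.prems by (auto intro: minus_carrier_mat)
  have Z0: "Z \<in> sq_mat (n + 0)" using Z by simp
  have N: "?N \<in> sq_mat (n + ?s)" using nested_carrier[OF Z0, of k X] Suc.prems(1) by simp
  have pN: "proper_mat ?N" by (rule proper_mat_nested[OF Z0]) (use Z Suc.prems in auto)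
  note [simp] = carrier_matD[OF X(1)] carrier_matD[OF Suc.prems(3)] carrier_matD[OF N] carrier_matD[OF Z(1)]
  let ?F = "((\<mu> ^ (a + b) \<cdot>\<^sub>m L) \<boxplus> 1\<^sub>m (Suc k * n)) - \<mu> \<cdot>\<^sub>m (lead_scale n (Suc k * n) (\<mu> ^ a) * nested n 0 Z side X (Suc k) * lead_scale n (Suc k * n) (\<mu> ^ b))"
  let ?F' = "((\<mu> ^ (?a + ?b) \<cdot>\<^sub>m (x \<cdot>\<^sub>m L - ?X)) \<boxplus> 1\<^sub>m (k * n)) - \<mu> \<cdot>\<^sub>m (lead_scale n (k * n) (\<mu> ^ ?a) * ?N * lead_scale n (k * n) (\<mu> ^ ?b))"
  have Leq: "\<mu> ^ (a + b) \<cdot>\<^sub>m L - (\<mu> * \<mu> ^ a * \<mu> ^ b) \<cdot>\<^sub>m ?X = \<mu> ^ (?a + ?b) \<cdot>\<^sub>m (x \<cdot>\<^sub>m L - ?X)"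
  proof -
    have "?a + ?b = Suc (a + b)" "\<mu> * \<mu> ^ a * \<mu> ^ b = \<mu> ^ Suc (a + b)" by (auto simp: power_add mult_ac)
    then show ?thesis
      by (simp only:) (intro eq_matI; simp add: reversal_entry[OF \<mu>(2), unfolded power_Suc])
  qed
  have "\<exists>U V. biproper (n + n + ?s) U \<and> biproper (n + n + ?s) V \<and>
    U * (((\<mu> ^ (a + b) \<cdot>\<^sub>m L) \<boxplus> 1\<^sub>m (n + ?s)) - \<mu> \<cdot>\<^sub>m (lead_scale n (n + ?s) (\<mu> ^ a)
       * attach (side (Suc k)) n ?s ?X ?N
       * lead_scale n (n + ?s) (\<mu> ^ b))) * V
    = 1\<^sub>m n \<boxplus> (((\<mu> ^ (a + b) \<cdot>\<^sub>m L - (\<mu> * \<mu> ^ a * \<mu> ^ b) \<cdot>\<^sub>m ?X) \<boxplus> 1\<^sub>m ?s)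
        - \<mu> \<cdot>\<^sub>m (lead_scale n ?s (if side (Suc k) then \<mu> ^ a else \<mu> * \<mu> ^ a) * ?N * lead_scale n ?s (if side (Suc k) then \<mu> * \<mu> ^ b else \<mu> ^ b)))"
    by (rule infinite_step) (use X(1) Suc.prems(3) N X(2) pN \<mu>(1) proper_power[OF \<mu>(1)] in simp_all)
  moreover have "(if side (Suc k) then \<mu> ^ a else \<mu> * \<mu> ^ a) = \<mu> ^ ?a" "(if side (Suc k) then \<mu> * \<mu> ^ b else \<mu> ^ b) = \<mu> ^ ?b"
    by simp_all
  moreover have "attach (side (Suc k)) n ?s ?X ?N = nested n 0 Z side X (Suc k)"
    "n + ?s = Suc k * n"
    by simp_all
  ultimately have "\<exists>U V. biproper (n + n + ?s) U \<and> biproper (n + n + ?s) V \<and> U * ?F * V = 1\<^sub>m n \<boxplus> ?F'"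
    by (simp only: Leq)
  then obtain U1 V1 where 1: "biproper (n + n + ?s) U1" "biproper (n + n + ?s) V1" and F: "U1 * ?F * V1 = 1\<^sub>m n \<boxplus> ?F'"
    by blast
  have "X i \<in> sq_mat n" "proper_mat (X i)" if "i \<le> k" for i using Suc.prems that by auto
  from Suc.IH[OF this L', of ?a ?b]
  obtain U2 V2 where 2: "biproper (n + k * n) U2" "biproper (n + k * n) V2" and F': "U2 * ?F' * V2
     = 1\<^sub>m (k * n) \<boxplus> (\<mu> ^ (?a + ?b + k + 1) \<cdot>\<^sub>m (x \<cdot>\<^sub>m horner x X k (x \<cdot>\<^sub>m L - ?X) - Z))"
    by blast
  note [simp] = carrier_matD[OF biproper_carrier[OF 1(1)]] carrier_matD[OF biproper_carrier[OF 1(2)]]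
    carrier_matD[OF biproper_carrier[OF 2(1)]] carrier_matD[OF biproper_carrier[OF 2(2)]]
  have "(1\<^sub>m n \<boxplus> U2) * U1 * ?F * (V1 * (1\<^sub>m n \<boxplus> V2)) = (1\<^sub>m n \<boxplus> U2) * (U1 * ?F * V1) * (1\<^sub>m n \<boxplus> V2)"
    by (simp add: mat_assoc_dim)
  also have "\<dots> = 1\<^sub>m n \<boxplus> (U2 * ?F' * V2)"
    unfolding F by (simp add: dsum_mult_dim mat_one_zero_dim)
  also have "\<dots> = 1\<^sub>m (Suc k * n) \<boxplus> (\<mu> ^ (a + b + Suc k + 1) \<cdot>\<^sub>m (x \<cdot>\<^sub>m horner x X (Suc k) L - Z))"
    unfolding F' by (simp add: dsum_assoc[symmetric])
  finally have "(1\<^sub>m n \<boxplus> U2) * U1 * ?F * (V1 * (1\<^sub>m n \<boxplus> V2)) = 1\<^sub>m (Suc k * n) \<boxplus> (\<mu> ^ (a + b + Suc k + 1) \<cdot>\<^sub>m (x \<cdot>\<^sub>m horner x X (Suc k) L - Z))" .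
  moreover have "biproper (n + Suc k * n) ((1\<^sub>m n \<boxplus> U2) * U1)" "biproper (n + Suc k * n) (V1 * (1\<^sub>m n \<boxplus> V2))"
    using 1 2 biproper_dsum[OF biproper_one[of n] 2(1)] biproper_dsum[OF biproper_one[of n] 2(2)]
    by (auto intro!: biproper_mult simp: add.assoc)
  ultimately show ?case by blast
qed

section \<open>Fiedler products as nested products\<close>

lemma mat_prod_Nil [simp]: "mat_prod N [] = 1\<^sub>m N" by (simp add: mat_prod_def)
lemma mat_prod_Cons [simp]: "mat_prod N (M # Ms) = M * mat_prod N Ms" by (simp add: mat_prod_def)

lemma mat_prod_carrier: "(\<And>M. M \<in> set Ms \<Longrightarrow> M \<in> sq_mat N) \<Longrightarrow> mat_prod N Ms \<in> sq_mat N"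
  by (induction Ms) (auto intro: mult_carrier_mat)

lemma mat_prod_append:
  "(\<And>M. M \<in> set (xs @ ys) \<Longrightarrow> M \<in> sq_mat N) \<Longrightarrow> mat_prod N (xs @ ys) = mat_prod N xs * mat_prod N ys"
proof (induction xs)
  case Nil
  then show ?case using mat_prod_carrier[of ys N] by (simp add: mat_one_zero_dim)
next
  case (Cons x xs)
  have "mat_prod N xs \<in> sq_mat N" "mat_prod N ys \<in> sq_mat N" "x \<in> sq_mat N"
    using Cons.prems by (auto intro: mat_prod_carrier)
  note this[THEN carrier_matD(1)] this[THEN carrier_matD(2)]
  then show ?case using Cons by (simp add: mat_assoc_dim)
qed

lemma mat_prod_dsum_left:
  fixes Ms :: "'a::ring_1 mat list"
  shows "(\<And>M. M \<in> set Ms \<Longrightarrow> M \<in> sq_mat N) \<Longrightarrow> mat_prod (n + N) (map (\<lambda>M. 1\<^sub>m n \<boxplus> M) Ms) = 1\<^sub>m n \<boxplus> mat_prod N Ms"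
proof (induction Ms)
  case (Cons M Ms)
  have "mat_prod N Ms \<in> sq_mat N" "M \<in> sq_mat N" using Cons.prems by (auto intro: mat_prod_carrier)
  note this[THEN carrier_matD(1)] this[THEN carrier_matD(2)]
  then show ?case using Cons by (simp add: dsum_mult_dim mat_one_zero_dim)
qed simp

lemma nested_cong: "(\<And>i. i \<le> k \<Longrightarrow> side i = side' i) \<Longrightarrow> nested n r Z side X k = nested n r Z side' X k"
  by (induction k) auto

lemma block_size_split: "0 < (i :: nat) \<Longrightarrow> i \<le> k \<Longrightarrow> (k - i) * n + (n + n + (i - 1) * n) = n + k * n"
proof -
  assume "0 < i" "i \<le> k"
  then have "k = (k - i) + (i - 1) + 1" by simp
  then have "k * n = (k - i) * n + (i - 1) * n + n" by (metis add_mult_distrib mult_1)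
  then show ?thesis by simp
qed

text \<open>
  The nontrivial block of the Fiedler matrix of index \<open>0\<close>.
\<close>

definition core_block :: "complex mat \<Rightarrow> complex mat \<Rightarrow> complex mat \<Rightarrow> complex mat \<Rightarrow> complex mat" where
  "core_block A0 A B C = four_block_mat (- A0) (- C) (- B) (- A)"

context
  fixes n r :: nat and Ac :: "nat \<Rightarrow> complex mat" and A E B C :: "complex mat"
  assumes AE: "A \<in> sq_mat r" "E \<in> sq_mat r" and B: "B \<in> carrier_mat r n" and C: "C \<in> carrier_mat n r"
begin

abbreviation "fmat m \<equiv> fiedler_S n m r Ac A E B C"
abbreviation "fword m \<equiv> fiedler_prod n m r Ac A E B C"

lemma core_block_carrier: "Ac 0 \<in> sq_mat n \<Longrightarrow> core_block (Ac 0) A B C \<in> sq_mat (n + r)"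
  unfolding core_block_def using AE B C by auto

text \<open>
  The Kronecker products with the last unit vector put \<open>C\<close> and \<open>B\<close> next to the coefficient \<open>A\<^sub>0\<close>.
\<close>

lemma fiedler_S_0:
  assumes "Ac 0 \<in> sq_mat n"
  shows "fmat (Suc k) 0 = 1\<^sub>m (k * n) \<boxplus> core_block (Ac 0) A B C"
proof -
  have d [simp]: "dim_row (Ac 0) = n" "dim_col (Ac 0) = n" "dim_row A = r" "dim_col A = r" "dim_row B = r" "dim_col B = n"
    "dim_row C = n" "dim_col C = r" using assms AE B C by auto
  have e: "e_last (Suc k) \<in> carrier_mat (Suc k) 1" "\<And>i. i < Suc k \<Longrightarrow> e_last (Suc k) $$ (i, 0) = (if i = k then 1 else 0)"
    by (auto simp: e_last_def mat_of_cols_def)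
  note [simp] = carrier_matD[OF e(1)]
  have kr: "(- e_last (Suc k) \<otimes>\<^sub>k C) $$ (i, j) = (if i < k * n then 0 else - C $$ (i - k * n, j))"
    if "i < n + k * n" "j < r" for i j
  proof -
    have "n > 0" using that(1) by (cases n) auto
    have "i div n < Suc k" using that(1) less_mult_imp_div_less[of i "Suc k" n] by simp
    moreover have "i div n = k \<longleftrightarrow> \<not> i < k * n"
      using calculation \<open>n > 0\<close> by (metis div_less_iff_less_mult less_Suc_eq not_less_eq)
    moreover have "i mod n = i - k * n" if "i div n = k" using that by (metis minus_div_mult_eq_mod)
    ultimately show ?thesis using that e(2) by (auto simp: kronecker_def)
  qed
  have kr': "(- (e_last (Suc k))\<^sup>T \<otimes>\<^sub>k B) $$ (i, j) = (if j < k * n then 0 else - B $$ (i, j - k * n))"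
    if "j < n + k * n" "i < r" for i j
  proof -
    have "n > 0" using that(1) by (cases n) auto
    have "j div n < Suc k" using that(1) less_mult_imp_div_less[of j "Suc k" n] by simp
    moreover have "j div n = k \<longleftrightarrow> \<not> j < k * n"
      using calculation \<open>n > 0\<close> by (metis div_less_iff_less_mult less_Suc_eq not_less_eq)
    moreover have "j mod n = j - k * n" if "j div n = k" using that by (metis minus_div_mult_eq_mod)
    ultimately show ?thesis using that e(2) by (auto simp: kronecker_def)
  qed
  have kd: "dim_row (- e_last (Suc k) \<otimes>\<^sub>k C) = n + k * n" "dim_col (- e_last (Suc k) \<otimes>\<^sub>k C) = r"
     "dim_row (- (e_last (Suc k))\<^sup>T \<otimes>\<^sub>k B) = r" "dim_col (- (e_last (Suc k))\<^sup>T \<otimes>\<^sub>k B) = n + k * n"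
    by (simp_all add: kronecker_def)
  have P: "fiedler_P n (Suc k) Ac 0 = 1\<^sub>m (k * n) \<boxplus> - Ac 0"
    by (simp add: fiedler_P_def elem_mat_def diag_block_mat_dsum del: diag_block_mat.simps)
  show ?thesis unfolding fiedler_S_def P
    by (rule eq_matI) (auto simp: kr kr' kd core_block_def dsum_def)
qed

lemma fiedler_S_pos:
  assumes "0 < i" "i \<le> k" "Ac i \<in> sq_mat n"
  shows "fmat (Suc k) (int i) = 1\<^sub>m ((k - i) * n) \<boxplus> corner n (- Ac i) \<boxplus> 1\<^sub>m ((i - 1) * n + r)"
proof -
  have "fiedler_P n (Suc k) Ac (int i) = 1\<^sub>m ((k - i) * n) \<boxplus> corner n (- Ac i) \<boxplus> 1\<^sub>m ((i - 1) * n)"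
    using assms by (simp add: fiedler_P_def elem_mat_def diag_block_mat_dsum corner_def nat_diff_distrib' del: diag_block_mat.simps)
  then show ?thesis using assms
    by (simp add: fiedler_S_def diag_block_mat_dsum dsum_assoc del: diag_block_mat.simps)
qed

lemma fiedler_S_step:
  assumes "\<And>i. i \<le> k \<Longrightarrow> Ac i \<in> sq_mat n" "0 \<le> i" "i \<le> int k"
  shows "fmat (Suc (Suc k)) i = 1\<^sub>m n \<boxplus> fmat (Suc k) i"
proof (cases "i = 0")
  case True
  then show ?thesis using fiedler_S_0[OF assms(1)] by (simp add: dsum_assoc[symmetric])
next
  case False
  define j where "j = nat i"
  have j: "i = int j" "0 < j" "j \<le> k" using False assms by (auto simp: j_def)
  have "Suc k - j = Suc (k - j)" using j by simp
  then show ?thesis unfolding j(1) using fiedler_S_pos[of j] j assms(1)[of j] by (simp add: dsum_assoc[symmetric])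
qed

lemma fiedler_S_carrier:
  assumes "\<And>i. i \<le> k \<Longrightarrow> Ac i \<in> sq_mat n" "0 \<le> i" "i \<le> int k"
  shows "fmat (Suc k) i \<in> sq_mat (n + (k * n + r))"
proof (cases "i = 0")
  case True
  have "1\<^sub>m (k * n) \<boxplus> core_block (Ac 0) A B C \<in> sq_mat (k * n + (n + r))"
    using core_block_carrier[OF assms(1)] by auto
  then show ?thesis using True fiedler_S_0[OF assms(1)[of 0], of k] by (simp add: add.assoc add.left_commute)
next
  case False
  define j where "j = nat i"
  have j: "i = int j" "0 < j" "j \<le> k" using False assms by (auto simp: j_def)
  have "(k - j) * n + (n + n + ((j - 1) * n + r)) = n + (k * n + r)"
    using block_size_split[OF j(2,3), of n] by simp
  then show ?thesis unfolding j(1) using fiedler_S_pos[of j k] j assms(1)[of j]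
    by (intro carrier_matI) simp_all
qed

lemma fiedler_prod_step:
  assumes "\<And>i. i \<le> k \<Longrightarrow> Ac i \<in> sq_mat n" "set t \<subseteq> {0..int k}"
  shows "fword (Suc (Suc k)) t = 1\<^sub>m n \<boxplus> fword (Suc k) t"
proof -
  have "map (fmat (Suc (Suc k))) t = map (\<lambda>M. 1\<^sub>m n \<boxplus> M) (map (fmat (Suc k)) t)"
    using assms by (auto intro!: fiedler_S_step)
  note eq = this
  have "fword (Suc (Suc k)) t
    = mat_prod (n + (n + (k * n + r))) (map (\<lambda>M. 1\<^sub>m n \<boxplus> M) (map (fmat (Suc k)) t))"
    unfolding fiedler_prod_def eq by (simp add: add.assoc)
  also have "\<dots> = 1\<^sub>m n \<boxplus> mat_prod (n + (k * n + r)) (map (fmat (Suc k)) t)"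
    by (rule mat_prod_dsum_left) (use assms(2) in \<open>auto intro!: fiedler_S_carrier[OF assms(1)]\<close>)
  finally show ?thesis by (simp add: fiedler_prod_def add.assoc)
qed

lemma fiedler_prod_carrier:
  assumes "\<And>i. i \<le> k \<Longrightarrow> Ac i \<in> sq_mat n" "set t \<subseteq> {0..int k}"
  shows "fword (Suc k) t \<in> sq_mat (n + (k * n + r))"
proof -
  have "mat_prod (n + (k * n + r)) (map (fmat (Suc k)) t) \<in> sq_mat (n + (k * n + r))"
    by (rule mat_prod_carrier) (use assms(2) in \<open>auto intro!: fiedler_S_carrier[OF assms(1)]\<close>)
  then show ?thesis by (simp add: fiedler_prod_def add.assoc)
qed

lemma fiedler_prod_append:
  assumes "\<And>i. i \<le> k \<Longrightarrow> Ac i \<in> sq_mat n" "set (s @ t) \<subseteq> {0..int k}"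
  shows "fword (Suc k) (s @ t) = fword (Suc k) s * fword (Suc k) t"
  unfolding fiedler_prod_def map_append
  by (rule mat_prod_append) (use assms(2) fiedler_S_carrier[OF assms(1)] in \<open>auto simp: add.assoc\<close>)

text \<open>
  The corner of the largest index lives on the first two blocks, where the matrices of all indices
  but the adjacent one are the identity.
\<close>

lemma fiedler_prod_commute:
  assumes Ac: "\<And>i. i \<le> Suc k \<Longrightarrow> Ac i \<in> sq_mat n" and t: "set t \<subseteq> {0..int k - 1}"
  shows "fword (Suc (Suc k)) t * fmat (Suc (Suc k)) (int (Suc k))
    = fmat (Suc (Suc k)) (int (Suc k)) * fword (Suc (Suc k)) t"
proof (cases t)
  case Nil
  have "fmat (Suc (Suc k)) (int (Suc k)) \<in> sq_mat (n + (Suc k * n + r))"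
    by (rule fiedler_S_carrier) (use Ac in auto)
  then show ?thesis using Nil by (simp add: fiedler_prod_def mat_one_zero_dim add.assoc)
next
  case (Cons i t')
  then have "k > 0" using t by auto
  then obtain k' where k: "k = Suc k'" by (cases k) auto
  have P: "fword (Suc k') t \<in> sq_mat (n + (k' * n + r))"
    by (rule fiedler_prod_carrier) (use Ac t k in auto)
  have "fword (Suc (Suc k)) t = 1\<^sub>m n \<boxplus> fword (Suc k) t"
    by (rule fiedler_prod_step) (use Ac t in auto)
  also have "fword (Suc k) t = 1\<^sub>m n \<boxplus> fword (Suc k') t"
    unfolding k by (rule fiedler_prod_step) (use Ac t k in auto)
  also have "1\<^sub>m n \<boxplus> 1\<^sub>m n \<boxplus> fword (Suc k') t = 1\<^sub>m (n + n) \<boxplus> fword (Suc k') t"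
    by (simp add: dsum_assoc[symmetric])
  finally have eq: "fword (Suc (Suc k)) t = 1\<^sub>m (n + n) \<boxplus> fword (Suc k') t" .
  have "fmat (Suc (Suc k)) (int (Suc k)) = 1\<^sub>m 0 \<boxplus> corner n (- Ac (Suc k)) \<boxplus> 1\<^sub>m (k * n + r)"
    using fiedler_S_pos[of "Suc k" "Suc k"] Ac[of "Suc k"] by simp
  also have "\<dots> = corner n (- Ac (Suc k)) \<boxplus> 1\<^sub>m (k * n + r)"
    by (rule eq_matI) (auto simp: dsum_def)
  finally have eq2: "fmat (Suc (Suc k)) (int (Suc k)) = corner n (- Ac (Suc k)) \<boxplus> 1\<^sub>m (k * n + r)" .
  have [simp]: "dim_row (Ac (Suc k)) = n" "dim_col (Ac (Suc k)) = n" using Ac[of "Suc k"] by auto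
  have "n + (k' * n + r) = k * n + r" by (simp add: k)
  note carrier_matD[OF P, unfolded this]
  then show ?thesis unfolding eq eq2 by (simp add: dsum_mult_dim mat_one_zero_dim)
qed

text \<open>
  The largest index commutes with everything except its neighbour, so it can be moved to the end
  of the tuple at which it does not have to pass this neighbour.
\<close>

lemma fiedler_prod_nested:
  assumes "\<And>i. i \<le> k \<Longrightarrow> Ac i \<in> sq_mat n" "is_perm_of t {0..int k}"
  shows "\<exists>side. fword (Suc k) t = nested n r (core_block (Ac 0) A B C) side (\<lambda>i. - Ac i) k"
  using assms
proof (induction k arbitrary: t)
  case 0
  have "set t = {0}" "distinct t" using 0(2) unfolding is_perm_of_def by auto
  then have "length t = 1" using distinct_card[of t] by simp
  then obtain y where "t = [y]" by (cases t) auto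
  then have "t = [0]" using \<open>set t = {0}\<close> by simp
  moreover have "1\<^sub>m 0 \<boxplus> M = M" for M :: "complex mat" by (rule eq_matI) (auto simp: dsum_def)
  ultimately show ?case using fiedler_S_0[OF 0(1), of 0] carrier_matD[OF core_block_carrier[OF 0(1)]]
    by (simp add: fiedler_prod_def mat_one_zero_dim)
next
  case (Suc k)
  let ?F = "fword (Suc (Suc k))" and ?S = "fmat (Suc (Suc k)) (int (Suc k))"
  have t: "distinct t" "set t = {0..int (Suc k)}" using Suc.prems(2) by (auto simp: is_perm_of_def)
  then have "int (Suc k) \<in> set t" by auto
  then obtain a b where ab: "t = a @ int (Suc k) # b" using split_list by metis
  have ts: "set t = insert (int (Suc k)) (set (a @ b))" "int (Suc k) \<notin> set (a @ b)"
    using t(1) unfolding ab by simp_all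
  have sab: "set (a @ b) = {0..int k}"
  proof
    show "set (a @ b) \<subseteq> {0..int k}"
    proof
      fix x assume "x \<in> set (a @ b)"
      then have "x \<in> {0..int (Suc k)}" "x \<noteq> int (Suc k)" using ts t(2) by auto
      then show "x \<in> {0..int k}" by simp
    qed
    show "{0..int k} \<subseteq> set (a @ b)"
    proof
      fix x assume "x \<in> {0..int k}"
      then have "x \<in> set t" "x \<noteq> int (Suc k)" unfolding t(2) by auto
      then show "x \<in> set (a @ b)" using ts(1) by simp
    qed
  qed
  have dab: "distinct (a @ b)" using t(1) unfolding ab by simp
  have perm: "is_perm_of (a @ b) {0..int k}" using sab dab by (auto simp: is_perm_of_def)
  obtain side where side: "fword (Suc k) (a @ b) = nested n r (core_block (Ac 0) A B C) side (\<lambda>i. - Ac i) k"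
    using Suc.IH[OF _ perm] Suc.prems(1) by auto
  have Fab: "?F (a @ b) = 1\<^sub>m n \<boxplus> fword (Suc k) (a @ b)"
    by (rule fiedler_prod_step) (use Suc.prems(1) sab in auto)
  have Fab': "?F (a @ b) = ?F a * ?F b"
    by (rule fiedler_prod_append) (use Suc.prems(1) sab in auto)
  have S: "?S = corner n (- Ac (Suc k)) \<boxplus> 1\<^sub>m (k * n + r)"
  proof -
    have "?S = 1\<^sub>m 0 \<boxplus> corner n (- Ac (Suc k)) \<boxplus> 1\<^sub>m (k * n + r)"
      using fiedler_S_pos[of "Suc k" "Suc k"] Suc.prems(1)[of "Suc k"] by simp
    also have "\<dots> = corner n (- Ac (Suc k)) \<boxplus> 1\<^sub>m (k * n + r)" by (rule eq_matI) (auto simp: dsum_def)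
    finally show ?thesis .
  qed
  have sub: "set a \<subseteq> {0..int k}" "set b \<subseteq> {0..int k}" using sab by (metis Un_upper1 Un_upper2 set_append)+
  have "{0..int k} \<subseteq> {0..int (Suc k)}" by simp
  then have sa: "set a \<subseteq> {0..int (Suc k)}" and sb: "set b \<subseteq> {0..int (Suc k)}" using sub by blast+
  note c = fiedler_prod_carrier[OF Suc.prems(1) sa] fiedler_prod_carrier[OF Suc.prems(1) sb]
    fiedler_S_carrier[where k = "Suc k" and i = "int (Suc k)", OF Suc.prems(1)]
  have [simp]: "dim_row (?F a) = n + (Suc k * n + r)" "dim_col (?F a) = n + (Suc k * n + r)"
    "dim_row (?F b) = n + (Suc k * n + r)" "dim_col (?F b) = n + (Suc k * n + r)"
    "dim_row ?S = n + (Suc k * n + r)" "dim_col ?S = n + (Suc k * n + r)"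
    by (rule c[THEN carrier_matD(1)] c[THEN carrier_matD(2)]; simp)+
  have Ft: "?F t = ?F a * (?S * ?F b)"
  proof -
    have "?F t = ?F a * ?F (int (Suc k) # b)" unfolding ab
      by (rule fiedler_prod_append) (use Suc.prems(1) sab in auto)
    then show ?thesis by (simp add: fiedler_prod_def)
  qed
  consider "int k \<notin> set a" | "int k \<notin> set b" using dab by auto
  then show ?case
  proof cases
    case 1
    then have "set a \<subseteq> {0..int k} - {int k}" using sub by blast
    also have "\<dots> \<subseteq> {0..int k - 1}" by auto
    finally have "set a \<subseteq> {0..int k - 1}" .
    then have "?F a * ?S = ?S * ?F a" by (intro fiedler_prod_commute) (use Suc.prems(1) in auto)
    then have "?F t = ?S * ?F (a @ b)" unfolding Ft Fab'
      by (subst (1 2) mat_assoc_dim[symmetric]) (simp_all del: of_nat_Suc)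
    then have "?F t = nested n r (core_block (Ac 0) A B C) (side(Suc k := True)) (\<lambda>i. - Ac i) (Suc k)"
      unfolding Fab S side using nested_cong[where side = "side(Suc k := True)" and side' = side and k = k and Z = "core_block (Ac 0) A B C"] by simp
    then show ?thesis by blast
  next
    case 2
    then have "set b \<subseteq> {0..int k} - {int k}" using sub by blast
    also have "\<dots> \<subseteq> {0..int k - 1}" by auto
    finally have "set b \<subseteq> {0..int k - 1}" .
    then have "?F b * ?S = ?S * ?F b" by (intro fiedler_prod_commute) (use Suc.prems(1) in auto)
    then have "?F t = ?F (a @ b) * ?S" unfolding Ft Fab' by (subst mat_assoc_dim) (simp_all del: of_nat_Suc)
    then have "?F t = nested n r (core_block (Ac 0) A B C) (side(Suc k := False)) (\<lambda>i. - Ac i) (Suc k)"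
      unfolding Fab S side using nested_cong[where side = "side(Suc k := False)" and side' = side and k = k and Z = "core_block (Ac 0) A B C"] by simp
    then show ?thesis by blast
  qed
qed

end

section \<open>From generalized to ordinary Fiedler pencils\<close>

lemma mat_inv_props:
  fixes M :: "'a::field mat"
  assumes "M \<in> sq_mat k" "det M \<noteq> 0"
  shows "mat_inv M \<in> sq_mat k" "M * mat_inv M = 1\<^sub>m k" "mat_inv M * M = 1\<^sub>m k"
proof -
  have "M \<in> Units (ring_mat TYPE('a) k ())" using det_non_zero_imp_unit[OF assms] .
  then have "mat_inverse M \<noteq> None" using mat_inverse(1)[OF assms(1), where b = "()"] by auto
  then obtain B where "mat_inverse M = Some B" by auto
  then show "mat_inv M \<in> sq_mat k" "M * mat_inv M = 1\<^sub>m k" "mat_inv M * M = 1\<^sub>m k"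
    using mat_inverse(2)[OF assms(1)] by (auto simp: mat_inv_def)
qed

lemma mat_inv_unique:
  fixes M :: "'a::field mat"
  assumes "M \<in> sq_mat k" "N \<in> sq_mat k" "M * N = 1\<^sub>m k"
  shows "mat_inv M = N"
proof -
  have "det M * det N = 1" using det_mult[OF assms(1,2)] assms(3) by simp
  then have "det M \<noteq> 0" by auto
  note i = mat_inv_props[OF assms(1) this]
  have "mat_inv M = mat_inv M * (M * N)" using assms i by simp
  also have "\<dots> = mat_inv M * M * N" using assms(1,2) i(1) by (simp add: assoc_mult_mat)
  finally show ?thesis using i(3) assms(2) by simp
qed

lemma det_corner_nonzero:
  fixes X :: "'a::idom mat"
  assumes "X \<in> sq_mat n"
  shows "corner n X \<in> sq_mat (n + n)" "corner_inv n X \<in> sq_mat (n + n)"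
    "det (corner n X) \<noteq> 0" "det (corner_inv n X) \<noteq> 0"
proof -
  show c: "corner n X \<in> sq_mat (n + n)" "corner_inv n X \<in> sq_mat (n + n)"
    using assms by (auto intro!: carrier_matI)
  have "det (corner n X) * det (corner_inv n X) = 1"
    using det_mult[OF c] corner_inverse(1)[OF assms] by simp
  then show "det (corner n X) \<noteq> 0" "det (corner_inv n X) \<noteq> 0" by auto
qed

text \<open>
  A corner is invertible whatever its entry; only the indices \<open>0\<close> and \<open>-m\<close> need a nonsingular
  argument.
\<close>

lemma elem_mat_nonsingular:
  assumes X: "X \<in> sq_mat n" and i: "- int (Suc k) \<le> i" "i \<le> int k"
    and d: "i = 0 \<or> i = - int (Suc k) \<Longrightarrow> det X \<noteq> 0"
  shows "elem_mat n (Suc k) i X \<in> sq_mat (n + k * n)" "det (elem_mat n (Suc k) i X) \<noteq> 0"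
proof -
  have three: "1\<^sub>m ((k - j) * n) \<boxplus> Y \<boxplus> 1\<^sub>m ((j - 1) * n) \<in> sq_mat (n + k * n) \<and>
       det (1\<^sub>m ((k - j) * n) \<boxplus> Y \<boxplus> 1\<^sub>m ((j - 1) * n)) \<noteq> 0"
    if "Y \<in> sq_mat (n + n)" "det Y \<noteq> 0" "0 < j" "j \<le> k" for Y :: "complex mat" and j
  proof -
    have c: "Y \<boxplus> 1\<^sub>m ((j - 1) * n) \<in> sq_mat (n + n + (j - 1) * n)" using that(1) by simp
    have "det (Y \<boxplus> 1\<^sub>m ((j - 1) * n)) = det Y" using det_dsum[OF that(1) one_carrier_mat] by simp
    then have "det (1\<^sub>m ((k - j) * n) \<boxplus> Y \<boxplus> 1\<^sub>m ((j - 1) * n)) = det Y" using det_dsum[OF one_carrier_mat c] by simp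
    moreover have "1\<^sub>m ((k - j) * n) \<boxplus> Y \<boxplus> 1\<^sub>m ((j - 1) * n) \<in> sq_mat ((k - j) * n + (n + n + (j - 1) * n))"
      using dsum_carrier[OF one_carrier_mat c] .
    ultimately show ?thesis using that(2) unfolding block_size_split[OF that(3,4)] by simp
  qed
  consider "i = 0" | "i = - int (Suc k)" | "0 < i" | "i < 0" "i \<noteq> - int (Suc k)" by linarith
  then have "elem_mat n (Suc k) i X \<in> sq_mat (n + k * n) \<and> det (elem_mat n (Suc k) i X) \<noteq> 0"
  proof cases
    case 1
    then have "elem_mat n (Suc k) i X = 1\<^sub>m (k * n) \<boxplus> X"
      by (simp add: elem_mat_def diag_block_mat_dsum del: diag_block_mat.simps)
    moreover have "1\<^sub>m (k * n) \<boxplus> X \<in> sq_mat (n + k * n)"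
      using X by (intro carrier_matI) auto
    ultimately show ?thesis using X d 1 det_dsum[OF one_carrier_mat X, of "k * n"] by simp
  next
    case 2
    then have "elem_mat n (Suc k) i X = X \<boxplus> 1\<^sub>m (k * n)"
      by (simp add: elem_mat_def diag_block_mat_dsum del: diag_block_mat.simps)
    then show ?thesis using X d 2 dsum_carrier[OF X one_carrier_mat] det_dsum[OF X one_carrier_mat, of "k * n"]
      by simp
  next
    case 3
    have "elem_mat n (Suc k) i X = 1\<^sub>m ((k - nat i) * n) \<boxplus> corner n X \<boxplus> 1\<^sub>m ((nat i - 1) * n)"
      using 3 by (simp add: elem_mat_def diag_block_mat_dsum corner_def del: diag_block_mat.simps)
    then show ?thesis using three[OF det_corner_nonzero(1,3)[OF X], of "nat i"] 3 i by simp
  next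
    case 4
    have "elem_mat n (Suc k) i X = 1\<^sub>m ((k - nat (- i)) * n) \<boxplus> corner_inv n (- X) \<boxplus> 1\<^sub>m ((nat (- i) - 1) * n)"
      using 4 by (simp add: elem_mat_def diag_block_mat_dsum corner_inv_def uminus_uminus_mat del: diag_block_mat.simps)
    moreover have "- X \<in> sq_mat n" using X by simp
    ultimately show ?thesis using three[OF det_corner_nonzero(2,4), of "- X" "nat (- i)"] 4 i by simp
  qed
  then show "elem_mat n (Suc k) i X \<in> sq_mat (n + k * n)" "det (elem_mat n (Suc k) i X) \<noteq> 0" by auto
qed

lemma elem_prod_nonsingular:
  assumes "matrix_assignment n t X" "set t \<subseteq> {- int (Suc k)..int k}" "nonsingular_assignment (Suc k) t X"
  shows "\<exists>Y \<in> sq_mat (n + k * n). det Y \<noteq> 0 \<and> elem_prod n (Suc k) r t X = Y \<boxplus> 1\<^sub>m r"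
proof -
  have "length t = length X" using assms(1) by (simp add: matrix_assignment_def)
  then show ?thesis using assms
  proof (induction t X rule: list_induct2)
    case Nil
    show ?case by (rule bexI[of _ "1\<^sub>m (n + k * n)"]) (simp_all add: elem_prod_def)
  next
    case (Cons i t M X)
    have "nonsingular_assignment (Suc k) t X"
      using Cons.prems(3) unfolding nonsingular_assignment_def by fastforce
    moreover have "matrix_assignment n t X" "set t \<subseteq> {- int (Suc k)..int k}"
      using Cons.prems(1,2) by (auto simp: matrix_assignment_def)
    ultimately obtain Y where Y: "Y \<in> sq_mat (n + k * n)" "det Y \<noteq> 0" "elem_prod n (Suc k) r t X = Y \<boxplus> 1\<^sub>m r"
      using Cons.IH by blast
    have M: "M \<in> sq_mat n" using Cons.prems(1) by (auto simp: matrix_assignment_def)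
    have i: "- int (Suc k) \<le> i" "i \<le> int k" using Cons.prems(2) by auto
    have d: "det M \<noteq> 0" if "i = 0 \<or> i = - int (Suc k)"
      using Cons.prems(3) that unfolding nonsingular_assignment_def by (metis length_greater_0_conv list.discI nth_Cons_0)
    note e = elem_mat_nonsingular[OF M i d]
    let ?e = "elem_mat n (Suc k) i M"
    have "elem_prod n (Suc k) r (i # t) (M # X) = (?e \<boxplus> 1\<^sub>m r) * (Y \<boxplus> 1\<^sub>m r)"
      using Y(3) by (simp add: elem_prod_def elem_mat_ext_def diag_block_mat_dsum del: diag_block_mat.simps)
    also have "\<dots> = ?e * Y \<boxplus> 1\<^sub>m r" using carrier_matD[OF Y(1)] carrier_matD[OF e(1)] by (simp add: dsum_mult_dim)
    finally show ?case using e Y(1,2) det_mult[OF e(1) Y(1)] mult_carrier_mat[OF e(1) Y(1)] by (metis no_zero_divisors)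
  qed
qed

context
  fixes n r k :: nat and Ac :: "nat \<Rightarrow> complex mat" and A E B C :: "complex mat"
  assumes AE: "A \<in> sq_mat r" "E \<in> sq_mat r" and B: "B \<in> carrier_mat r n" and C: "C \<in> carrier_mat n r"
    and Ac: "\<And>i. i \<le> Suc k \<Longrightarrow> Ac i \<in> sq_mat n"
begin

abbreviation "fiedler_mat \<equiv> fiedler_S n (Suc k) r Ac A E B C"
abbreviation "fiedler_word \<equiv> fiedler_prod n (Suc k) r Ac A E B C"
abbreviation "width \<equiv> n + k * n"

lemma fiedler_neg_block:
  assumes "- int k \<le> i" "i < 0"
  shows "\<exists>P P'. P \<in> sq_mat width \<and> P' \<in> sq_mat width \<and> P * P' = 1\<^sub>m width \<and> fiedler_mat i = P \<boxplus> 1\<^sub>m r \<and> fiedler_mat (- i) = P' \<boxplus> 1\<^sub>m r"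
proof -
  define P where "P = fiedler_P n (Suc k) Ac (- i)"
  have X: "- Ac (nat (- i)) \<in> sq_mat n" using Ac[of "nat (- i)"] assms by simp
  have P: "P = elem_mat n (Suc k) (- i) (- Ac (nat (- i)))" using assms by (simp add: P_def fiedler_P_def)
  have c: "P \<in> sq_mat width" "det P \<noteq> 0" unfolding P
    by (rule elem_mat_nonsingular[OF X]; use assms in linarith)+
  note inv = mat_inv_props[OF c]
  have F1: "fiedler_mat (- i) = P \<boxplus> 1\<^sub>m r"
    using assms by (simp add: fiedler_S_def P_def diag_block_mat_dsum del: diag_block_mat.simps)
  have "mat_inv (P \<boxplus> 1\<^sub>m r) = mat_inv P \<boxplus> 1\<^sub>m r"
    by (rule mat_inv_unique[of _ "width + r"]) (use c inv carrier_matD[OF c(1)] carrier_matD[OF inv(1)] in \<open>auto simp: dsum_mult_dim\<close>)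
  then have F2: "fiedler_mat i = mat_inv P \<boxplus> 1\<^sub>m r"
    using assms by (simp add: fiedler_S_def P_def diag_block_mat_dsum del: diag_block_mat.simps)
  show ?thesis using F1 F2 inv c by (intro exI[of _ "mat_inv P"] exI[of _ P]) simp
qed

lemma fiedler_lead_block: "fiedler_mat (- int (Suc k)) = (Ac (Suc k) \<boxplus> 1\<^sub>m (k * n)) \<boxplus> - E"
  by (simp add: fiedler_S_def fiedler_P_def elem_mat_def diag_block_mat_dsum nat_add_distrib del: diag_block_mat.simps)

lemma fiedler_mat_carrier:
  assumes "- int (Suc k) \<le> i" "i \<le> int k"
  shows "fiedler_mat i \<in> sq_mat (width + r)"
proof -
  consider "0 \<le> i" | "i = - int (Suc k)" | "- int k \<le> i" "i < 0" using assms by linarith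
  then show ?thesis
  proof cases
    case 1
    have "fiedler_mat i \<in> sq_mat (n + (k * n + r))"
      by (rule fiedler_S_carrier[OF AE B C]) (use Ac 1 assms in auto)
    then show ?thesis by (simp add: add.assoc)
  next
    case 2
    show ?thesis unfolding 2 fiedler_lead_block using Ac[of "Suc k"] AE by (intro dsum_carrier) auto
  next
    case 3
    then show ?thesis using fiedler_neg_block[of i] by (auto intro: dsum_carrier)
  qed
qed

lemma fiedler_word_append:
  assumes "set (s @ t) \<subseteq> {- int (Suc k)..int k}"
  shows "fiedler_word (s @ t) = fiedler_word s * fiedler_word t"
proof -
  have "mat_prod (width + r) (map fiedler_mat s @ map fiedler_mat t) = mat_prod (width + r) (map fiedler_mat s) * mat_prod (width + r) (map fiedler_mat t)"
  proof (rule mat_prod_append)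
    fix M assume "M \<in> set (map fiedler_mat s @ map fiedler_mat t)"
    then obtain i where "i \<in> set (s @ t)" "M = fiedler_mat i" by auto
    then show "M \<in> sq_mat (width + r)" using fiedler_mat_carrier[of i] assms by auto
  qed
  then show ?thesis by (simp add: fiedler_prod_def)
qed

lemma fiedler_word_singleton: "- int (Suc k) \<le> i \<Longrightarrow> i \<le> int k \<Longrightarrow> fiedler_word [i] = fiedler_mat i"
  using carrier_matD[OF fiedler_mat_carrier[of i]] by (simp add: fiedler_prod_def mat_one_zero_dim)

lemma fiedler_word_Cons: "fiedler_word (i # t) = fiedler_mat i * fiedler_word t"
  by (simp add: fiedler_prod_def)

text \<open>
  A product over negative indices is undone by the product over the reversed, negated tuple.
\<close>

lemma fiedler_neg_word:
  assumes "set c \<subseteq> {- int k..-1}"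
  shows "\<exists>Y Y'. Y \<in> sq_mat width \<and> Y' \<in> sq_mat width \<and> Y * Y' = 1\<^sub>m width \<and> fiedler_word c = Y \<boxplus> 1\<^sub>m r \<and> fiedler_word (rev (map uminus c)) = Y' \<boxplus> 1\<^sub>m r"
  using assms
proof (induction c)
  case Nil
  show ?case by (intro exI[of _ "1\<^sub>m width"]) (simp add: fiedler_prod_def)
next
  case (Cons i c)
  then obtain Y Y' where Y: "Y \<in> sq_mat width" "Y' \<in> sq_mat width" "Y * Y' = 1\<^sub>m width" "fiedler_word c = Y \<boxplus> 1\<^sub>m r" "fiedler_word (rev (map uminus c)) = Y' \<boxplus> 1\<^sub>m r"
    by auto
  have i: "- int k \<le> i" "i < 0" using Cons.prems by auto
  obtain P P' where P: "P \<in> sq_mat width" "P' \<in> sq_mat width" "P * P' = 1\<^sub>m width" "fiedler_mat i = P \<boxplus> 1\<^sub>m r" "fiedler_mat (- i) = P' \<boxplus> 1\<^sub>m r"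
    using fiedler_neg_block[OF i] by auto
  note d [simp] = carrier_matD[OF Y(1)] carrier_matD[OF Y(2)] carrier_matD[OF P(1)] carrier_matD[OF P(2)]
  have sub: "set (rev (map uminus c) @ [- i]) \<subseteq> {- int (Suc k)..int k}" using Cons.prems by fastforce
  have "fiedler_word (rev (map uminus (i # c))) = fiedler_word (rev (map uminus c)) * fiedler_mat (- i)"
    using fiedler_word_append[OF sub] fiedler_word_singleton[of "- i"] i by simp
  then have "fiedler_word (rev (map uminus (i # c))) = Y' * P' \<boxplus> 1\<^sub>m r" unfolding Y(5) P(5) by (simp add: dsum_mult_dim)
  moreover have "fiedler_word (i # c) = P * Y \<boxplus> 1\<^sub>m r" unfolding fiedler_word_Cons P(4) Y(4) by (simp add: dsum_mult_dim)
  moreover have "P * Y * (Y' * P') = 1\<^sub>m width"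
  proof -
    have "P * Y * (Y' * P') = P * ((Y * Y') * P')" by (simp add: mat_assoc_dim)
    then show ?thesis unfolding Y(3) using P(2,3) by simp
  qed
  moreover have "P * Y \<in> sq_mat width" "Y' * P' \<in> sq_mat width" by (auto intro!: carrier_matI)
  ultimately show ?case by blast
qed

lemma right_inverse_det:
  fixes Y :: "complex mat"
  shows "Y \<in> sq_mat width \<Longrightarrow> Y' \<in> sq_mat width \<Longrightarrow> Y * Y' = 1\<^sub>m width \<Longrightarrow> det Y \<noteq> 0 \<and> Y' * Y = 1\<^sub>m width"
  using det_mult[of Y width Y'] mat_mult_left_right_inverse[of Y width Y'] by auto

text \<open>
  With \<open>\<tau> = (c, -m, d)\<close> the outer factors are \<open>M\<^sub>c\<close> and \<open>M\<^sub>d\<close>.  Multiplying \<open>M\<^sub>\<sigma>\<close> by their inverses gives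
  the product over the reversed negation of \<open>c\<close>, then \<open>\<sigma>\<close>, then the reversed negation of \<open>d\<close>, which
  is a permutation of all of \<open>{0..m - 1}\<close>.
\<close>

lemma fiedler_pencil_factor:
  assumes \<sigma>: "is_perm_of \<sigma> {0..int h}" and \<tau>: "is_perm_of \<tau> {- int (Suc k)..- int h - 1}" and h: "h \<le> k"
  shows "\<exists>Z1 Z2 side. Z1 \<in> sq_mat width \<and> Z2 \<in> sq_mat width \<and> det Z1 \<noteq> 0 \<and> det Z2 \<noteq> 0 \<and>
     fiedler_word \<tau> = (Z1 \<boxplus> 1\<^sub>m r) * ((Ac (Suc k) \<boxplus> 1\<^sub>m (k * n)) \<boxplus> - E) * (Z2 \<boxplus> 1\<^sub>m r) \<and>
     fiedler_word \<sigma> = (Z1 \<boxplus> 1\<^sub>m r) * nested n r (core_block (Ac 0) A B C) side (\<lambda>i. - Ac i) k * (Z2 \<boxplus> 1\<^sub>m r)"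
proof -
  have t: "distinct \<tau>" "set \<tau> = {- int (Suc k)..- int h - 1}" using \<tau> by (auto simp: is_perm_of_def)
  have s: "distinct \<sigma>" "set \<sigma> = {0..int h}" using \<sigma> by (auto simp: is_perm_of_def)
  have "- int (Suc k) \<in> set \<tau>" unfolding t(2) using h by simp
  then obtain c d where cd: "\<tau> = c @ - int (Suc k) # d" using split_list by metis
  have dist: "distinct (c @ d)" "- int (Suc k) \<notin> set (c @ d)" using t(1) unfolding cd by simp_all
  have ins: "insert (- int (Suc k)) (set (c @ d)) = {- int (Suc k)..- int h - 1}" using t(2) unfolding cd by simp
  have scd: "x \<in> set (c @ d) \<longleftrightarrow> - int k \<le> x \<and> x \<le> - int h - 1" for x
  proof -
    have "x \<in> set (c @ d) \<longleftrightarrow> x \<in> {- int (Suc k)..- int h - 1} \<and> x \<noteq> - int (Suc k)"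
      using dist(2) unfolding ins[symmetric] by blast
    then show ?thesis using h by auto
  qed
  have sc: "set c \<subseteq> {- int k..-1}" and sd: "set d \<subseteq> {- int k..-1}"
    using scd h by fastforce+
  obtain Y1 Y1' where Y1: "Y1 \<in> sq_mat width" "Y1' \<in> sq_mat width" "Y1 * Y1' = 1\<^sub>m width" "fiedler_word c = Y1 \<boxplus> 1\<^sub>m r" "fiedler_word (rev (map uminus c)) = Y1' \<boxplus> 1\<^sub>m r"
    using fiedler_neg_word[OF sc] by blast
  obtain Y2 Y2' where Y2: "Y2 \<in> sq_mat width" "Y2' \<in> sq_mat width" "Y2 * Y2' = 1\<^sub>m width" "fiedler_word d = Y2 \<boxplus> 1\<^sub>m r" "fiedler_word (rev (map uminus d)) = Y2' \<boxplus> 1\<^sub>m r"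
    using fiedler_neg_word[OF sd] by blast
  note [simp] = carrier_matD[OF Y1(1)] carrier_matD[OF Y1(2)] carrier_matD[OF Y2(1)] carrier_matD[OF Y2(2)]
  \<comment> \<open>the permutation of all nonnegative indices\<close>
  define w where "w = rev (map uminus c) @ \<sigma> @ rev (map uminus d)"
  have "is_perm_of w {0..int k}"
  proof -
    have "distinct w"
    proof -
      have neg: "x \<in> set (rev (map uminus c)) \<or> x \<in> set (rev (map uminus d)) \<longleftrightarrow> - x \<in> set (c @ d)" for x :: int
        by force
      have "inj_on uminus (set (c @ d))" by (simp add: inj_on_def)
      then have "distinct (map uminus (c @ d))" using dist(1) unfolding distinct_map by blast
      moreover have "x \<notin> set \<sigma>" if "- x \<in> set (c @ d)" for x using that unfolding scd s(2) by auto
      ultimately show ?thesis unfolding w_def using s(1) neg by auto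
    qed
    moreover have "set w = {0..int k}"
    proof (intro Set.set_eqI)
      fix x
      have "x \<in> set w \<longleftrightarrow> x \<in> set \<sigma> \<or> - x \<in> set (c @ d)" unfolding w_def by force
      then show "x \<in> set w \<longleftrightarrow> x \<in> {0..int k}" unfolding scd s(2) using h by auto
    qed
    ultimately show ?thesis by (simp add: is_perm_of_def)
  qed
  then obtain side where side: "fiedler_word w = nested n r (core_block (Ac 0) A B C) side (\<lambda>i. - Ac i) k"
    using fiedler_prod_nested[OF AE B C, of k Ac w] Ac by auto
  have wsub: "set w \<subseteq> {- int (Suc k)..int k}" using \<open>is_perm_of w _\<close> by (auto simp: is_perm_of_def)
  then have "set (\<sigma> @ rev (map uminus d)) \<subseteq> {- int (Suc k)..int k}" unfolding w_def by simp
  then have FPw: "fiedler_word w = fiedler_word (rev (map uminus c)) * (fiedler_word \<sigma> * fiedler_word (rev (map uminus d)))"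
    using fiedler_word_append[OF wsub[unfolded w_def]] fiedler_word_append by (simp add: w_def)
  have FPs: "fiedler_word \<sigma> \<in> sq_mat (width + r)"
    using fiedler_prod_carrier[OF AE B C, of k Ac \<sigma>] Ac s(2) h by (auto simp: add.assoc)
  note [simp] = carrier_matD[OF FPs]
  have inv1: "Y1 * Y1' = 1\<^sub>m width" "det Y1 \<noteq> 0" and inv2: "Y2' * Y2 = 1\<^sub>m width" "det Y2 \<noteq> 0"
    using right_inverse_det[OF Y1(1-3)] right_inverse_det[OF Y2(1-3)] Y1(3) by auto
  have "(Y1 \<boxplus> 1\<^sub>m r) * fiedler_word w * (Y2 \<boxplus> 1\<^sub>m r)
     = ((Y1 \<boxplus> 1\<^sub>m r) * (Y1' \<boxplus> 1\<^sub>m r)) * fiedler_word \<sigma> * ((Y2' \<boxplus> 1\<^sub>m r) * (Y2 \<boxplus> 1\<^sub>m r))"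
    unfolding FPw Y1(5) Y2(5) by (simp add: mat_assoc_dim)
  also have "\<dots> = fiedler_word \<sigma>" by (simp add: dsum_mult_dim inv1 inv2 mat_one_zero_dim)
  finally have f2: "fiedler_word \<sigma> = (Y1 \<boxplus> 1\<^sub>m r) * nested n r (core_block (Ac 0) A B C) side (\<lambda>i. - Ac i) k * (Y2 \<boxplus> 1\<^sub>m r)"
    unfolding side by simp
  have "set (c @ - int (Suc k) # d) \<subseteq> {- int (Suc k)..int k}" using t(2) unfolding cd by auto
  then have "fiedler_word \<tau> = fiedler_word c * (fiedler_mat (- int (Suc k)) * fiedler_word d)"
    unfolding cd using fiedler_word_append fiedler_word_Cons by metis
  then have f1: "fiedler_word \<tau> = (Y1 \<boxplus> 1\<^sub>m r) * ((Ac (Suc k) \<boxplus> 1\<^sub>m (k * n)) \<boxplus> - E) * (Y2 \<boxplus> 1\<^sub>m r)"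
    unfolding Y1(4) Y2(4) fiedler_lead_block using Ac[of "Suc k"] AE by (simp add: mat_assoc_dim)
  show ?thesis using f1 f2 inv1(2) inv2(2) Y1(1) Y2(1) by blast
qed

end

section \<open>Transfer functions\<close>

lemma const_hom: "comm_ring_hom (\<lambda>c :: complex. [:c:])"
  by unfold_locales (auto simp: one_pCons)

lemma to_fract_hom: "comm_ring_hom (to_fract :: complex poly \<Rightarrow> _)"
  by unfold_locales simp_all

interpretation const_h: comm_ring_hom "\<lambda>c :: complex. [:c:]" by (rule const_hom)
interpretation rat_h: comm_ring_hom "to_fract :: complex poly \<Rightarrow> complex poly fract" by (rule to_fract_hom)

definition rconst :: "complex mat \<Rightarrow> complex poly fract mat" where
  "rconst M = rat_mat (const_mat M)"

lemma dim_rconst [simp]: "dim_row (rconst M) = dim_row M" "dim_col (rconst M) = dim_col M"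
  by (simp_all add: rconst_def)

lemma const_mat_mult: "dim_col X = dim_row Y \<Longrightarrow> const_mat (X * Y) = const_mat X * const_mat Y"
  by (rule const_h.mat_hom_mult) auto

lemma rat_mat_mult: "dim_col X = dim_row Y \<Longrightarrow> rat_mat (X * Y) = rat_mat X * rat_mat Y"
  by (rule rat_h.mat_hom_mult) auto

lemma rconst_mult: "dim_col X = dim_row Y \<Longrightarrow> rconst (X * Y) = rconst X * rconst Y"
  by (simp add: rconst_def const_mat_mult rat_mat_mult)

lemma rconst_one [simp]: "rconst (1\<^sub>m n) = 1\<^sub>m n"
  by (simp add: rconst_def const_h.mat_hom_one rat_h.mat_hom_one)

lemma proper_rconst: "proper_mat (rconst M)"
  unfolding rconst_def by (rule proper_mat_intros)

lemma smult_mat_one: "1 \<cdot>\<^sub>m (A :: 'a::monoid_mult mat) = A"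
  by (rule eq_matI) auto

lemma tends_det:
  assumes "mat_tends N N F L"
  shows "tends (det F) (det L)"
proof -
  have c: "F \<in> sq_mat N" "L \<in> sq_mat N" using assms by (auto simp: mat_tends_def)
  have "tends (signof p) (signof p)" for p :: "nat \<Rightarrow> nat"
    using tends_const[of "signof p"] by (metis const_h.hom_signof rat_h.hom_signof)
  moreover have "p i < N" if "p permutes {0..<N}" "i < N" for p i
    using permutes_in_image[OF that(1), of i] that(2) by simp
  ultimately show ?thesis unfolding det_def'[OF c(1)] det_def'[OF c(2)]
    using assms unfolding mat_tends_def
    by (intro tends_sum tends_mult tends_prod) auto
qed

lemma proper_det: "F \<in> sq_mat N \<Longrightarrow> proper_mat F \<Longrightarrow> proper (det F)"
  using proper_mat_tends[of F N N] tends_det unfolding proper_def by metis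

text \<open>
  Cramer's rule: the determinant has a nonzero limit, and cofactors of a proper matrix are proper.
\<close>

lemma biproper_inverse_proper:
  assumes "biproper N F"
  shows "det F \<noteq> 0" "proper_mat F \<Longrightarrow> proper_mat (mat_inv F)"
proof -
  from assms obtain L where L: "mat_tends N N F L" "det L \<noteq> 0" unfolding biproper_iff by auto
  have t: "tends (det F) (det L)" by (rule tends_det[OF L(1)])
  show d: "det F \<noteq> 0" using t L(2) tends_unique[OF _ tends_0] by metis
  assume p: "proper_mat F"
  have c: "F \<in> sq_mat N" using assms by (rule biproper_carrier)
  have i: "proper (inverse (det F))" using tends_inverse[OF t L(2)] by (auto simp: proper_def)
  have cof: "proper (cofactor F i j)" if "i < N" "j < N" for i j
  proof -
    have "proper_mat (mat_delete F i j)" using p c that unfolding proper_mat_def mat_delete_def by auto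
    then have "proper (det (mat_delete F i j))" using c by (intro proper_det[of _ "N - 1"]) (auto simp: mat_delete_def)
    then show ?thesis unfolding cofactor_def by (intro proper_intros(5) proper_power proper_intros(6) proper_intros(2))
  qed
  have a: "proper_mat (adj_mat F)" using c cof by (auto simp: proper_mat_def adj_mat_def)
  have "mat_inv F = inverse (det F) \<cdot>\<^sub>m adj_mat F"
  proof (rule mat_inv_unique[OF c])
    show "F * (inverse (det F) \<cdot>\<^sub>m adj_mat F) = 1\<^sub>m N"
      using adj_mat[OF c] c d by (simp add: mult_smult_distrib[OF c] smult_mat_assoc smult_mat_one)
  qed (use adj_mat[OF c] in auto)
  then show "proper_mat (mat_inv F)" using i a by (simp add: proper_mat_intros)
qed

lemma lam_nonzero: "to_fract lam \<noteq> 0"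
  by (simp add: lam_def)

definition rat_pencil :: "complex mat \<Rightarrow> complex mat \<Rightarrow> complex poly fract mat" where
  "rat_pencil A E = rat_mat (lam \<cdot>\<^sub>m const_mat E - const_mat A)"

lemma rat_pencil:
  assumes "A \<in> sq_mat r" "E \<in> sq_mat r"
  shows "rat_pencil A E = to_fract lam \<cdot>\<^sub>m rconst E - rconst A" "rat_pencil A E \<in> sq_mat r"
  using assms by (auto simp: rat_pencil_def rconst_def intro!: eq_matI simp del: mult_pCons_right mult_pCons_left)

text \<open>
  The matrix \<open>\<lambda>\<^sup>-\<^sup>1(\<lambda>E - A)\<close> tends to the nonsingular \<open>E\<close>, so its inverse is proper; multiplying by
  \<open>\<lambda>\<^sup>-\<^sup>1\<close> keeps it proper.
\<close>

lemma rat_pencil_inverse: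
  assumes c: "A \<in> sq_mat r" "E \<in> sq_mat r" and E: "det E \<noteq> 0"
  shows "det (rat_pencil A E) \<noteq> 0" "proper_mat (mat_inv (rat_pencil A E))"
proof -
  let ?\<mu> = "inverse (to_fract lam)" and ?K = "rat_pencil A E"
  define F where "F = rconst E - ?\<mu> \<cdot>\<^sub>m rconst A"
  have FK: "F = ?\<mu> \<cdot>\<^sub>m ?K" "?K = to_fract lam \<cdot>\<^sub>m F"
    unfolding F_def rat_pencil(1)[OF c] using c lam_nonzero by (auto intro!: eq_matI simp: right_diff_distrib)
  have p: "proper_mat F" unfolding F_def using c by (auto intro!: proper_mat_intros proper_rconst proper_intros)
  have Fc: "F \<in> sq_mat r" using c by (auto simp: F_def intro!: carrier_matI)
  have "mat_tends r r F E"
    unfolding mat_tends_def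
  proof (intro conjI allI impI Fc c)
    fix i j assume "i < r" "j < r"
    then have "F $$ (i, j) = to_fract [:E $$ (i, j):] - ?\<mu> * to_fract [:A $$ (i, j):]" using c by (simp add: F_def rconst_def)
    moreover have "tends (to_fract [:E $$ (i, j):] - ?\<mu> * to_fract [:A $$ (i, j):]) (E $$ (i, j) - 0 * A $$ (i, j))"
      by (intro tends_minus tends_mult tends_const tends_inverse_lam)
    ultimately show "tends (F $$ (i, j)) (E $$ (i, j))" by simp
  qed
  then have bF: "biproper r F" using E unfolding biproper_iff by blast
  note inv = biproper_inverse_proper[OF bF]
  show dK: "det ?K \<noteq> 0" unfolding FK(2) using inv(1) lam_nonzero by simp
  note Fi = mat_inv_props[OF Fc inv(1)]
  have "mat_inv ?K = ?\<mu> \<cdot>\<^sub>m mat_inv F"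
  proof (rule mat_inv_unique[OF rat_pencil(2)[OF c]])
    have "dim_col F = dim_row (mat_inv F)" using Fc Fi(1) by auto
    then show "?K * (?\<mu> \<cdot>\<^sub>m mat_inv F) = 1\<^sub>m r" unfolding FK(2)
      using Fi lam_nonzero by (simp add: mat_smult_dim smult_mat_assoc smult_mat_one)
  qed (use Fi in auto)
  then show "proper_mat (mat_inv ?K)" using inv(2)[OF p] by (simp add: proper_mat_intros proper_intros)
qed

lemma transfer_function_rat: "transfer_function P A E B C = rat_mat P + rconst C * mat_inv (rat_pencil A E) * rconst B"
  by (simp add: transfer_function_def rconst_def rat_pencil_def)

section \<open>Minimal realizations have no null vectors\<close>

lemma exists_first_row_completion:
  fixes w :: "complex vec"
  assumes "w \<in> carrier_vec (Suc s)" "w \<noteq> 0\<^sub>v (Suc s)"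
  shows "\<exists>Q \<in> sq_mat (Suc s). det Q \<noteq> 0 \<and> row Q 0 = w"
proof -
  interpret vec_space "TYPE(complex)" "Suc s" .
  note b = basis_completion[OF assms]
  let ?b = "basis_completion w"
  define W where "W = mat_of_cols (Suc s) ?b"
  have W: "W \<in> sq_mat (Suc s)" unfolding W_def using mat_of_cols_carrier(1)[of "Suc s" ?b] unfolding b(6) .
  have cols: "cols W = ?b" using b(2) by (simp add: W_def)
  have "rank W = Suc s" by (rule lin_indpt_full_rank[OF W]) (use b cols in auto)
  then have "det W \<noteq> 0" using det_rank_iff[OF W] by simp
  moreover have "row (W\<^sup>T) 0 = w"
  proof -
    have "row (W\<^sup>T) 0 = col W 0" using W by simp
    also have "\<dots> = cols W ! 0" using W by (simp add: cols_nth)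
    also have "\<dots> = w" unfolding cols using b(6,7) by (cases ?b) auto
    finally show ?thesis .
  qed
  ultimately show ?thesis using W by (intro bexI[of _ "W\<^sup>T"]) (auto simp: det_transpose)
qed

text \<open>
  The first row of \<open>Q\<close> is the null vector \<open>w\<close>.  In the coordinates given by \<open>Q\<close> on the left and by
  \<open>(QE)\<^sup>-\<^sup>1\<close> on the right, \<open>E\<close> becomes the identity, the first row of \<open>B\<close> vanishes, and the first
  row of \<open>A\<close> is \<open>z\<close> times the first unit row.  The remaining \<open>s\<close> coordinates thus form an invariant
  subspace which contains the image of \<open>B\<close>; \<open>M\<close> and \<open>N\<close> embed it in the two original coordinates.
\<close>

lemma uncontrollable_intertwining:
  fixes A E :: "complex mat"
  assumes c: "A \<in> sq_mat r" "E \<in> sq_mat r" "B \<in> carrier_mat r n" and E: "det E \<noteq> 0"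
    and w: "w \<in> carrier_vec r" "w \<noteq> 0\<^sub>v r" "B\<^sup>T *\<^sub>v w = 0\<^sub>v n" "A\<^sup>T *\<^sub>v w = z \<cdot>\<^sub>v (E\<^sup>T *\<^sub>v w)"
  shows "\<exists>s M N A1 B1. r = Suc s \<and> M \<in> carrier_mat r s \<and> N \<in> carrier_mat r s \<and> A1 \<in> sq_mat s \<and> B1 \<in> carrier_mat s n \<and>
     E * M = N \<and> A * M = N * A1 \<and> B = N * B1"
proof -
  have "r \<noteq> 0" using w by auto
  then obtain s where r: "r = Suc s" by (cases r) auto
  obtain Q where Q: "Q \<in> sq_mat r" "det Q \<noteq> 0" "row Q 0 = w"
    using exists_first_row_completion[of w s] w r by auto
  define S where "S = Q * E"
  have S: "S \<in> sq_mat r" "det S \<noteq> 0" using Q c E by (auto simp: S_def det_mult)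
  note V = mat_inv_props[OF S] and Qi = mat_inv_props[OF Q(1,2)]
  define V where "V = mat_inv S"
  define Qi where "Qi = mat_inv Q"
  note V = V[folded V_def] and Qi = Qi[folded Qi_def]
  \<comment> \<open>deletes the first of \<open>r\<close> coordinates; its transpose puts a zero back\<close>
  define J :: "complex mat" where "J = mat s r (\<lambda>(i, j). if j = Suc i then 1 else 0)"
  have J: "J \<in> carrier_mat s r" by (simp add: J_def)
  note dims = Q(1) S(1) V(1) Qi(1) J c(1) c(2) c(3)
  note [simp] = dims[THEN carrier_matD(1)] dims[THEN carrier_matD(2)]
  have JJ: "J\<^sup>T * (J * X) = X" if X: "X \<in> carrier_mat r k" "\<And>j. j < k \<Longrightarrow> X $$ (0, j) = 0" for X :: "complex mat" and k
  proof (rule eq_matI)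
    fix i j assume "i < dim_row X" "j < dim_col X"
    then have ij: "i < r" "j < k" using X by auto
    have JX: "(J * X) $$ (a, j) = X $$ (Suc a, j)" if "a < s" for a
    proof -
      have "(J * X) $$ (a, j) = (\<Sum>b = 0..<r. J $$ (a, b) * X $$ (b, j))"
        using that X(1) ij by (auto simp: scalar_prod_def intro!: sum.cong)
      also have "\<dots> = (\<Sum>b = 0..<r. if b = Suc a then X $$ (b, j) else 0)"
        using that by (intro sum.cong) (auto simp: J_def)
      finally show ?thesis using that r by simp
    qed
    have "(J\<^sup>T * (J * X)) $$ (i, j) = (\<Sum>a = 0..<s. J $$ (a, i) * (J * X) $$ (a, j))"
      using ij X(1) by (auto simp: scalar_prod_def intro!: sum.cong)
    also have "\<dots> = (\<Sum>a = 0..<s. if i = Suc a then X $$ (i, j) else 0)"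
      using ij JX by (intro sum.cong) (auto simp: J_def)
    also have "\<dots> = X $$ (i, j)"
      using ij X(2) r by (cases i) (auto simp: sum.delta)
    finally show "(J\<^sup>T * (J * X)) $$ (i, j) = X $$ (i, j)" .
  qed (use X in auto)
  have rowT: "X\<^sup>T *\<^sub>v w = vec k (\<lambda>j. (Q * X) $$ (0, j))" if "X \<in> carrier_mat r k" for X k
    using that Q(1,3) r w(1) by (auto intro!: eq_vecI simp: comm_scalar_prod[of _ r])
  have QB: "(Q * B) $$ (0, j) = 0" if "j < n" for j
    using rowT[OF c(3)] w(3) that by (metis index_vec index_zero_vec(1))
  have QA: "row (Q * A) 0 = z \<cdot>\<^sub>v row S 0"
  proof -
    have "row (Q * A) 0 = A\<^sup>T *\<^sub>v w" "row S 0 = E\<^sup>T *\<^sub>v w"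
      unfolding S_def rowT[OF c(1)] rowT[OF c(2)] using r by (auto intro!: eq_vecI)
    then show ?thesis using w(4) by simp
  qed
  define Ah where "Ah = Q * A * V"
  have Ah: "Ah \<in> sq_mat r" by (auto simp: Ah_def intro!: carrier_matI)
  have AhJ: "(Ah * J\<^sup>T) $$ (0, j) = 0" if "j < s" for j
  proof -
    have "Ah $$ (0, Suc j) = row (Q * A) 0 \<bullet> col V (Suc j)" using that r by (simp add: Ah_def)
    also have "\<dots> = z * (S * V) $$ (0, Suc j)" unfolding QA using that r S(1) V(1) by simp
    also have "\<dots> = 0" unfolding V(2) using that r by simp
    finally have z: "Ah $$ (0, Suc j) = 0" .
    have "(Ah * J\<^sup>T) $$ (0, j) = (\<Sum>b = 0..<r. Ah $$ (0, b) * J $$ (j, b))"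
      using that Ah r by (auto simp: scalar_prod_def intro!: sum.cong)
    also have "\<dots> = (\<Sum>b = 0..<r. if b = Suc j then Ah $$ (0, b) else 0)"
      using that by (intro sum.cong) (auto simp: J_def)
    finally show ?thesis using z that r by simp
  qed
  define M where "M = V * J\<^sup>T"
  define N where "N = Qi * J\<^sup>T"
  define A1 where "A1 = J * (Ah * J\<^sup>T)"
  define B1 where "B1 = J * (Q * B)"
  have E': "E = Qi * S" unfolding S_def using Qi(3) c by (simp add: mat_assoc_dim[symmetric])
  have EM: "E * M = N"
  proof -
    have "E * M = Qi * (S * V) * J\<^sup>T" unfolding E' M_def by (simp add: mat_assoc_dim)
    then show ?thesis unfolding V(2) N_def using Qi(1) by simp
  qed
  have AhJ': "J\<^sup>T * A1 = Ah * J\<^sup>T" unfolding A1_def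
    by (rule JJ[of _ s]) (use Ah AhJ in \<open>auto intro!: carrier_matI\<close>)
  have AM: "A * M = N * A1"
  proof -
    have "Qi * (Ah * J\<^sup>T) = (Qi * Q) * (A * M)" unfolding Ah_def M_def by (simp add: mat_assoc_dim)
    then have "A * M = Qi * (J\<^sup>T * A1)" unfolding Qi(3) AhJ' by (simp add: M_def mat_one_zero_dim)
    then show ?thesis unfolding N_def by (simp add: mat_assoc_dim A1_def)
  qed
  have QB': "J\<^sup>T * B1 = Q * B" unfolding B1_def
    by (rule JJ[of _ n]) (use QB in \<open>auto intro!: carrier_matI\<close>)
  have "N * B1 = Qi * (J\<^sup>T * B1)" unfolding N_def by (simp add: mat_assoc_dim B1_def)
  also have "\<dots> = B" unfolding QB' using Qi(3) c by (simp add: mat_assoc_dim[symmetric])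
  finally have NB: "B = N * B1" by simp
  show ?thesis
    using r EM AM NB by (intro exI[of _ s] exI[of _ M] exI[of _ N] exI[of _ A1] exI[of _ B1])
      (auto simp: M_def N_def A1_def B1_def intro!: carrier_matI)
qed

text \<open>
  The intertwining relations give \<open>(\<lambda>E - A)M = N(\<lambda>I - A\<^sub>1)\<close>, hence
  \<open>(\<lambda>E - A)\<^sup>-\<^sup>1B = M(\<lambda>I - A\<^sub>1)\<^sup>-\<^sup>1B\<^sub>1\<close>, and \<open>CM\<close> completes a realization with fewer states.
\<close>

lemma minimal_no_left_null:
  assumes min: "minimal_realization n r G P A E B C"
    and w: "w \<in> carrier_vec r" "B\<^sup>T *\<^sub>v w = 0\<^sub>v n" "A\<^sup>T *\<^sub>v w = z \<cdot>\<^sub>v (E\<^sup>T *\<^sub>v w)"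
  shows "w = 0\<^sub>v r"
proof (rule ccontr)
  assume w0: "w \<noteq> 0\<^sub>v r"
  have c: "P \<in> sq_mat n" "A \<in> sq_mat r" "E \<in> sq_mat r" "B \<in> carrier_mat r n" "C \<in> carrier_mat n r"
    and E: "det E \<noteq> 0" and G: "G = transfer_function P A E B C"
    using min by (auto simp: minimal_realization_def realization_def)
  obtain s M N A1 B1 where r: "r = Suc s" and c1: "M \<in> carrier_mat r s" "N \<in> carrier_mat r s" "A1 \<in> sq_mat s" "B1 \<in> carrier_mat s n"
    and eq: "E * M = N" "A * M = N * A1" "B = N * B1"
    using uncontrollable_intertwining[OF c(2,3,4) E w(1) w0 w(2,3)] by blast
  let ?K = "rat_pencil A E" and ?K1 = "rat_pencil A1 (1\<^sub>m s)"
  note K = rat_pencil[OF c(2,3)] and K1 = rat_pencil[OF c1(3) one_carrier_mat]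
  note Ki = mat_inv_props[OF K(2) rat_pencil_inverse(1)[OF c(2,3) E]]
  have "det (1\<^sub>m s :: complex mat) \<noteq> 0" by simp
  note K1i = mat_inv_props[OF K1(2) rat_pencil_inverse(1)[OF c1(3) one_carrier_mat this]]
  note dims = K(2) K1(2) Ki(1) K1i(1) c(2) c(3) c(4) c(5) c1(1) c1(2) c1(3) c1(4)
  note [simp] = dims[THEN carrier_matD(1)] dims[THEN carrier_matD(2)]
  have "?K * rconst M = to_fract lam \<cdot>\<^sub>m rconst (E * M) - rconst (A * M)" unfolding K(1) by (simp add: mat_dim_simps rconst_mult)
  also have "\<dots> = rconst N * ?K1" unfolding eq(1,2) K1(1) by (simp add: mat_dim_simps rconst_mult)
  finally have KM: "?K * rconst M = rconst N * ?K1" .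
  have "?K * (rconst M * mat_inv ?K1 * rconst B1) = (?K * rconst M) * mat_inv ?K1 * rconst B1" by (simp add: mat_assoc_dim)
  also have "\<dots> = rconst N * (?K1 * mat_inv ?K1) * rconst B1" unfolding KM by (simp add: mat_assoc_dim)
  also have "\<dots> = rconst B" unfolding K1i(2) eq(3) by (simp add: mat_one_zero_dim rconst_mult)
  finally have "mat_inv ?K * rconst B = (mat_inv ?K * ?K) * (rconst M * mat_inv ?K1 * rconst B1)" by (simp add: mat_assoc_dim)
  then have KB: "mat_inv ?K * rconst B = rconst M * mat_inv ?K1 * rconst B1" unfolding Ki(3) by (simp add: mat_one_zero_dim)
  have "rconst C * mat_inv ?K * rconst B = rconst C * (mat_inv ?K * rconst B)" by (simp add: mat_assoc_dim)
  also have "\<dots> = rconst (C * M) * mat_inv ?K1 * rconst B1" unfolding KB by (simp add: mat_assoc_dim rconst_mult)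
  finally have "G = transfer_function P A1 (1\<^sub>m s) B1 (C * M)" unfolding G transfer_function_rat by simp
  moreover have "C * M \<in> carrier_mat n s" by (auto intro!: carrier_matI)
  ultimately have "realization n s G P A1 (1\<^sub>m s) B1 (C * M)" using c c1 by (simp add: realization_def)
  then have "r \<le> s" using min unfolding minimal_realization_def by blast
  then show False using r by simp
qed

text \<open>
  The dual statement, with the transposed intertwining relations.
\<close>

lemma minimal_no_right_null:
  assumes min: "minimal_realization n r G P A E B C"
    and w: "w \<in> carrier_vec r" "C *\<^sub>v w = 0\<^sub>v n" "A *\<^sub>v w = z \<cdot>\<^sub>v (E *\<^sub>v w)"
  shows "w = 0\<^sub>v r"
proof (rule ccontr)
  assume w0: "w \<noteq> 0\<^sub>v r"
  have c: "P \<in> sq_mat n" "A \<in> sq_mat r" "E \<in> sq_mat r" "B \<in> carrier_mat r n" "C \<in> carrier_mat n r"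
    and E: "det E \<noteq> 0" and G: "G = transfer_function P A E B C"
    using min by (auto simp: minimal_realization_def realization_def)
  have cT: "A\<^sup>T \<in> sq_mat r" "E\<^sup>T \<in> sq_mat r" "C\<^sup>T \<in> carrier_mat r n" "det (E\<^sup>T) \<noteq> 0"
    using c E by (auto simp: det_transpose)
  have "\<exists>s M N A1 B1. r = Suc s \<and> M \<in> carrier_mat r s \<and> N \<in> carrier_mat r s \<and> A1 \<in> sq_mat s \<and> B1 \<in> carrier_mat s n \<and>
     E\<^sup>T * M = N \<and> A\<^sup>T * M = N * A1 \<and> C\<^sup>T = N * B1"
    by (rule uncontrollable_intertwining[OF cT w(1) w0]) (use w in auto)
  then obtain s M N A1 B1 where r: "r = Suc s" and c1: "M \<in> carrier_mat r s" "N \<in> carrier_mat r s" "A1 \<in> sq_mat s" "B1 \<in> carrier_mat s n"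
    and eqT: "E\<^sup>T * M = N" "A\<^sup>T * M = N * A1" "C\<^sup>T = N * B1"
    by blast
  note dims = c(2) c(3) c(4) c(5) c1(1) c1(2) c1(3) c1(4)
  note [simp] = dims[THEN carrier_matD(1)] dims[THEN carrier_matD(2)]
  have eq: "M\<^sup>T * E = N\<^sup>T" "M\<^sup>T * A = A1\<^sup>T * N\<^sup>T" "C = B1\<^sup>T * N\<^sup>T"
  proof -
    have "(E\<^sup>T * M)\<^sup>T = N\<^sup>T" "(A\<^sup>T * M)\<^sup>T = (N * A1)\<^sup>T" "C\<^sup>T\<^sup>T = (N * B1)\<^sup>T" using eqT by simp_all
    then show "M\<^sup>T * E = N\<^sup>T" "M\<^sup>T * A = A1\<^sup>T * N\<^sup>T" "C = B1\<^sup>T * N\<^sup>T" by (simp_all add: mult_transpose)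
  qed
  let ?K = "rat_pencil A E" and ?K1 = "rat_pencil (A1\<^sup>T) (1\<^sub>m s)"
  have c1T: "A1\<^sup>T \<in> sq_mat s" using c1 by simp
  note K = rat_pencil[OF c(2,3)] and K1 = rat_pencil[OF c1T one_carrier_mat]
  note Ki = mat_inv_props[OF K(2) rat_pencil_inverse(1)[OF c(2,3) E]]
  have "det (1\<^sub>m s :: complex mat) \<noteq> 0" by simp
  note K1i = mat_inv_props[OF K1(2) rat_pencil_inverse(1)[OF c1T one_carrier_mat this]]
  note [simp] = carrier_matD[OF K(2)] carrier_matD[OF K1(2)] carrier_matD[OF Ki(1)] carrier_matD[OF K1i(1)]
  have "rconst (M\<^sup>T) * ?K = to_fract lam \<cdot>\<^sub>m rconst (M\<^sup>T * E) - rconst (M\<^sup>T * A)" unfolding K(1) by (simp add: mat_dim_simps rconst_mult)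
  also have "\<dots> = ?K1 * rconst (N\<^sup>T)" unfolding eq(1,2) K1(1) by (simp add: mat_dim_simps rconst_mult)
  finally have KM: "rconst (M\<^sup>T) * ?K = ?K1 * rconst (N\<^sup>T)" .
  have "rconst (B1\<^sup>T) * mat_inv ?K1 * rconst (M\<^sup>T) * ?K = rconst (B1\<^sup>T) * mat_inv ?K1 * (rconst (M\<^sup>T) * ?K)" by (simp add: mat_assoc_dim)
  also have "\<dots> = rconst (B1\<^sup>T) * (mat_inv ?K1 * ?K1) * rconst (N\<^sup>T)" unfolding KM by (simp add: mat_assoc_dim)
  also have "\<dots> = rconst C" unfolding K1i(3) eq(3) by (simp add: mat_one_zero_dim rconst_mult)
  finally have CK: "rconst (B1\<^sup>T) * mat_inv ?K1 * rconst (M\<^sup>T) * ?K = rconst C" .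
  have "rconst C * mat_inv ?K = rconst (B1\<^sup>T) * mat_inv ?K1 * rconst (M\<^sup>T) * (?K * mat_inv ?K)"
    unfolding CK[symmetric] by (simp add: mat_assoc_dim)
  then have KB: "rconst C * mat_inv ?K = rconst (B1\<^sup>T) * mat_inv ?K1 * rconst (M\<^sup>T)" unfolding Ki(2) by (simp add: mat_one_zero_dim)
  have "rconst C * mat_inv ?K * rconst B = rconst (B1\<^sup>T) * mat_inv ?K1 * rconst (M\<^sup>T * B)" unfolding KB by (simp add: mat_assoc_dim rconst_mult)
  then have "G = transfer_function P (A1\<^sup>T) (1\<^sub>m s) (M\<^sup>T * B) (B1\<^sup>T)" unfolding G transfer_function_rat by simp
  moreover have "M\<^sup>T * B \<in> carrier_mat s n" by (auto intro!: carrier_matI)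
  ultimately have "realization n s G P (A1\<^sup>T) (1\<^sub>m s) (M\<^sup>T * B) (B1\<^sup>T)" using c c1 by (simp add: realization_def)
  then have "r \<le> s" using min unfolding minimal_realization_def by blast
  then show False using r by simp
qed

section \<open>Full rank and trivial kernels\<close>

lemma rank_of_trivial_kernel:
  fixes M :: "complex mat"
  assumes M: "M \<in> carrier_mat a r" and inj: "\<And>v. v \<in> carrier_vec r \<Longrightarrow> M *\<^sub>v v = 0\<^sub>v a \<Longrightarrow> v = 0\<^sub>v r"
  shows "vec_space.rank a M = r"
proof -
  interpret vec_space "TYPE(complex)" a .
  have d: "distinct (cols M)"
  proof (rule ccontr)
    assume "\<not> distinct (cols M)"
    then obtain i j where ij: "i < r" "j < r" "i \<noteq> j" "cols M ! i = cols M ! j"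
      using M by (auto simp: distinct_conv_nth)
    then have e: "col M i = col M j" using M by (simp add: cols_nth)
    define v :: "complex vec" where "v = unit_vec r i - unit_vec r j"
    have "M *\<^sub>v v = M *\<^sub>v unit_vec r i - M *\<^sub>v unit_vec r j"
      unfolding v_def using M by (intro mult_minus_distrib_mat_vec[of _ a r]) auto
    also have "\<dots> = col M i - col M j"
    proof -
      have "M *\<^sub>v unit_vec r a = col M a" if "a < r" for a
        using M that by (intro eq_vecI) auto
      then show ?thesis using ij by simp
    qed
    also have "\<dots> = 0\<^sub>v a" by (intro eq_vecI) (use e M in auto)
    finally have "v = 0\<^sub>v r" by (intro inj) (auto simp: v_def)
    then have "v $ i = 0" using ij by simp
    then show False using ij by (simp add: v_def)
  qed
  have "lin_indpt (set (cols M))"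
    using lin_depE[OF M _ d] inj by blast
  then show ?thesis using lin_indpt_full_rank[OF M d] by blast
qed

text \<open>
  The Gram matrix \<open>MM\<^sup>*\<close> is nonsingular, since \<open>MM\<^sup>*v = 0\<close> forces \<open>M\<^sup>*v = 0\<close>; it provides a right
  inverse of \<open>M\<close>, so the columns of \<open>M\<close> span the whole space.
\<close>

lemma rank_of_trivial_left_kernel:
  fixes M :: "complex mat"
  assumes M: "M \<in> carrier_mat r c" and inj: "\<And>v. v \<in> carrier_vec r \<Longrightarrow> M\<^sup>T *\<^sub>v v = 0\<^sub>v c \<Longrightarrow> v = 0\<^sub>v r"
  shows "vec_space.rank r M = r"
proof -
  interpret vec_space "TYPE(complex)" r .
  define H where "H = map_mat cnj (M\<^sup>T)"
  have H: "H \<in> carrier_mat c r" using M by (simp add: H_def)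
  have G: "M * H \<in> sq_mat r" using M H by auto
  \<comment> \<open>\<open>H\<close> is the conjugate transpose of \<open>M\<close>, so a null vector \<open>v\<close> gives \<open>Hv\<close> of norm zero\<close>
  have "det (M * H) \<noteq> 0"
  proof
    assume "det (M * H) = 0"
    then obtain v where v: "v \<in> carrier_vec r" "v \<noteq> 0\<^sub>v r" "(M * H) *\<^sub>v v = 0\<^sub>v r"
      using det_0_iff_vec_prod_zero_field[OF G] by auto
    define u where "u = H *\<^sub>v v"
    define v' where "v' = conjugate v"
    have u: "u \<in> carrier_vec c" "v' \<in> carrier_vec r" using H v by (auto simp: u_def v'_def)
    have cu: "conjugate u = M\<^sup>T *\<^sub>v v'"
    proof (rule eq_vecI)
      fix i assume "i < dim_vec (M\<^sup>T *\<^sub>v v')"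
      then have "i < c" using M by simp
      then show "conjugate u $ i = (M\<^sup>T *\<^sub>v v') $ i"
        using M v by (auto simp: u_def v'_def H_def scalar_prod_def conjugate_complex_def)
    qed (use M u in auto)
    have Mu: "M *\<^sub>v u = 0\<^sub>v r"
      unfolding u_def using v(3) assoc_mult_mat_vec[OF M H v(1)] by simp
    have cc: "conjugate u \<in> carrier_vec c" using u(1) by simp
    have "u \<bullet>c u = conjugate u \<bullet> u" by (rule comm_scalar_prod[OF u(1) cc])
    also have "\<dots> = (M\<^sup>T *\<^sub>v v') \<bullet> u" unfolding cu ..
    also have "\<dots> = v' \<bullet> (M *\<^sub>v u)" by (rule transpose_vec_mult_scalar[OF M u])
    also have "\<dots> = 0" unfolding Mu using u(2) by simp
    finally have "u = 0\<^sub>v c" using conjugate_square_eq_0_vec[OF u(1)] by simp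
    then have "M\<^sup>T *\<^sub>v v' = 0\<^sub>v c" unfolding cu[symmetric] by (intro eq_vecI) auto
    then have "v' = 0\<^sub>v r" using inj u(2) by blast
    then have "v = 0\<^sub>v r" using v(1) unfolding v'_def by (metis conjugate_zero_iff_vec)
    then show False using v(2) by simp
  qed
  note I = mat_inv_props[OF G this]
  have "col_space M = carrier_vec r"
  proof
    show "col_space M \<subseteq> carrier_vec r" unfolding col_space_eq[OF M] using M by auto
    show "carrier_vec r \<subseteq> col_space M"
    proof
      fix y :: "complex vec" assume y: "y \<in> carrier_vec r"
      have "M *\<^sub>v (H *\<^sub>v (mat_inv (M * H) *\<^sub>v y)) = ((M * H) * mat_inv (M * H)) *\<^sub>v y"
        using M H I(1) y by (simp add: assoc_mult_mat_vec[of _ r c _ r] assoc_mult_mat_vec[of _ r r _ r])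
      then have "M *\<^sub>v (H *\<^sub>v (mat_inv (M * H) *\<^sub>v y)) = y" unfolding I(2) using y by simp
      then show "y \<in> col_space M" unfolding col_space_eq[OF M] using M H I(1) y by (auto intro!: bexI[of _ "H *\<^sub>v (mat_inv (M * H) *\<^sub>v y)"])
    qed
  qed
  then have "span (set (cols M)) = carrier V" by (simp add: col_space_def)
  then have "span_vs (set (cols M)) = V" by simp
  then show ?thesis unfolding rank_def using dim_is_n by simp
qed

section \<open>Horner's scheme and matrix polynomials\<close>

lemma unimodular_of_unit_det: "U \<in> sq_mat N \<Longrightarrow> det U dvd 1 \<Longrightarrow> unimodular N U"
proof -
  assume U: "U \<in> sq_mat N" and "det U dvd 1"
  then have "degree (det U) = 0" "det U \<noteq> 0" by (auto simp: is_unit_iff_degree)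
  then obtain c where "det U = [:c:]" "c \<noteq> 0" using degree_eq_zeroE by (metis pCons_eq_0_iff)
  then show "unimodular N U" using U unfolding unimodular_def by blast
qed

lemma (in comm_ring_hom) map_nested:
  assumes "Z \<in> sq_mat (n + r)" "\<And>i. i \<le> k \<Longrightarrow> X i \<in> sq_mat n"
  shows "map_mat hom (nested n r Z side X k) = nested n r (map_mat hom Z) side (\<lambda>i. map_mat hom (X i)) k"
  using assms(2)
proof (induction k)
  case (Suc k)
  have N: "nested n r Z side X k \<in> sq_mat (n + (k * n + r))"
    by (rule nested_carrier) (use assms(1) Suc.prems in auto)
  have X: "X (Suc k) \<in> sq_mat n" using Suc.prems by simp
  have c: "map_mat hom (corner n (X (Suc k))) = corner n (map_mat hom (X (Suc k)))"
    unfolding corner_def using X by (subst map_four_block_mat) (auto simp: mat_hom_one)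
  have m: "corner n (X (Suc k)) \<boxplus> 1\<^sub>m (k * n + r) \<in> sq_mat (n + (n + (k * n + r)))"
    "1\<^sub>m n \<boxplus> nested n r Z side X k \<in> sq_mat (n + (n + (k * n + r)))"
    using N X by (auto intro!: carrier_matI)
  have IH: "map_mat hom (nested n r Z side X k) = nested n r (map_mat hom Z) side (\<lambda>i. map_mat hom (X i)) k"
    by (rule Suc.IH) (use Suc.prems in simp)
  show ?case
    by (simp add: mat_hom_mult[OF m] mat_hom_mult[OF m(2,1)] map_dsum c IH mat_hom_one)
qed simp

lemma (in comm_ring_hom) map_horner:
  assumes "L \<in> sq_mat n" "\<And>i. i \<le> k \<Longrightarrow> X i \<in> sq_mat n"
  shows "map_mat hom (horner x X k L) = horner (hom x) (\<lambda>i. map_mat hom (X i)) k (map_mat hom L)"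
  using assms
proof (induction k arbitrary: L)
  case (Suc k)
  have L': "x \<cdot>\<^sub>m L - X (Suc k) \<in> sq_mat n" using Suc.prems by (intro minus_carrier_mat) auto
  have "map_mat hom (x \<cdot>\<^sub>m L - X (Suc k)) = hom x \<cdot>\<^sub>m map_mat hom L - map_mat hom (X (Suc k))"
    using Suc.prems(1) Suc.prems(2)[of "Suc k"] by (intro eq_matI) (auto simp: hom_distribs)
  then show ?case using Suc.IH[OF L'] Suc.prems(2) by simp
qed simp

lemma horner_entry:
  fixes x :: "'a::comm_ring_1"
  assumes "L \<in> sq_mat n" "\<And>i. i \<le> k \<Longrightarrow> X i \<in> sq_mat n" "i < n" "j < n"
  shows "x * horner x X k L $$ (i, j) - X 0 $$ (i, j) = x ^ Suc k * L $$ (i, j) - (\<Sum>l\<le>k. x ^ l * X l $$ (i, j))"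
  using assms(1,2)
proof (induction k arbitrary: L)
  case (Suc k)
  have L': "x \<cdot>\<^sub>m L - X (Suc k) \<in> sq_mat n" using Suc.prems by (intro minus_carrier_mat) auto
  have e: "(x \<cdot>\<^sub>m L - X (Suc k)) $$ (i, j) = x * L $$ (i, j) - X (Suc k) $$ (i, j)"
    using Suc.prems(1) Suc.prems(2)[of "Suc k"] assms(3,4) by auto
  have "x * horner x X (Suc k) L $$ (i, j) - X 0 $$ (i, j)
      = x ^ Suc k * (x * L $$ (i, j) - X (Suc k) $$ (i, j)) - (\<Sum>l\<le>k. x ^ l * X l $$ (i, j))"
    using Suc.IH[OF L'] Suc.prems(2) unfolding e by simp
  then show ?case by (simp only: sum.atMost_Suc right_diff_distrib power_Suc mult_ac diff_diff_eq add.commute)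
qed simp

lemma matrix_poly_horner:
  assumes "\<And>i. i \<le> Suc k \<Longrightarrow> Ac i \<in> sq_mat n"
  shows "matrix_poly n (Suc k) Ac = lam \<cdot>\<^sub>m horner lam (\<lambda>i. const_mat (- Ac i)) k (const_mat (Ac (Suc k))) - const_mat (- Ac 0)"
proof (rule eq_matI)
  let ?X = "\<lambda>i. const_mat (- Ac i)" and ?L = "const_mat (Ac (Suc k))"
  have c: "?L \<in> sq_mat n" "\<And>i. i \<le> k \<Longrightarrow> ?X i \<in> sq_mat n" using assms by auto
  note h [simp] = carrier_matD[OF horner_carrier[OF c, where x = lam]]
  note a [simp] = carrier_matD[OF assms[of 0]]
  show "dim_row (matrix_poly n (Suc k) Ac) = dim_row (lam \<cdot>\<^sub>m horner lam ?X k ?L - ?X 0)"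
    "dim_col (matrix_poly n (Suc k) Ac) = dim_col (lam \<cdot>\<^sub>m horner lam ?X k ?L - ?X 0)" by (simp_all add: matrix_poly_def)
  fix i j assume "i < dim_row (lam \<cdot>\<^sub>m horner lam ?X k ?L - ?X 0)" "j < dim_col (lam \<cdot>\<^sub>m horner lam ?X k ?L - ?X 0)"
  then have ij: "i < n" "j < n" by simp_all
  have mon: "monom (Ac l $$ (i, j)) l = lam ^ l * [:Ac l $$ (i, j):]" for l
    by (simp add: monom_altdef lam_def)
  have "(lam \<cdot>\<^sub>m horner lam ?X k ?L - ?X 0) $$ (i, j) = lam * horner lam ?X k ?L $$ (i, j) - ?X 0 $$ (i, j)"
    using ij by simp
  also have "\<dots> = lam ^ Suc k * ?L $$ (i, j) - (\<Sum>l\<le>k. lam ^ l * ?X l $$ (i, j))"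
    by (rule horner_entry[OF c ij])
  also have "(\<Sum>l\<le>k. lam ^ l * ?X l $$ (i, j)) = - (\<Sum>l\<le>k. monom (Ac l $$ (i, j)) l)"
    unfolding sum_negf[symmetric]
  proof (rule sum.cong[OF refl])
    fix l assume "l \<in> {..k}"
    then have "?X l $$ (i, j) = - [:Ac l $$ (i, j):]" using assms[of l] ij by simp
    then show "lam ^ l * ?X l $$ (i, j) = - monom (Ac l $$ (i, j)) l" unfolding mon by simp
  qed
  also have "lam ^ Suc k * ?L $$ (i, j) = monom (Ac (Suc k) $$ (i, j)) (Suc k)"
    unfolding mon using assms[of "Suc k"] ij by simp
  finally show "matrix_poly n (Suc k) Ac $$ (i, j) = (lam \<cdot>\<^sub>m horner lam ?X k ?L - ?X 0) $$ (i, j)"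
    using ij by (simp add: matrix_poly_def)
qed

section \<open>Schur complements\<close>

lemma four_block_eqD:
  assumes eq: "four_block_mat a b c d = four_block_mat a' b' c' d'"
    and c: "a \<in> carrier_mat p q" "b \<in> carrier_mat p s" "c \<in> carrier_mat r q" "d \<in> carrier_mat r s"
    and c': "a' \<in> carrier_mat p q" "b' \<in> carrier_mat p s" "c' \<in> carrier_mat r q" "d' \<in> carrier_mat r s"
  shows "a = a'" "b = b'" "c = c'" "d = d'"
proof -
  have e: "four_block_mat a b c d $$ (i, j) = four_block_mat a' b' c' d' $$ (i, j)" for i j using eq by simp
  show "a = a'"
  proof (rule eq_matI)
    fix i j assume "i < dim_row a'" "j < dim_col a'" then show "a $$ (i, j) = a' $$ (i, j)" using e[of i j] c c' by simp
  qed (use c c' in auto)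
  show "b = b'"
  proof (rule eq_matI)
    fix i j assume "i < dim_row b'" "j < dim_col b'" then show "b $$ (i, j) = b' $$ (i, j)" using e[of i "q + j"] c c' by simp
  qed (use c c' in auto)
  show "c = c'"
  proof (rule eq_matI)
    fix i j assume "i < dim_row c'" "j < dim_col c'" then show "c $$ (i, j) = c' $$ (i, j)" using e[of "p + i" j] c c' by simp
  qed (use c c' in auto)
  show "d = d'"
  proof (rule eq_matI)
    fix i j assume "i < dim_row d'" "j < dim_col d'" then show "d $$ (i, j) = d' $$ (i, j)" using e[of "p + i" "q + j"] c c' by simp
  qed (use c c' in auto)
qed

lemma four_block_cases:
  assumes "M \<in> sq_mat (p + r)"
  obtains a b c d where "a \<in> sq_mat p" "b \<in> carrier_mat p r" "c \<in> carrier_mat r p" "d \<in> sq_mat r"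
    "M = four_block_mat a b c d"
proof -
  obtain a b c d where "split_block M p p = (a, b, c, d)" by (metis prod_cases4)
  from split_block[OF this, of r r] assms that show ?thesis by auto
qed

text \<open>
  The Schur complement of the lower right block, where \<open>R\<close> is given independently and stands for the
  inverse of that block up to sign.
\<close>

definition schur :: "nat \<Rightarrow> 'a::ring_1 mat \<Rightarrow> 'a mat \<Rightarrow> 'a mat" where
  "schur p R M = (case split_block M p p of (a, b, c, d) \<Rightarrow> a - b * R * c)"

lemma schur_four_block:
  assumes "a \<in> sq_mat p" "b \<in> carrier_mat p r" "c \<in> carrier_mat r p" "d \<in> sq_mat r"
  shows "schur p R (four_block_mat a b c d) = a - b * R * c"
proof -
  obtain a' b' c' d' where s: "split_block (four_block_mat a b c d) p p = (a', b', c', d')" by (metis prod_cases4)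
  have "dim_row (four_block_mat a b c d) = p + r" "dim_col (four_block_mat a b c d) = p + r" using assms by auto
  from split_block[OF s this] have s': "a' \<in> sq_mat p" "b' \<in> carrier_mat p r" "c' \<in> carrier_mat r p" "d' \<in> sq_mat r"
    "four_block_mat a b c d = four_block_mat a' b' c' d'" by auto
  from four_block_eqD[OF s'(5) assms s'(1-4)] show ?thesis unfolding schur_def s by simp
qed

lemma dsum_one_sandwich:
  fixes U :: "'a::ring_1 mat"
  assumes "U \<in> sq_mat p" "V \<in> sq_mat p"
    and "a \<in> sq_mat p" "b \<in> carrier_mat p r" "c \<in> carrier_mat r p" "d \<in> sq_mat r"
  shows "(U \<boxplus> 1\<^sub>m r) * four_block_mat a b c d * (V \<boxplus> 1\<^sub>m r) = four_block_mat (U * a * V) (U * b) (c * V) d"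
proof -
  note dims = assms(1) assms(2) assms(3) assms(4) assms(5) assms(6)
  note [simp] = dims[THEN carrier_matD(1)] dims[THEN carrier_matD(2)]
  show ?thesis unfolding dsum_def by (simp add: four_block_mult_dim mat_one_zero_dim mat_add_zero_dim)
qed

lemma schur_sandwich:
  fixes U :: "'a::comm_ring_1 mat"
  assumes U: "U \<in> sq_mat p" "V \<in> sq_mat p" and M: "M \<in> sq_mat (p + r)" and R: "R \<in> sq_mat r"
  shows "schur p R ((U \<boxplus> 1\<^sub>m r) * M * (V \<boxplus> 1\<^sub>m r)) = U * schur p R M * V"
proof -
  obtain a b c d where m: "a \<in> sq_mat p" "b \<in> carrier_mat p r" "c \<in> carrier_mat r p" "d \<in> sq_mat r" and M': "M = four_block_mat a b c d"
    using four_block_cases[OF M] .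
  note dims = U(1) U(2) m(1) m(2) m(3) R
  note [simp] = dims[THEN carrier_matD(1)] dims[THEN carrier_matD(2)]
  have "schur p R ((U \<boxplus> 1\<^sub>m r) * M * (V \<boxplus> 1\<^sub>m r)) = U * a * V - U * b * R * (c * V)"
    unfolding M' dsum_one_sandwich[OF U m] by (rule schur_four_block[of _ _ _ r]) (auto intro!: carrier_matI simp: carrier_matD[OF m(4)])
  also have "\<dots> = U * (a - b * R * c) * V" by (simp add: mat_dim_simps)
  also have "\<dots> = U * schur p R M * V" unfolding M' schur_four_block[OF m] ..
  finally show ?thesis .
qed

lemma one_dsum_four_block:
  fixes a :: "'a::ring_1 mat"
  assumes "a \<in> sq_mat p" "b \<in> carrier_mat p r" "c \<in> carrier_mat r p" "d \<in> sq_mat r"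
  shows "1\<^sub>m n \<boxplus> four_block_mat a b c d = four_block_mat (1\<^sub>m n \<boxplus> a)
     (four_block_mat (0\<^sub>m n 0) (0\<^sub>m n r) (0\<^sub>m p 0) b) (four_block_mat (0\<^sub>m 0 n) (0\<^sub>m 0 p) (0\<^sub>m r n) c) d"
  by (rule eq_matI) (use assms in \<open>auto simp: dsum_def\<close>)

text \<open>
  The padding of the off-diagonal blocks is written with blocks without rows or columns, so
  that their product is a block product again.
\<close>

lemma schur_one_dsum:
  fixes M :: "'a::ring_1 mat"
  assumes M: "M \<in> sq_mat (p + r)" and R: "R \<in> sq_mat r"
  shows "schur (n + p) R (1\<^sub>m n \<boxplus> M) = 1\<^sub>m n \<boxplus> schur p R M"
proof -
  obtain a b c d where m: "a \<in> sq_mat p" "b \<in> carrier_mat p r" "c \<in> carrier_mat r p" "d \<in> sq_mat r" and M': "M = four_block_mat a b c d"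
    using four_block_cases[OF M] .
  note [simp] = carrier_matD[OF m(1)] carrier_matD[OF m(2)]
    carrier_matD[OF m(3)] carrier_matD[OF R] carrier_matD[OF m(4)]
  let ?b = "four_block_mat (0\<^sub>m n 0) (0\<^sub>m n r) (0\<^sub>m p 0) b" and ?c = "four_block_mat (0\<^sub>m 0 n) (0\<^sub>m 0 p) (0\<^sub>m r n) c"
  have R': "R = four_block_mat (0\<^sub>m 0 0) (0\<^sub>m 0 r) (0\<^sub>m r 0) R" by (rule eq_matI) auto
  have "?b * R * ?c = 0\<^sub>m n n \<boxplus> b * R * c"
    by (subst R') (simp add: four_block_mult_dim mat_one_zero_dim mat_add_zero_dim dsum_def)
  then have "(1\<^sub>m n \<boxplus> a) - ?b * R * ?c = 1\<^sub>m n \<boxplus> (a - b * R * c)"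
    by (auto intro!: eq_matI simp: dsum_def)
  moreover have "schur (n + p) R (1\<^sub>m n \<boxplus> M) = (1\<^sub>m n \<boxplus> a) - ?b * R * ?c"
    unfolding M' one_dsum_four_block[OF m] by (rule schur_four_block[of _ _ _ r]) (auto intro!: carrier_matI)
  ultimately show ?thesis unfolding M' schur_four_block[OF m] by simp
qed

lemma schur_carrier:
  assumes "M \<in> sq_mat (p + r)" "R \<in> sq_mat r"
  shows "schur p R M \<in> sq_mat p"
proof -
  obtain a b c d where m: "a \<in> sq_mat p" "b \<in> carrier_mat p r" "c \<in> carrier_mat r p" "d \<in> sq_mat r" and M': "M = four_block_mat a b c d"
    using four_block_cases[OF assms(1)] .
  show ?thesis unfolding M' schur_four_block[OF m] using m assms(2) by (auto intro!: minus_carrier_mat)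
qed

text \<open>
  The corners do not touch the state coordinates, so eliminating the state affects only the
  innermost block.
\<close>

lemma schur_nested:
  fixes Z :: "'a::comm_ring_1 mat"
  assumes Z: "Z \<in> sq_mat (n + r)" and X: "\<And>i. i \<le> k \<Longrightarrow> X i \<in> sq_mat n" and R: "R \<in> sq_mat r"
  shows "schur (n + k * n) R (nested n r Z side X k) = nested n 0 (schur n R Z) side X k"
  using X
proof (induction k)
  case (Suc k)
  let ?N = "nested n r Z side X k" and ?T = "corner n (X (Suc k))"
  have N: "?N \<in> sq_mat (n + k * n + r)"
    using nested_carrier[OF Z, of k X side] Suc.prems by (simp add: add.assoc)
  have Xk: "X (Suc k) \<in> sq_mat n" using Suc.prems by simp
  have IH: "schur (n + k * n) R ?N = nested n 0 (schur n R Z) side X k" by (rule Suc.IH) (use Suc.prems in simp)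
  have one: "1\<^sub>m (n + Suc k * n) \<in> sq_mat (n + Suc k * n)" by simp
  have T: "?T \<boxplus> 1\<^sub>m (k * n) \<in> sq_mat (n + Suc k * n)" using Xk by (auto intro!: carrier_matI)
  have T': "?T \<boxplus> 1\<^sub>m (k * n + r) = (?T \<boxplus> 1\<^sub>m (k * n)) \<boxplus> 1\<^sub>m r" by (simp add: dsum_assoc)
  have M: "1\<^sub>m n \<boxplus> ?N \<in> sq_mat (n + Suc k * n + r)" using N by (auto intro!: carrier_matI)
  have SM: "schur (n + Suc k * n) R (1\<^sub>m n \<boxplus> ?N) = 1\<^sub>m n \<boxplus> nested n 0 (schur n R Z) side X k"
    using schur_one_dsum[OF N R, of n] IH by simp
  have dM: "dim_row (1\<^sub>m n \<boxplus> ?N) = n + Suc k * n + r" "dim_col (1\<^sub>m n \<boxplus> ?N) = n + Suc k * n + r" using M by auto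
  have f: "dim_row (nested n 0 (schur n R Z) side X k) = n + k * n" "dim_col (nested n 0 (schur n R Z) side X k) = n + k * n"
    unfolding IH[symmetric] using schur_carrier[OF N R] by auto
  show ?case
  proof (cases "side (Suc k)")
    case True
    have "schur (n + Suc k * n) R (((?T \<boxplus> 1\<^sub>m (k * n)) \<boxplus> 1\<^sub>m r) * (1\<^sub>m n \<boxplus> ?N) * (1\<^sub>m (n + Suc k * n) \<boxplus> 1\<^sub>m r))
       = (?T \<boxplus> 1\<^sub>m (k * n)) * (1\<^sub>m n \<boxplus> nested n 0 (schur n R Z) side X k) * 1\<^sub>m (n + Suc k * n)"
      unfolding schur_sandwich[OF T one M R] SM ..
    then show ?thesis using True carrier_matD[OF T] dM f unfolding nested.simps(2) T' by (simp add: mat_one_zero_dim del: nested.simps)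
  next
    case False
    have "schur (n + Suc k * n) R ((1\<^sub>m (n + Suc k * n) \<boxplus> 1\<^sub>m r) * (1\<^sub>m n \<boxplus> ?N) * ((?T \<boxplus> 1\<^sub>m (k * n)) \<boxplus> 1\<^sub>m r))
       = 1\<^sub>m (n + Suc k * n) * (1\<^sub>m n \<boxplus> nested n 0 (schur n R Z) side X k) * (?T \<boxplus> 1\<^sub>m (k * n))"
      unfolding schur_sandwich[OF one T M R] SM ..
    then show ?thesis using False carrier_matD[OF T] dM f unfolding nested.simps(2) T' by (simp add: mat_one_zero_dim del: nested.simps)
  qed
qed simp

section \<open>The strong linearization\<close>

lemma rconst_uminus: "rconst (- M) = - rconst M"
proof -
  have "to_fract [:- c:] = - to_fract [:c:]" for c :: complex by (simp flip: to_fract_uminus)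
  then show ?thesis by (auto intro!: eq_matI simp: rconst_def)
qed

text \<open>
  The reduction at infinity, with the innermost block \<open>-(A\<^sub>0 + C(\<lambda>E - A)\<^sup>-\<^sup>1B)\<close> that the elimination
  of the state produces.
\<close>

lemma rational_reduction:
  fixes Ac :: "nat \<Rightarrow> complex mat"
  assumes Ac: "\<And>i. i \<le> Suc k \<Longrightarrow> Ac i \<in> sq_mat n"
    and AE: "A \<in> sq_mat r" "E \<in> sq_mat r" and B: "B \<in> carrier_mat r n" and C: "C \<in> carrier_mat n r" and E: "det E \<noteq> 0"
    and F: "F = nested n 0 (- rconst (Ac 0) - rconst C * mat_inv (rat_pencil A E) * rconst B) side (\<lambda>i. rconst (- Ac i)) k"
  shows "\<exists>Ol Or. biproper (n + k * n) Ol \<and> biproper (n + k * n) Or \<and>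
     Ol * ((rconst (Ac (Suc k)) \<boxplus> 1\<^sub>m (k * n)) - inverse (to_fract lam) \<cdot>\<^sub>m F) * Or
      = 1\<^sub>m (k * n) \<boxplus> (inverse (to_fract lam ^ Suc k) \<cdot>\<^sub>m transfer_function (matrix_poly n (Suc k) Ac) A E B C)"
proof -
  let ?\<mu> = "inverse (to_fract lam)" and ?R = "mat_inv (rat_pencil A E)" and ?X = "\<lambda>i. rconst (- Ac i)"
  define Z where "Z = - rconst (Ac 0) - rconst C * ?R * rconst B"
  note R = mat_inv_props[OF rat_pencil(2)[OF AE] rat_pencil_inverse(1)[OF AE E]]
  note dims = R(1) Ac[of 0] AE(1) AE(2) B C Ac[of "Suc k"]
  note [simp] = dims[THEN carrier_matD(1)] dims[THEN carrier_matD(2)]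
  have Z: "Z \<in> sq_mat n" by (auto simp: Z_def intro!: carrier_matI)
  have pZ: "proper_mat Z" unfolding Z_def
    by (auto intro!: proper_mat_intros proper_mat_mult proper_rconst rat_pencil_inverse(2)[OF AE E])
  have X: "?X i \<in> sq_mat n" "proper_mat (?X i)" if "i \<le> k" for i
    using Ac[of i] that by (auto simp: proper_rconst intro!: carrier_matI)
  have L: "rconst (Ac (Suc k)) \<in> sq_mat n" by (auto intro!: carrier_matI)
  have \<mu>: "proper ?\<mu>" "?\<mu> * to_fract lam = 1" using lam_nonzero by (auto intro: proper_intros)
  obtain U V where UV: "biproper (n + k * n) U" "biproper (n + k * n) V" and eq:
    "U * (((?\<mu> ^ (0 + 0) \<cdot>\<^sub>m rconst (Ac (Suc k))) \<boxplus> 1\<^sub>m (k * n)) - ?\<mu> \<cdot>\<^sub>m (lead_scale n (k * n) (?\<mu> ^ 0) * nested n 0 Z side ?X k * lead_scale n (k * n) (?\<mu> ^ 0))) * V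
     = 1\<^sub>m (k * n) \<boxplus> (?\<mu> ^ (0 + 0 + k + 1) \<cdot>\<^sub>m (to_fract lam \<cdot>\<^sub>m horner (to_fract lam) ?X k (rconst (Ac (Suc k))) - Z))"
    using infinite_reduction[where X = ?X and k = k and a = 0 and b = 0 and side = side, OF Z pZ X(1) X(2) L \<mu>(1) \<mu>(2)] by blast
  have FZ: "F = nested n 0 Z side ?X k" by (simp add: F Z_def)
  have "nested n 0 Z side ?X k \<in> sq_mat (n + (k * n + 0))"
    by (rule nested_carrier) (use Z X in auto)
  then have Fd: "dim_row F = n + k * n" "dim_col F = n + k * n" unfolding FZ by auto
  have cc: "const_mat (Ac (Suc k)) \<in> sq_mat n" "\<And>i. i \<le> k \<Longrightarrow> const_mat (- Ac i) \<in> sq_mat n" using Ac by auto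
  have mp: "matrix_poly n (Suc k) Ac = lam \<cdot>\<^sub>m horner lam (\<lambda>i. const_mat (- Ac i)) k (const_mat (Ac (Suc k))) - const_mat (- Ac 0)"
    by (rule matrix_poly_horner) (rule Ac)
  have "rat_mat (matrix_poly n (Suc k) Ac) = to_fract lam \<cdot>\<^sub>m rat_mat (horner lam (\<lambda>i. const_mat (- Ac i)) k (const_mat (Ac (Suc k)))) - rconst (- Ac 0)"
    unfolding mp rconst_def using carrier_matD[OF horner_carrier[where x = lam and k = k and X = "\<lambda>i. const_mat (- Ac i)", OF cc]]
    by (auto intro!: eq_matI)
  moreover have mh: "rat_mat (horner lam (\<lambda>i. const_mat (- Ac i)) k (const_mat (Ac (Suc k)))) = horner (to_fract lam) ?X k (rconst (Ac (Suc k)))"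
    unfolding rconst_def by (rule rat_h.map_horner) (rule cc, rule cc, simp)
  ultimately have P: "rat_mat (matrix_poly n (Suc k) Ac) = to_fract lam \<cdot>\<^sub>m horner (to_fract lam) ?X k (rconst (Ac (Suc k))) - rconst (- Ac 0)"
    by (simp only: mh rconst_def)
  have Hd: "dim_row (horner (to_fract lam) ?X k (rconst (Ac (Suc k)))) = n" "dim_col (horner (to_fract lam) ?X k (rconst (Ac (Suc k)))) = n"
    using carrier_matD[OF horner_carrier[where x = "to_fract lam" and k = k and X = ?X, OF L X(1)]] by simp_all
  have "- rconst (Ac 0) = rconst (- Ac 0)" by (simp add: rconst_uminus)
  then have G: "to_fract lam \<cdot>\<^sub>m horner (to_fract lam) ?X k (rconst (Ac (Suc k))) - Z = transfer_function (matrix_poly n (Suc k) Ac) A E B C"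
    unfolding transfer_function_rat P Z_def using Hd by (auto intro!: eq_matI)
  have "U * ((rconst (Ac (Suc k)) \<boxplus> 1\<^sub>m (k * n)) - ?\<mu> \<cdot>\<^sub>m F) * V = 1\<^sub>m (k * n) \<boxplus> (inverse (to_fract lam ^ Suc k) \<cdot>\<^sub>m transfer_function (matrix_poly n (Suc k) Ac) A E B C)"
    using eq Fd unfolding G FZ[symmetric] by (simp add: smult_mat_one mat_one_zero_dim power_inverse)
  then show ?thesis using UV by blast
qed

text \<open>
  A null vector of one of the two rank conditions is killed by the state pencil and, through the
  hypotheses on \<open>BB\<close> and \<open>CC\<close>, by \<open>B\<close> or \<open>C\<close>; minimality excludes it.
\<close>

lemma irreducible_of_minimal:
  assumes min: "minimal_realization n r G P A E B C"
    and BB: "BB \<in> carrier_mat r N" and CC: "CC \<in> carrier_mat N r"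
    and B0: "\<And>w. w \<in> carrier_vec r \<Longrightarrow> BB\<^sup>T *\<^sub>v w = 0\<^sub>v N \<Longrightarrow> B\<^sup>T *\<^sub>v w = 0\<^sub>v n"
    and C0: "\<And>w. w \<in> carrier_vec r \<Longrightarrow> CC *\<^sub>v w = 0\<^sub>v N \<Longrightarrow> C *\<^sub>v w = 0\<^sub>v n"
  shows "irreducible_pencil N r BB CC A E"
  unfolding irreducible_pencil_def
proof (intro allI conjI)
  fix z
  have AE: "A \<in> sq_mat r" "E \<in> sq_mat r"
    using min by (auto simp: minimal_realization_def realization_def)
  define K where "K = A - z \<cdot>\<^sub>m E"
  have K: "K \<in> sq_mat r" using AE by (auto simp: K_def intro!: minus_carrier_mat)
  note [simp] = carrier_matD[OF K] carrier_matD[OF AE(1)] carrier_matD[OF AE(2)] carrier_matD[OF BB] carrier_matD[OF CC]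
  have Kw: "A *\<^sub>v w = z \<cdot>\<^sub>v (E *\<^sub>v w)" if "w \<in> carrier_vec r" "K *\<^sub>v w = 0\<^sub>v r" for w
  proof (rule eq_vecI)
    fix i assume "i < dim_vec (z \<cdot>\<^sub>v (E *\<^sub>v w))"
    then have i: "i < r" by simp
    have "row K i = row A i - z \<cdot>\<^sub>v row E i" using i by (auto simp: K_def intro!: eq_vecI)
    moreover have "row A i \<in> carrier_vec r" "row E i \<in> carrier_vec r" using i by (auto intro!: carrier_vecI)
    moreover from this have "(row A i - z \<cdot>\<^sub>v row E i) \<bullet> w = row A i \<bullet> w - z * (row E i \<bullet> w)"
      using that(1) by (simp add: minus_scalar_prod_distrib[of _ r])
    moreover have "row K i \<bullet> w = 0" using arg_cong[OF that(2), of "\<lambda>v. vec_index v i"] i by simp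
    ultimately show "(A *\<^sub>v w) $ i = (z \<cdot>\<^sub>v (E *\<^sub>v w)) $ i"
      using i that(1) by simp
  qed simp
  have KTw: "A\<^sup>T *\<^sub>v w = z \<cdot>\<^sub>v (E\<^sup>T *\<^sub>v w)" if "w \<in> carrier_vec r" "K\<^sup>T *\<^sub>v w = 0\<^sub>v r" for w
  proof (rule eq_vecI)
    fix i assume "i < dim_vec (z \<cdot>\<^sub>v (E\<^sup>T *\<^sub>v w))"
    then have i: "i < r" by simp
    have "col K i = col A i - z \<cdot>\<^sub>v col E i" using i by (auto simp: K_def intro!: eq_vecI)
    moreover have "col A i \<in> carrier_vec r" "col E i \<in> carrier_vec r" using i by (auto intro!: carrier_vecI)
    moreover from this have "(col A i - z \<cdot>\<^sub>v col E i) \<bullet> w = col A i \<bullet> w - z * (col E i \<bullet> w)"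
      using that(1) by (simp add: minus_scalar_prod_distrib[of _ r])
    moreover have "col K i \<bullet> w = 0" using arg_cong[OF that(2), of "\<lambda>v. vec_index v i"] i by simp
    ultimately show "(A\<^sup>T *\<^sub>v w) $ i = (z \<cdot>\<^sub>v (E\<^sup>T *\<^sub>v w)) $ i"
      using i that(1) by simp
  qed simp
  show "vec_space.rank r (BB @\<^sub>c (A - z \<cdot>\<^sub>m E)) = r"
    unfolding K_def[symmetric]
  proof (rule rank_of_trivial_left_kernel)
    show "BB @\<^sub>c K \<in> carrier_mat r (N + r)" by (auto simp: append_cols_def intro!: carrier_matI)
    fix w assume w: "w \<in> carrier_vec r" "(BB @\<^sub>c K)\<^sup>T *\<^sub>v w = 0\<^sub>v (N + r)"
    have e: "col (BB @\<^sub>c K) j \<bullet> w = 0" if "j < N + r" for j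
      using arg_cong[OF w(2), of "\<lambda>v. vec_index v j"] that by (simp add: append_cols_def)
    have "BB\<^sup>T *\<^sub>v w = 0\<^sub>v N"
    proof (rule eq_vecI)
      fix j assume "j < dim_vec (0\<^sub>v N)"
      then have j: "j < N" by simp
      have "col (BB @\<^sub>c K) j = col BB j" using j by (auto simp: append_cols_def intro!: eq_vecI)
      then show "(BB\<^sup>T *\<^sub>v w) $ j = 0\<^sub>v N $ j" using e[of j] j by simp
    qed simp
    moreover have "K\<^sup>T *\<^sub>v w = 0\<^sub>v r"
    proof (rule eq_vecI)
      fix j assume "j < dim_vec (0\<^sub>v r)"
      then have j: "j < r" by simp
      have "col (BB @\<^sub>c K) (N + j) = col K j" using j by (auto simp: append_cols_def intro!: eq_vecI)
      then show "(K\<^sup>T *\<^sub>v w) $ j = 0\<^sub>v r $ j" using e[of "N + j"] j by simp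
    qed simp
    ultimately show "w = 0\<^sub>v r" using minimal_no_left_null[OF min w(1) B0[OF w(1)] KTw[OF w(1)]] by blast
  qed
  show "vec_space.rank (N + r) (CC @\<^sub>r (A - z \<cdot>\<^sub>m E)) = r"
    unfolding K_def[symmetric]
  proof (rule rank_of_trivial_kernel)
    show "CC @\<^sub>r K \<in> carrier_mat (N + r) r" by (auto intro!: carrier_matI simp: append_rows_def)
    fix w assume w: "w \<in> carrier_vec r" "(CC @\<^sub>r K) *\<^sub>v w = 0\<^sub>v (N + r)"
    have e: "row (CC @\<^sub>r K) j \<bullet> w = 0" if "j < N + r" for j
      using arg_cong[OF w(2), of "\<lambda>v. vec_index v j"] that by (simp add: append_rows_def)
    have "CC *\<^sub>v w = 0\<^sub>v N"
    proof (rule eq_vecI)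
      fix j assume "j < dim_vec (0\<^sub>v N)"
      then have j: "j < N" by simp
      have "row (CC @\<^sub>r K) j = row CC j" using j by (auto simp: append_rows_def intro!: eq_vecI)
      then show "(CC *\<^sub>v w) $ j = 0\<^sub>v N $ j" using e[of j] j by simp
    qed simp
    moreover have "K *\<^sub>v w = 0\<^sub>v r"
    proof (rule eq_vecI)
      fix j assume "j < dim_vec (0\<^sub>v r)"
      then have j: "j < r" by simp
      have "row (CC @\<^sub>r K) (N + j) = row K j" using j by (auto simp: append_rows_def intro!: eq_vecI)
      then show "(K *\<^sub>v w) $ j = 0\<^sub>v r $ j" using e[of "N + j"] j by simp
    qed simp
    ultimately show "w = 0\<^sub>v r" using minimal_no_right_null[OF min w(1) C0[OF w(1)] Kw[OF w(1)]] by blast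
  qed
qed

text \<open>
  The matrices assigned to the outer tuples are constant, nonsingular and the identity on the state
  coordinates, so they merge with the outer factors of the Fiedler pencil.
\<close>

lemma GFPR_factor:
  assumes Ac: "\<And>i. i \<le> Suc k \<Longrightarrow> Ac i \<in> sq_mat n"
    and AE: "A \<in> sq_mat r" "E \<in> sq_mat r" and B: "B \<in> carrier_mat r n" and C: "C \<in> carrier_mat n r"
    and data: "GFPR_data n (Suc k) h \<sigma> \<tau> \<sigma>1 \<sigma>2 \<tau>1 \<tau>2 X1 X2 Y1 Y2"
    and nons: "nonsingular_assignment (Suc k) \<sigma>1 X1" "nonsingular_assignment (Suc k) \<sigma>2 X2"
      "nonsingular_assignment (Suc k) \<tau>1 Y1" "nonsingular_assignment (Suc k) \<tau>2 Y2"
  shows "\<exists>Z1 Z2 side. Z1 \<in> sq_mat (n + k * n) \<and> Z2 \<in> sq_mat (n + k * n) \<and> det Z1 \<noteq> 0 \<and> det Z2 \<noteq> 0 \<and>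
    GFPR n (Suc k) r Ac A E B C \<sigma> \<tau> \<sigma>1 \<sigma>2 \<tau>1 \<tau>2 X1 X2 Y1 Y2 =
      lam \<cdot>\<^sub>m const_mat ((Z1 \<boxplus> 1\<^sub>m r) * ((Ac (Suc k) \<boxplus> 1\<^sub>m (k * n)) \<boxplus> - E) * (Z2 \<boxplus> 1\<^sub>m r))
      - const_mat ((Z1 \<boxplus> 1\<^sub>m r) * nested n r (core_block (Ac 0) A B C) side (\<lambda>i. - Ac i) k * (Z2 \<boxplus> 1\<^sub>m r))"
proof -
  let ?p = "n + k * n"
  have h: "h \<le> k" and \<sigma>: "is_perm_of \<sigma> {0..int h}" and \<tau>: "is_perm_of \<tau> {- int (Suc k)..- int h - 1}"
    using data by (auto simp: GFPR_data_def)
  have ma: "matrix_assignment n \<sigma>1 X1" "matrix_assignment n \<sigma>2 X2" "matrix_assignment n \<tau>1 Y1" "matrix_assignment n \<tau>2 Y2"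
    using data by (auto simp: GFPR_data_def)
  have sub1: "set \<sigma>1 \<subseteq> {0..int h - 1}" "set \<sigma>2 \<subseteq> {0..int h - 1}" "set \<tau>1 \<subseteq> {- int (Suc k)..- int h - 2}" "set \<tau>2 \<subseteq> {- int (Suc k)..- int h - 2}"
    using data by (auto simp only: GFPR_data_def)
  have "{0..int h - 1} \<subseteq> {- int (Suc k)..int k}" "{- int (Suc k)..- int h - 2} \<subseteq> {- int (Suc k)..int k}" using h by auto
  then have sub: "set \<sigma>1 \<subseteq> {- int (Suc k)..int k}" "set \<sigma>2 \<subseteq> {- int (Suc k)..int k}" "set \<tau>1 \<subseteq> {- int (Suc k)..int k}" "set \<tau>2 \<subseteq> {- int (Suc k)..int k}"
    using sub1 by blast+
  obtain S1 where S1: "S1 \<in> sq_mat ?p" "det S1 \<noteq> 0" "elem_prod n (Suc k) r \<sigma>1 X1 = S1 \<boxplus> 1\<^sub>m r"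
    using elem_prod_nonsingular[OF ma(1) sub(1) nons(1)] by blast
  obtain S2 where S2: "S2 \<in> sq_mat ?p" "det S2 \<noteq> 0" "elem_prod n (Suc k) r \<sigma>2 X2 = S2 \<boxplus> 1\<^sub>m r"
    using elem_prod_nonsingular[OF ma(2) sub(2) nons(2)] by blast
  obtain T1 where T1: "T1 \<in> sq_mat ?p" "det T1 \<noteq> 0" "elem_prod n (Suc k) r \<tau>1 Y1 = T1 \<boxplus> 1\<^sub>m r"
    using elem_prod_nonsingular[OF ma(3) sub(3) nons(3)] by blast
  obtain T2 where T2: "T2 \<in> sq_mat ?p" "det T2 \<noteq> 0" "elem_prod n (Suc k) r \<tau>2 Y2 = T2 \<boxplus> 1\<^sub>m r"
    using elem_prod_nonsingular[OF ma(4) sub(4) nons(4)] by blast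
  let ?D = "(Ac (Suc k) \<boxplus> 1\<^sub>m (k * n)) \<boxplus> - E"
  obtain W1 W2 side where W: "W1 \<in> sq_mat ?p" "W2 \<in> sq_mat ?p" "det W1 \<noteq> 0" "det W2 \<noteq> 0"
    and f1: "fiedler_prod n (Suc k) r Ac A E B C \<tau> = (W1 \<boxplus> 1\<^sub>m r) * ?D * (W2 \<boxplus> 1\<^sub>m r)"
    and f2: "fiedler_prod n (Suc k) r Ac A E B C \<sigma> = (W1 \<boxplus> 1\<^sub>m r) * nested n r (core_block (Ac 0) A B C) side (\<lambda>i. - Ac i) k * (W2 \<boxplus> 1\<^sub>m r)"
    using fiedler_pencil_factor[where Ac = Ac, OF AE B C Ac \<sigma> \<tau> h] by blast
  define N where "N = nested n r (core_block (Ac 0) A B C) side (\<lambda>i. - Ac i) k"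
  have N: "N \<in> sq_mat (n + (k * n + r))" unfolding N_def
    by (rule nested_carrier) (use core_block_carrier[where Ac = Ac, OF AE B C Ac[of 0]] Ac in auto)
  note dims = N S1(1) S2(1) T1(1) T2(1) W(1) W(2) AE(2) Ac[of "Suc k", simplified]
  note [simp] = dims[THEN carrier_matD(1)] dims[THEN carrier_matD(2)]
  define Z1 where "Z1 = T1 * S1 * W1"
  define Z2 where "Z2 = W2 * S2 * T2"
  have Z: "Z1 \<in> sq_mat ?p" "Z2 \<in> sq_mat ?p" by (auto simp: Z1_def Z2_def intro!: carrier_matI)
  have TS: "T1 * S1 \<in> sq_mat ?p" "W2 * S2 \<in> sq_mat ?p" by (auto intro!: carrier_matI)
  have detZ: "det Z1 \<noteq> 0" "det Z2 \<noteq> 0"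
    unfolding Z1_def Z2_def det_mult[OF TS(1) W(1)] det_mult[OF T1(1) S1(1)] det_mult[OF TS(2) T2(1)] det_mult[OF W(2) S2(1)]
    using S1 S2 T1 T2 W by simp_all
  have z1: "Z1 \<boxplus> 1\<^sub>m r = (T1 \<boxplus> 1\<^sub>m r) * (S1 \<boxplus> 1\<^sub>m r) * (W1 \<boxplus> 1\<^sub>m r)"
    and z2: "Z2 \<boxplus> 1\<^sub>m r = (W2 \<boxplus> 1\<^sub>m r) * (S2 \<boxplus> 1\<^sub>m r) * (T2 \<boxplus> 1\<^sub>m r)"
    by (simp_all add: Z1_def Z2_def dsum_mult_dim)
  have "GFPR n (Suc k) r Ac A E B C \<sigma> \<tau> \<sigma>1 \<sigma>2 \<tau>1 \<tau>2 X1 X2 Y1 Y2 =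
      lam \<cdot>\<^sub>m const_mat ((Z1 \<boxplus> 1\<^sub>m r) * ?D * (Z2 \<boxplus> 1\<^sub>m r)) - const_mat ((Z1 \<boxplus> 1\<^sub>m r) * N * (Z2 \<boxplus> 1\<^sub>m r))"
    unfolding GFPR_def S1(3) S2(3) T1(3) T2(3) f1 f2 N_def[symmetric] z1 z2
    by (simp add: const_mat_mult mat_dim_simps)
  then show ?thesis using Z detZ unfolding N_def by blast
qed

lemma pencil_blocks:
  assumes "Y0 = Y11 \<boxplus> - E" "Y11 \<in> sq_mat p" "E \<in> sq_mat r"
    and "X0 = four_block_mat a b c d" "a \<in> sq_mat p" "b \<in> carrier_mat p r" "c \<in> carrier_mat r p" "d \<in> sq_mat r"
  shows "lam \<cdot>\<^sub>m const_mat Y0 - const_mat X0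
    = four_block_mat (pencil (- a) (- Y11)) (const_mat (- b)) (const_mat (- c)) (pencil (- d) E)"
  using assms by (auto intro!: eq_matI simp: pencil_def dsum_def)

theorem theorem3p21:
  fixes n m r h :: nat
    and Ac :: "nat \<Rightarrow> complex mat"
    and A E B C :: "complex mat"
    and G :: "complex poly fract mat"
    and \<sigma> \<tau> \<sigma>1 \<sigma>2 \<tau>1 \<tau>2 :: "int list"
    and X1 X2 Y1 Y2 :: "complex mat list"
  assumes "m \<ge> 1"
    and "\<And>i. i \<le> m \<Longrightarrow> Ac i \<in> carrier_mat n n"
    and "Ac m \<noteq> 0\<^sub>m n n"
    and "minimal_realization n r G (matrix_poly n m Ac) A E B C"
    and "GFPR_data n m h \<sigma> \<tau> \<sigma>1 \<sigma>2 \<tau>1 \<tau>2 X1 X2 Y1 Y2"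
    and "nonsingular_assignment m \<sigma>1 X1" and "nonsingular_assignment m \<sigma>2 X2"
    and "nonsingular_assignment m \<tau>1 Y1" and "nonsingular_assignment m \<tau>2 Y2"
  shows "rosenbrock_strong_linearization n m r G
           (system_matrix (matrix_poly n m Ac) A E B C)
           (GFPR n m r Ac A E B C \<sigma> \<tau> \<sigma>1 \<sigma>2 \<tau>1 \<tau>2 X1 X2 Y1 Y2)"
proof -
  obtain k where m: "m = Suc k" using assms(1) by (cases m) auto
  let ?p = "n + k * n" and ?P = "matrix_poly n (Suc k) Ac"
  let ?S = "system_matrix ?P A E B C" and ?L = "GFPR n (Suc k) r Ac A E B C \<sigma> \<tau> \<sigma>1 \<sigma>2 \<tau>1 \<tau>2 X1 X2 Y1 Y2"
  have Ac: "\<And>i. i \<le> Suc k \<Longrightarrow> Ac i \<in> sq_mat n" using assms(2) by (simp add: m)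
  have min: "minimal_realization n r G ?P A E B C" using assms(4) by (simp add: m)
  have AE: "A \<in> sq_mat r" "E \<in> sq_mat r" and B: "B \<in> carrier_mat r n" and C: "C \<in> carrier_mat n r"
    and detE: "det E \<noteq> 0" and G: "G = transfer_function ?P A E B C"
    using min unfolding minimal_realization_def realization_def by blast+
  note data = assms(5)[unfolded m] and nons = assms(6-9)[unfolded m]
  define N where "N = (\<lambda>side. nested n r (core_block (Ac 0) A B C) side (\<lambda>i. - Ac i) k)"
  let ?D11 = "Ac (Suc k) \<boxplus> 1\<^sub>m (k * n)"
  obtain Z1 Z2 side where Z: "Z1 \<in> sq_mat ?p" "Z2 \<in> sq_mat ?p" "det Z1 \<noteq> 0" "det Z2 \<noteq> 0"
    and L: "?L = lam \<cdot>\<^sub>m const_mat ((Z1 \<boxplus> 1\<^sub>m r) * (?D11 \<boxplus> - E) * (Z2 \<boxplus> 1\<^sub>m r))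
      - const_mat ((Z1 \<boxplus> 1\<^sub>m r) * N side * (Z2 \<boxplus> 1\<^sub>m r))"
    using GFPR_factor[where Ac = Ac, OF Ac AE B C data nons] unfolding N_def by blast
  have base: "core_block (Ac 0) A B C \<in> sq_mat (n + r)" by (rule core_block_carrier[OF AE B C]) (simp add: Ac)
  have negAc: "- Ac i \<in> sq_mat n" if "i \<le> k" for i using Ac[of i] that by simp
  have "N side \<in> sq_mat (n + (k * n + r))"
    unfolding N_def by (rule nested_carrier) (rule base, rule negAc)
  then have N: "N side \<in> sq_mat (?p + r)" by (simp add: add.assoc)
  have D: "?D11 \<in> sq_mat ?p" using Ac[of "Suc k"] by (intro dsum_carrier) auto
  note Z1i = mat_inv_props[OF Z(1,3)] and Z2i = mat_inv_props[OF Z(2,4)]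
  have detZi: "det (mat_inv Z1) \<noteq> 0" "det (mat_inv Z2) \<noteq> 0"
    using det_mult[OF Z(1) Z1i(1)] det_mult[OF Z(2) Z2i(1)] unfolding Z1i(2) Z2i(2) by auto
  note dims = Z(1) Z(2) N D AE(1) AE(2) B C Z1i(1) Z2i(1) Ac[of 0, simplified] Ac[of "Suc k", simplified]
  note [simp] = dims[THEN carrier_matD(1)] dims[THEN carrier_matD(2)]

  \<comment> \<open>the constant and the \<open>\<lambda>\<close>-part of the pencil; the latter has no off-diagonal blocks\<close>
  define X0 where "X0 = (Z1 \<boxplus> 1\<^sub>m r) * N side * (Z2 \<boxplus> 1\<^sub>m r)"
  define Y11 where "Y11 = Z1 * ?D11 * Z2"
  have Y11: "Y11 \<in> sq_mat ?p" by (auto simp: Y11_def intro!: carrier_matI)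
  have Y0: "(Z1 \<boxplus> 1\<^sub>m r) * (?D11 \<boxplus> - E) * (Z2 \<boxplus> 1\<^sub>m r) = Y11 \<boxplus> - E"
    by (simp add: dsum_mult_dim Y11_def mat_one_zero_dim)
  have "X0 \<in> sq_mat (?p + r)" by (auto simp: X0_def intro!: carrier_matI)
  then obtain a b c d where abcd: "a \<in> sq_mat ?p" "b \<in> carrier_mat ?p r" "c \<in> carrier_mat r ?p" "d \<in> sq_mat r"
    and X0: "X0 = four_block_mat a b c d" by (rule four_block_cases)
  define CC where "CC = - b"
  define BB where "BB = - c"
  have CC: "CC \<in> carrier_mat ?p r" and BB: "BB \<in> carrier_mat r ?p" using abcd by (auto simp: CC_def BB_def)
  have Lblock: "?L = four_block_mat (pencil (- a) (- Y11)) (const_mat CC) (const_mat BB) (pencil (- d) E)"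
    unfolding L Y0 X0_def[symmetric] CC_def BB_def
    by (rule pencil_blocks[OF refl Y11 AE(2) X0 abcd])
  have pc: "pencil (- a) (- Y11) \<in> sq_mat ?p" "const_mat CC \<in> carrier_mat ?p r" "const_mat BB \<in> carrier_mat r ?p" "pencil (- d) E \<in> sq_mat r"
    using abcd Y11 CC BB AE by (auto simp: pencil_def intro!: minus_carrier_mat)

  \<comment> \<open>condition (i): the finite reduction, with the constant factors \<open>Z1\<close> and \<open>Z2\<close> absorbed into \<open>U\<close> and \<open>V\<close>\<close>
  let ?cN = "nested n r (const_mat (core_block (Ac 0) A B C)) side (\<lambda>i. const_mat (- Ac i)) k"
  have cN: "const_mat (N side) = ?cN" unfolding N_def
    by (rule const_h.map_nested[OF base]) (rule negAc)
  let ?F = "lam \<cdot>\<^sub>m (const_mat ?D11 \<boxplus> const_mat (- E)) - const_mat (N side)"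
  have cone: "const_mat (1\<^sub>m i) = 1\<^sub>m i" for i by (rule const_h.mat_hom_one)
  have LF: "?L = (const_mat Z1 \<boxplus> 1\<^sub>m r) * ?F * (const_mat Z2 \<boxplus> 1\<^sub>m r)"
    unfolding L by (simp add: const_mat_mult map_dsum cone mat_dim_simps)
  have czero: "const_mat (0\<^sub>m i j) = 0\<^sub>m i j" for i j by (rule eq_matI) auto
  have Fd: "dim_row ?F = ?p + r" "dim_col ?F = ?p + r" by simp_all

  have cbase: "const_mat (core_block (Ac 0) A B C) \<in> sq_mat (n + r)" using base by simp
  have cX: "\<And>i. i \<le> k \<Longrightarrow> const_mat (- Ac i) \<in> sq_mat n" using negAc by simp
  have cL: "const_mat (Ac (Suc k)) \<in> sq_mat n" using Ac by simp
  have cE: "const_mat (- E) \<in> sq_mat r" by (auto intro!: carrier_matI)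
  let ?H = "horner lam (\<lambda>i. const_mat (- Ac i)) k (const_mat (Ac (Suc k)))"
  have H: "?H \<in> sq_mat n" by (rule horner_carrier) (use cL cX in auto)
  have "\<exists>U V. U \<in> sq_mat ?p \<and> V \<in> sq_mat ?p \<and> det U dvd 1 \<and> det V dvd 1 \<and>
    (U \<boxplus> 1\<^sub>m r) * (lam \<cdot>\<^sub>m (const_mat (Ac (Suc k)) \<boxplus> 1\<^sub>m (k * n) \<boxplus> const_mat (- E)) - ?cN) * (V \<boxplus> 1\<^sub>m r)
     = 1\<^sub>m (k * n) \<boxplus> (lam \<cdot>\<^sub>m (?H \<boxplus> const_mat (- E)) - const_mat (core_block (Ac 0) A B C))"
    by (rule finite_reduction) (use cbase cX cL cE in auto)
  then obtain U V where U: "U \<in> sq_mat ?p" "det U dvd 1" and V: "V \<in> sq_mat ?p" "det V dvd 1"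
    and red: "(U \<boxplus> 1\<^sub>m r) * (lam \<cdot>\<^sub>m (const_mat (Ac (Suc k)) \<boxplus> 1\<^sub>m (k * n) \<boxplus> const_mat (- E)) - ?cN) * (V \<boxplus> 1\<^sub>m r)
     = 1\<^sub>m (k * n) \<boxplus> (lam \<cdot>\<^sub>m (?H \<boxplus> const_mat (- E)) - const_mat (core_block (Ac 0) A B C))"
    by blast
  note [simp] = carrier_matD[OF U(1)] carrier_matD[OF V(1)] carrier_matD[OF H]
  have P: "?P = lam \<cdot>\<^sub>m ?H - const_mat (- Ac 0)" by (rule matrix_poly_horner) (rule Ac)
  have Pc: "?P \<in> sq_mat n" by (simp add: matrix_poly_def)
  have S: "lam \<cdot>\<^sub>m (?H \<boxplus> const_mat (- E)) - const_mat (core_block (Ac 0) A B C) = ?S"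
    unfolding system_matrix_def P by (rule eq_matI) (auto simp: core_block_def dsum_def pencil_def)
  have F': "lam \<cdot>\<^sub>m (const_mat (Ac (Suc k)) \<boxplus> 1\<^sub>m (k * n) \<boxplus> const_mat (- E)) - ?cN = ?F"
    unfolding cN[symmetric] by (simp add: map_dsum cone dsum_assoc)
  have redF: "(U \<boxplus> 1\<^sub>m r) * ?F * (V \<boxplus> 1\<^sub>m r) = 1\<^sub>m (k * n) \<boxplus> ?S"
    using red unfolding F' S .
  define U' where "U' = U * const_mat (mat_inv Z1)"
  define V' where "V' = const_mat (mat_inv Z2) * V"
  have U'V': "U' \<in> sq_mat ?p" "V' \<in> sq_mat ?p" by (auto simp: U'_def V'_def intro!: carrier_matI)
  have cdet: "det (const_mat M) dvd 1" if "det M \<noteq> 0" for M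
    unfolding const_h.hom_det using that by (simp add: is_unit_pCons_iff)
  have uni: "unimodular ?p U'" "unimodular ?p V'"
    unfolding U'_def V'_def
    by (intro unimodular_of_unit_det mult_carrier_mat[of _ _ ?p] unit_det_mult[of _ ?p] U V cdet detZi; use Z1i(1) Z2i(1) in simp)+
  have "(U' \<boxplus> 1\<^sub>m r) * ?L * (V' \<boxplus> 1\<^sub>m r) = (U \<boxplus> 1\<^sub>m r) * ?F * (V \<boxplus> 1\<^sub>m r)"
  proof -
    have i: "const_mat (mat_inv Z1) * const_mat Z1 = 1\<^sub>m ?p" "const_mat Z2 * const_mat (mat_inv Z2) = 1\<^sub>m ?p"
      using Z1i(3) Z2i(2) by (simp_all add: const_mat_mult[symmetric] cone)
    have u: "(U' \<boxplus> 1\<^sub>m r) * (const_mat Z1 \<boxplus> 1\<^sub>m r) = U \<boxplus> 1\<^sub>m r"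
      unfolding U'_def by (simp add: dsum_mult_dim mat_assoc_dim i mat_one_zero_dim)
    have "const_mat Z2 * V' = (const_mat Z2 * const_mat (mat_inv Z2)) * V" unfolding V'_def by (simp add: mat_assoc_dim)
    then have v: "(const_mat Z2 \<boxplus> 1\<^sub>m r) * (V' \<boxplus> 1\<^sub>m r) = V \<boxplus> 1\<^sub>m r"
      using U'V'(2) unfolding i(2) by (simp add: dsum_mult_dim mat_one_zero_dim)
    have "(U' \<boxplus> 1\<^sub>m r) * ?L * (V' \<boxplus> 1\<^sub>m r)
      = ((U' \<boxplus> 1\<^sub>m r) * (const_mat Z1 \<boxplus> 1\<^sub>m r)) * ?F * ((const_mat Z2 \<boxplus> 1\<^sub>m r) * (V' \<boxplus> 1\<^sub>m r))"
      unfolding LF using carrier_matD[OF U'V'(1)] carrier_matD[OF U'V'(2)] by (simp add: mat_assoc_dim)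
    then show ?thesis unfolding u v .
  qed
  then have part1: "(U' \<boxplus> 1\<^sub>m r) * ?L * (V' \<boxplus> 1\<^sub>m r) = 1\<^sub>m (k * n) \<boxplus> ?S" unfolding redF .

  \<comment> \<open>comparing blocks in this equivalence identifies the state block and the off-diagonal blocks\<close>
  have Sc: "?P \<in> sq_mat n" "const_mat C \<in> carrier_mat n r" "const_mat B \<in> carrier_mat r n" "pencil A E \<in> sq_mat r"
    using Pc AE B C by (auto simp: pencil_def intro!: minus_carrier_mat)
  let ?Ce = "four_block_mat (0\<^sub>m (k * n) 0) (0\<^sub>m (k * n) r) (0\<^sub>m n 0) (const_mat C)"
  let ?Be = "four_block_mat (0\<^sub>m 0 (k * n)) (0\<^sub>m 0 n) (0\<^sub>m r (k * n)) (const_mat B)"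
  have "four_block_mat (U' * pencil (- a) (- Y11) * V') (U' * const_mat CC) (const_mat BB * V') (pencil (- d) E)
    = four_block_mat (1\<^sub>m (k * n) \<boxplus> ?P) ?Ce ?Be (pencil A E)"
    using part1 unfolding Lblock dsum_one_sandwich[OF U'V' pc] system_matrix_def one_dsum_four_block[OF Sc] .
  note blocks = four_block_eqD[OF this, of ?p ?p r r]
  have eqs: "U' * const_mat CC = ?Ce" "const_mat BB * V' = ?Be" "pencil (- d) E = pencil A E"
    by (rule blocks; use U'V' pc Sc CC BB Pc in \<open>auto intro!: carrier_matI mult_carrier_mat[of _ _ ?p]\<close>)+
  have dA: "- d = A"
  proof (rule eq_matI)
    fix i j assume ij: "i < dim_row A" "j < dim_col A"
    then show "(- d) $$ (i, j) = A $$ (i, j)"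
      using arg_cong[OF eqs(3), of "\<lambda>M. M $$ (i, j)"] abcd(4) by (simp add: pencil_def)
  qed (use abcd in auto)
  have L2: "?L = four_block_mat (pencil (- a) (- Y11)) (const_mat CC) (const_mat BB) (pencil A E)"
    using Lblock unfolding eqs(3) .

  have B0: "B\<^sup>T *\<^sub>v w = 0\<^sub>v n" if w: "w \<in> carrier_vec r" "BB\<^sup>T *\<^sub>v w = 0\<^sub>v ?p" for w
  proof (rule eq_vecI)
    \<comment> \<open>as a \<open>1 \<times> r\<close> matrix \<open>w\<close> can be multiplied through the identity \<open>BB V = [0 B]\<close>\<close>
    define W where "W = mat_of_rows r [w]"
    have W: "W \<in> carrier_mat 1 r" by (simp add: W_def mat_of_rows_def)
    have row: "row W 0 = w" using w(1) by (simp add: W_def)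
    note [simp] = carrier_matD[OF W] carrier_matD[OF BB] carrier_matD[OF U'V'(2)]
    have "W * BB = 0\<^sub>m 1 ?p"
    proof (rule eq_matI)
      fix i j assume "i < dim_row (0\<^sub>m 1 ?p)" "j < dim_col (0\<^sub>m 1 ?p)"
      then have ij: "i = 0" "j < ?p" by auto
      have "col BB j \<bullet> w = 0" using arg_cong[OF w(2), of "\<lambda>v. vec_index v j"] ij by simp
      then show "(W * BB) $$ (i, j) = 0\<^sub>m 1 ?p $$ (i, j)"
        using ij row w(1) comm_scalar_prod[of w r "col BB j"] BB by auto
    qed auto
    then have "const_mat W * const_mat BB = 0\<^sub>m 1 ?p" by (simp add: const_mat_mult[symmetric] czero)
    then have "const_mat W * ?Be = 0\<^sub>m 1 ?p"
      unfolding eqs(2)[symmetric] by (simp add: mat_assoc_dim[symmetric] mat_one_zero_dim)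
    fix j assume "j < dim_vec (0\<^sub>v n)"
    then have j: "j < n" by simp
    have "0 = (const_mat W * ?Be) $$ (0, k * n + j)" using \<open>const_mat W * ?Be = _\<close> j by simp
    also have "\<dots> = row (const_mat W) 0 \<bullet> col ?Be (k * n + j)" using j by simp
    also have "col ?Be (k * n + j) = col (const_mat B) j" using j by (auto intro!: eq_vecI)
    also have "row (const_mat W) 0 \<bullet> col (const_mat B) j = (const_mat W * const_mat B) $$ (0, j)" using j by simp
    also have "\<dots> = const_mat (W * B) $$ (0, j)" by (simp add: const_mat_mult)
    also have "\<dots> = [:w \<bullet> col B j:]" using j row by simp
    finally have "w \<bullet> col B j = 0" by simp
    then show "(B\<^sup>T *\<^sub>v w) $ j = 0\<^sub>v n $ j" using j w(1) comm_scalar_prod[of w r "col B j"] B by simp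
  qed (use B in simp)
  have C0: "C *\<^sub>v w = 0\<^sub>v n" if w: "w \<in> carrier_vec r" "CC *\<^sub>v w = 0\<^sub>v ?p" for w
  proof (rule eq_vecI)
    define W where "W = mat_of_cols r [w]"
    have W: "W \<in> carrier_mat r 1" by (simp add: W_def mat_of_cols_def)
    have col: "col W 0 = w" using w(1) by (simp add: W_def)
    note [simp] = carrier_matD[OF W] carrier_matD[OF CC] carrier_matD[OF U'V'(1)]
    have "CC * W = 0\<^sub>m ?p 1"
    proof (rule eq_matI)
      fix i j assume "i < dim_row (0\<^sub>m ?p 1)" "j < dim_col (0\<^sub>m ?p 1)"
      then have ij: "j = 0" "i < ?p" by auto
      have "row CC i \<bullet> w = 0" using arg_cong[OF w(2), of "\<lambda>v. vec_index v i"] ij by simp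
      then show "(CC * W) $$ (i, j) = 0\<^sub>m ?p 1 $$ (i, j)" using ij col by simp
    qed auto
    then have "const_mat CC * const_mat W = 0\<^sub>m ?p 1" by (simp add: const_mat_mult[symmetric] czero)
    then have "?Ce * const_mat W = 0\<^sub>m ?p 1"
      unfolding eqs(1)[symmetric] by (simp add: mat_assoc_dim mat_one_zero_dim)
    fix j assume "j < dim_vec (0\<^sub>v n)"
    then have j: "j < n" by simp
    have "0 = (?Ce * const_mat W) $$ (k * n + j, 0)" using \<open>?Ce * const_mat W = _\<close> j by simp
    also have "\<dots> = row ?Ce (k * n + j) \<bullet> col (const_mat W) 0" using j by simp
    also have "row ?Ce (k * n + j) = row (const_mat C) j" using j by (auto intro!: eq_vecI)
    also have "row (const_mat C) j \<bullet> col (const_mat W) 0 = (const_mat C * const_mat W) $$ (j, 0)" using j by simp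
    also have "\<dots> = const_mat (C * W) $$ (j, 0)" by (simp add: const_mat_mult)
    also have "\<dots> = [:row C j \<bullet> w:]" using j col by simp
    finally have "row C j \<bullet> w = 0" by simp
    then show "(C *\<^sub>v w) $ j = 0\<^sub>v n $ j" using j by simp
  qed (use C in simp)
  have irr: "irreducible_pencil ?p r BB CC A E"
    by (rule irreducible_of_minimal[OF min BB CC]) (rule B0 C0; assumption)+

  \<comment> \<open>condition (ii): the transfer function is the Schur complement with \<open>R = (\<lambda>E - A)\<^sup>-\<^sup>1\<close>, negated because the state block of the pencil is \<open>A - \<lambda>E\<close>\<close>
  let ?R = "mat_inv (rat_pencil A E)" and ?\<mu> = "inverse (to_fract lam)"
  note R = mat_inv_props[OF rat_pencil(2)[OF AE] rat_pencil_inverse(1)[OF AE detE]]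
  note [simp] = carrier_matD[OF R(1)]
  let ?T = "transfer_function (pencil (- a) (- Y11)) A E BB CC"
  let ?hN = "nested n r (rconst (core_block (Ac 0) A B C)) side (\<lambda>i. rconst (- Ac i)) k"
  have hN: "rat_mat (const_mat (N side)) = ?hN" unfolding cN rconst_def
    by (rule rat_h.map_nested[OF cbase]) (rule cX)
  have hNc: "?hN \<in> sq_mat (?p + r)" unfolding hN[symmetric] using N by simp
  have T: "?T = schur ?p (- ?R) (rat_mat ?L)"
  proof -
    have "rat_mat ?L = four_block_mat (rat_mat (pencil (- a) (- Y11))) (rconst CC) (rconst BB) (rat_mat (pencil A E))"
      unfolding L2 rconst_def using pc eqs(3) by (subst map_four_block_mat) auto
    moreover have "schur ?p (- ?R) (four_block_mat (rat_mat (pencil (- a) (- Y11))) (rconst CC) (rconst BB) (rat_mat (pencil A E)))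
       = rat_mat (pencil (- a) (- Y11)) - rconst CC * (- ?R) * rconst BB"
      by (rule schur_four_block[of _ _ _ r]) (use pc eqs(3) CC BB in \<open>auto intro!: carrier_matI\<close>)
    moreover have "rat_mat (pencil (- a) (- Y11)) - rconst CC * (- ?R) * rconst BB = ?T"
      unfolding transfer_function_rat using pc CC BB by (auto intro!: eq_matI simp: mat_uminus_dim)
    ultimately show ?thesis by simp
  qed
  have hatLF: "rat_mat ?L = (rconst Z1 \<boxplus> 1\<^sub>m r) * (to_fract lam \<cdot>\<^sub>m (rconst ?D11 \<boxplus> rconst (- E)) - ?hN) * (rconst Z2 \<boxplus> 1\<^sub>m r)"
  proof -
    have "rat_mat ?L = (rconst Z1 \<boxplus> 1\<^sub>m r) * rat_mat ?F * (rconst Z2 \<boxplus> 1\<^sub>m r)"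
      unfolding LF by (simp add: rat_mat_mult map_dsum rconst_def rat_h.mat_hom_one)
    moreover have "rat_mat ?F = to_fract lam \<cdot>\<^sub>m (rconst ?D11 \<boxplus> rconst (- E)) - rat_mat (const_mat (N side))"
      by (rule eq_matI) (auto simp: rconst_def dsum_def)
    ultimately show ?thesis unfolding hN by simp
  qed
  define Fr where "Fr = schur ?p ?R ?hN"
  have hbase: "rconst (core_block (Ac 0) A B C) \<in> sq_mat (n + r)" using base by (simp add: rconst_def)
  have "schur n ?R (rconst (core_block (Ac 0) A B C)) = rconst (- Ac 0) - rconst (- C) * ?R * rconst (- B)"
  proof -
    have "rconst (core_block (Ac 0) A B C) = four_block_mat (rconst (- Ac 0)) (rconst (- C)) (rconst (- B)) (rconst (- A))"
      unfolding core_block_def by (rule eq_matI) (auto simp: rconst_def)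
    then show ?thesis by (simp only:) (rule schur_four_block[of _ _ _ r]; auto intro!: carrier_matI)
  qed
  also have "\<dots> = - rconst (Ac 0) - rconst C * ?R * rconst B"
  proof -
    show ?thesis by (simp add: rconst_uminus mat_uminus_dim uminus_uminus_mat)
  qed
  finally have sb: "schur n ?R (rconst (core_block (Ac 0) A B C)) = - rconst (Ac 0) - rconst C * ?R * rconst B" .
  have Fr: "Fr = nested n 0 (- rconst (Ac 0) - rconst C * ?R * rconst B) side (\<lambda>i. rconst (- Ac i)) k"
  proof -
    have "schur (n + k * n) ?R ?hN = nested n 0 (schur n ?R (rconst (core_block (Ac 0) A B C))) side (\<lambda>i. rconst (- Ac i)) k"
      by (rule schur_nested[OF hbase _ R(1)]) (use negAc in \<open>auto simp: rconst_def\<close>)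
    then show ?thesis unfolding Fr_def sb .
  qed
  have Frc: "Fr \<in> sq_mat ?p" unfolding Fr_def by (rule schur_carrier[OF hNc R(1)])
  have Tfac: "?T = rconst Z1 * (to_fract lam \<cdot>\<^sub>m rconst ?D11 - Fr) * rconst Z2"
  proof -
    obtain a' b' c' d' where q: "a' \<in> sq_mat ?p" "b' \<in> carrier_mat ?p r" "c' \<in> carrier_mat r ?p" "d' \<in> sq_mat r"
      and hNb: "?hN = four_block_mat a' b' c' d'" using four_block_cases[OF hNc] .
    note [simp] = carrier_matD[OF q(1)] carrier_matD[OF q(2)]
      carrier_matD[OF q(3)] carrier_matD[OF q(4)]
    have "to_fract lam \<cdot>\<^sub>m (rconst ?D11 \<boxplus> rconst (- E)) - ?hN
      = four_block_mat (to_fract lam \<cdot>\<^sub>m rconst ?D11 - a') (- b') (- c') (to_fract lam \<cdot>\<^sub>m rconst (- E) - d')"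
      unfolding hNb by (rule eq_matI) (auto simp: dsum_def)
    moreover have "schur ?p (- ?R) (four_block_mat (to_fract lam \<cdot>\<^sub>m rconst ?D11 - a') (- b') (- c') (to_fract lam \<cdot>\<^sub>m rconst (- E) - d'))
      = (to_fract lam \<cdot>\<^sub>m rconst ?D11 - a') - (- b') * (- ?R) * (- c')"
      by (rule schur_four_block[of _ _ _ r]) (auto intro!: carrier_matI)
    moreover have "(to_fract lam \<cdot>\<^sub>m rconst ?D11 - a') - (- b') * (- ?R) * (- c') = to_fract lam \<cdot>\<^sub>m rconst ?D11 - (a' - b' * ?R * c')"
      by (rule eq_matI) (auto simp: mat_uminus_dim uminus_uminus_mat)
    moreover have "Fr = a' - b' * ?R * c'" unfolding Fr_def hNb by (rule schur_four_block[OF q])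
    ultimately have s: "schur ?p (- ?R) (to_fract lam \<cdot>\<^sub>m (rconst ?D11 \<boxplus> rconst (- E)) - ?hN) = to_fract lam \<cdot>\<^sub>m rconst ?D11 - Fr" by simp
    have "schur ?p (- ?R) ((rconst Z1 \<boxplus> 1\<^sub>m r) * (to_fract lam \<cdot>\<^sub>m (rconst ?D11 \<boxplus> rconst (- E)) - ?hN) * (rconst Z2 \<boxplus> 1\<^sub>m r))
      = rconst Z1 * schur ?p (- ?R) (to_fract lam \<cdot>\<^sub>m (rconst ?D11 \<boxplus> rconst (- E)) - ?hN) * rconst Z2"
      by (rule schur_sandwich) (use hNc R(1) in \<open>auto intro!: carrier_matI\<close>)
    then show ?thesis unfolding T hatLF s .
  qed
  obtain Ol Or where O: "biproper ?p Ol" "biproper ?p Or" and Oeq: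
     "Ol * ((rconst (Ac (Suc k)) \<boxplus> 1\<^sub>m (k * n)) - ?\<mu> \<cdot>\<^sub>m Fr) * Or
      = 1\<^sub>m (k * n) \<boxplus> (inverse (to_fract lam ^ Suc k) \<cdot>\<^sub>m G)"
    using rational_reduction[where Ac = Ac, OF Ac AE B C detE Fr] unfolding G by blast
  note [simp] = carrier_matD[OF biproper_carrier[OF O(1)]] carrier_matD[OF biproper_carrier[OF O(2)]] carrier_matD[OF Frc]
  have bZ: "biproper ?p (rconst (mat_inv Z1))" "biproper ?p (rconst (mat_inv Z2))"
    unfolding rconst_def using biproper_const Z1i(1) Z2i(1) detZi by blast+
  have part2: "(Ol * rconst (mat_inv Z1)) * (?\<mu> \<cdot>\<^sub>m ?T) * (rconst (mat_inv Z2) * Or) = 1\<^sub>m (k * n) \<boxplus> (inverse (to_fract lam ^ Suc k) \<cdot>\<^sub>m G)"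
  proof -
    have i: "rconst (mat_inv Z1) * rconst Z1 = 1\<^sub>m ?p" "rconst Z2 * rconst (mat_inv Z2) = 1\<^sub>m ?p"
      using Z1i(3) Z2i(2) by (simp_all add: rconst_mult[symmetric])
    have hD: "?\<mu> \<cdot>\<^sub>m (to_fract lam \<cdot>\<^sub>m rconst ?D11 - Fr) = (rconst (Ac (Suc k)) \<boxplus> 1\<^sub>m (k * n)) - ?\<mu> \<cdot>\<^sub>m Fr"
      using lam_nonzero by (auto intro!: eq_matI simp: rconst_def dsum_def right_diff_distrib)
    have "(Ol * rconst (mat_inv Z1)) * (?\<mu> \<cdot>\<^sub>m ?T) * (rconst (mat_inv Z2) * Or)
      = Ol * (rconst (mat_inv Z1) * rconst Z1) * (?\<mu> \<cdot>\<^sub>m (to_fract lam \<cdot>\<^sub>m rconst ?D11 - Fr)) * (rconst Z2 * rconst (mat_inv Z2)) * Or"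
      unfolding Tfac by (simp add: mat_assoc_dim mat_smult_dim)
    also have "\<dots> = Ol * ((rconst (Ac (Suc k)) \<boxplus> 1\<^sub>m (k * n)) - ?\<mu> \<cdot>\<^sub>m Fr) * Or"
      unfolding i hD by (simp add: mat_one_zero_dim)
    finally show ?thesis unfolding Oeq .
  qed
  have part2': "biproper ?p (Ol * rconst (mat_inv Z1))" "biproper ?p (rconst (mat_inv Z2) * Or)"
    using O bZ by (auto intro: biproper_mult)
  have size: "Suc k * n = ?p" "(Suc k - 1) * n = k * n" by simp_all
  show ?thesis
    unfolding m rosenbrock_strong_linearization_def size diag_block_mat_dsum
  proof (rule exI[of _ "- a"], rule exI[of _ "- Y11"], rule exI[of _ CC], rule exI[of _ BB], rule exI[of _ A], rule exI[of _ E], intro conjI)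
    show "- a \<in> sq_mat ?p" "- Y11 \<in> sq_mat ?p" using abcd Y11 by auto
    show "CC \<in> carrier_mat ?p r" "BB \<in> carrier_mat r ?p" "A \<in> sq_mat r" "E \<in> sq_mat r" "det E \<noteq> 0"
      by (fact CC BB AE detE)+
    show "?L = four_block_mat (pencil (- a) (- Y11)) (const_mat CC) (const_mat BB) (pencil A E)" by (fact L2)
    show "irreducible_pencil ?p r BB CC A E" by (fact irr)
    show "\<exists>U V U0 V0. unimodular ?p U \<and> unimodular ?p V \<and> U0 \<in> sq_mat r \<and> det U0 \<noteq> 0 \<and> V0 \<in> sq_mat r \<and> det V0 \<noteq> 0 \<and>
          (U \<boxplus> const_mat U0) * ?L * (V \<boxplus> const_mat V0) = 1\<^sub>m (k * n) \<boxplus> ?S"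
      by (rule exI[of _ U'], rule exI[of _ V'], rule exI[of _ "1\<^sub>m r"], rule exI[of _ "1\<^sub>m r"])
        (simp add: uni cone part1)
    show "\<exists>Ol Or. biproper ?p Ol \<and> biproper ?p Or \<and>
          Ol * (inverse (to_fract lam) \<cdot>\<^sub>m ?T) * Or = 1\<^sub>m (k * n) \<boxplus> (inverse (to_fract lam ^ Suc k) \<cdot>\<^sub>m G)"
      using part2 part2' by blast
  qed
qed

end
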